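(* Let $a,b$ satisfy the Lipschitz condition and the linear-growth bound stated in the context, and let $(\boldsymbol U,\boldsymbol Y)$ be the maximally extended strong DO solution with initial datum $(\boldsymbol U_0,\boldsymbol Y_0)$, where $\boldsymbol U_0\in\mathbb R^{R\times d}$ has orthonormal rows and $\boldsymbol Y_0\in L^2(\Omega;\mathbb R^R)$ is $\mathscr F_0$-measurable with linearly independent components. Let $\tau_n$ be defined as in the context. Then either $T_e=\lim_{n\to\infty}\tau_n=\infty$ or $T_e<\infty$; and if $T_e<\infty$, we necessarily have $$\lim_{t\uparrow T_e}\|C_{\boldsymbol Y_t}^{-1}\|_{\mathrm F}=\infty.$$
   Context: Let $(\Omega,\mathscr F,\mathbb P;(\mathscr F_t)_{t\ge0})$ be a filtered complete probability space with the usual conditions and $W$ a standard $m$-dimensional $(\mathscr F_t)$-Brownian motion. $|\cdot|$ is the Euclidean norm, $\|\cdot\|_{\mathrm F}$ the Frobenius norm, and $R\le d$ are positive integers. $a:[0,\infty)\times\mathbb R^d\to\mathbb R^d$ and $b:[0,\infty)\times\mathbb R^d\to\mathbb R^{d\times m}$ are jointly measurable. Lipschitz condition: for some $C_{\mathrm{Lip}}>0$, $|a(s,x)-a(s,y)|\le C_{\mathrm{Lip}}|x-y|$ and $\|b(s,x)-b(s,y)\|_{\mathrm F}\le C_{\mathrm{Lip}}|x-y|$ for all $s\geq 0$, $x,y\in\mathbb R^d$. Linear-growth bound: for some $C_{\mathrm{lgb}}>0$, $|a(s,x)|^2+\|b(s,x)\|_{\mathrm F}^2\le C_{\mathrm{lgb}}(1+|x|^2)$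 for all $s\geq 0$, $x\in\mathbb R^d$. Strong DO solution. Write $C_{\boldsymbol Y_t}=\mathbb E[\boldsymbol Y_t\boldsymbol Y_t^\top]\in\mathbb R^{R\times R}$ and let $P^{\mathrm{row}}_{\boldsymbol U_t}\in\mathbb R^{d\times d}$ be the orthogonal projection onto the span of the rows of $\boldsymbol U_t$. $(\boldsymbol U,\boldsymbol Y):[0,T]\to\mathbb R^{R\times d}\times L^2(\Omega;\mathbb R^R)$ is a strong DO solution on $[0,T]$ if (1) $\boldsymbol U_0$ has orthonormal rows and $\boldsymbol Y_0\in L^2(\Omega;\mathbb R^R)$ has linearly independent components; (2) $t\mapsto\boldsymbol U_t$ is absolutely continuous on $[0,T]$ and $\boldsymbol U_t\dot{\boldsymbol U}_t^\top=0$ for a.e. $t$; (3) $\boldsymbol Y$ has almost surely continuous paths, is $(\mathscr F_t)$-adapted, and for every $t\in[0,T]$ the components $Y^1_t,\dots,Y^R_t$ are linearly independent in $L^2(\Omega)$; (4) for a.e. $t\in[0,T]$, $C_{\boldsymbol Y_t}\dot{\boldsymbol U}_t=\mathbb E[\boldsymbol Y_t a(t,\boldsymbol U_t^\top\boldsymbol Y_t)^\top](I_{d\times d}-P^{\mathrm{row}}_{\boldsymbol U_t})$, and $\boldsymbol Y$ is a strong solution on $[0,T]$ of $d\boldsymbol Y_t=\boldsymbol U_t a(t,\boldsymbol U_t^\top\boldsymbol Y_t)\,dt+\boldsymbol U_t b(t,\boldsymbol U_t^\top\boldsymbol Y_t)\,dW_t$. Maximal extension and explosion time. A unique strong DO solution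 with the given initial datum exists on some interval $[0,T]$, $T>0$, and it can be extended in time; $(\boldsymbol U,\boldsymbol Y)$ denotes the solution on the union of all intervals on which a strong DO solution with this datum exists. For $n\in\mathbb N$, with $t$ ranging over the interval of existence and $\inf\varnothing=\infty$, let $$\tau^1_n:=\inf\{t>0:\|C_{\boldsymbol Y_t}^{-1}\|_{\mathrm F}=\|C_{\boldsymbol Y_0}^{-1}\|_{\mathrm F}+n\},\quad \tau^2_n:=\inf\{t>0:\|\boldsymbol Y_t\|_{[L^2(\Omega)]^R}=\|\boldsymbol Y_0\|_{[L^2(\Omega)]^R}+n\},$$ $\tau_n:=\min\{\tau_n^1,\tau_n^2\}$, where $\|\boldsymbol Y\|_{[L^2(\Omega)]^R}^2=\mathbb E[|\boldsymbol Y|^2]$. The sequence $(\tau_n)$ is non-decreasing, and $T_e:=\lim_{n\to\infty}\tau_n$ is called the explosion time; the solution exists on $[0,T_e)$. *)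

theory Defs
  imports "HOL-Probability.Probability"
begin

text \<open>
  Time is indexed by \<^typ>\<open>real\<close>; only parameters \<open>t \<ge> 0\<close> matter, and nothing is required of
  \<open>F t\<close> or of a process at \<open>t < 0\<close>.  The index types \<open>'r\<close>, \<open>'d\<close>, \<open>'m\<close> play the roles of
  \<open>R\<close>, \<open>d\<close>, \<open>m\<close>, so an \<open>R \<times> d\<close> matrix has type \<^typ>\<open>real^'d^'r\<close>, and \<^const>\<open>norm\<close> on such a
  matrix type is the Frobenius norm.
\<close>

section \<open>Stochastic basis and Brownian motion\<close>

locale usual_filtered_prob_space = prob_space M + complete_measure M
  for M :: "'w measure" and F :: "real \<Rightarrow> 'w measure" +
  assumes filtration_subalgebra: "0 \<le> t \<Longrightarrow> subalgebra M (F t)"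
    and filtration_mono: "0 \<le> s \<Longrightarrow> s \<le> t \<Longrightarrow> sets (F s) \<subseteq> sets (F t)"
    and filtration_right_continuous: "0 \<le> t \<Longrightarrow> (\<Inter>u\<in>{t<..}. sets (F u)) \<subseteq> sets (F t)"
    and filtration_complete: "null_sets M \<subseteq> sets (F 0)"

definition brownian_motion ::
    "'w measure \<Rightarrow> (real \<Rightarrow> 'w measure) \<Rightarrow> (real \<Rightarrow> 'w \<Rightarrow> real^'m) \<Rightarrow> bool" where
  "brownian_motion M F W \<longleftrightarrow>
     (\<forall>t\<ge>0. W t \<in> borel_measurable (F t)) \<and>
     (AE \<omega> in M. W 0 \<omega> = 0) \<and>
     (AE \<omega> in M. continuous_on {0..} (\<lambda>t. W t \<omega>)) \<and>
     (\<forall>s t. 0 \<le> s \<and> s < t \<longrightarrow>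
        prob_space.indep_set M (sets (F s))
          (sets (vimage_algebra (space M) (\<lambda>\<omega>. W t \<omega> - W s \<omega>) borel)) \<and>
        prob_space.indep_vars M (\<lambda>_. borel) (\<lambda>j \<omega>. (W t \<omega> - W s \<omega>) $ j) UNIV \<and>
        (\<forall>j. distributed M lborel (\<lambda>\<omega>. (W t \<omega> - W s \<omega>) $ j)
               (\<lambda>x. ennreal (normal_density 0 (sqrt (t - s)) x))))"

section \<open>It\^o integral and strong solutions\<close>

definition tendsto_0_in_prob :: "'w measure \<Rightarrow> (nat \<Rightarrow> 'w \<Rightarrow> ennreal) \<Rightarrow> bool" where
  "tendsto_0_in_prob M X \<longleftrightarrow>
     (\<forall>n. X n \<in> borel_measurable M) \<and>
     (\<forall>\<epsilon>>0. (\<lambda>n. measure M {\<omega> \<in> space M. X n \<omega> > ennreal \<epsilon>}) \<longlonglongrightarrow> 0)"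

text \<open>A simple integrand is given by \<open>n\<close> steps, with value \<open>\<xi> k\<close> on \<open>(p k, p (k + 1)]\<close> for \<open>k < n\<close>.\<close>

definition simple_integrand ::
    "'w measure \<Rightarrow> (real \<Rightarrow> 'w measure) \<Rightarrow> nat \<Rightarrow> (nat \<Rightarrow> real) \<Rightarrow> (nat \<Rightarrow> 'w \<Rightarrow> real^'m^'k) \<Rightarrow> bool" where
  "simple_integrand M F n p \<xi> \<longleftrightarrow>
     0 \<le> p 0 \<and>
     (\<forall>k<n. p k \<le> p (Suc k) \<and> \<xi> k \<in> borel_measurable (F (p k)) \<and> bounded (\<xi> k ` space M))"

definition simple_process ::
    "nat \<Rightarrow> (nat \<Rightarrow> real) \<Rightarrow> (nat \<Rightarrow> 'w \<Rightarrow> real^'m^'k) \<Rightarrow> real \<Rightarrow> 'w \<Rightarrow> real^'m^'k" where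
  "simple_process n p \<xi> t \<omega> = (\<Sum>k<n. indicator {p k<..p (Suc k)} t *\<^sub>R \<xi> k \<omega>)"

definition simple_integral ::
    "(real \<Rightarrow> 'w \<Rightarrow> real^'m) \<Rightarrow> nat \<Rightarrow> (nat \<Rightarrow> real) \<Rightarrow> (nat \<Rightarrow> 'w \<Rightarrow> real^'m^'k) \<Rightarrow> real \<Rightarrow> 'w \<Rightarrow> real^'k" where
  "simple_integral W n p \<xi> t \<omega> =
     (\<Sum>k<n. \<xi> k \<omega> *v (W (min t (p (Suc k))) \<omega> - W (min t (p k)) \<omega>))"

text \<open>
  \<open>has_ito_integral M F W T H I\<close>: on \<open>[0, T]\<close>, \<open>I\<close> is (a version of) the It\^o integral process
  \<open>\<integral> H dW\<close>, for integrands with \<open>\<integral>\<^sub>0\<^sup>T |H|\<^sup>2 ds < \<infinity>\<close> almost surely.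
  No moment of \<open>H\<close> is required, hence the approximation by simple
  integrands is in probability.  Progressive measurability of \<open>H\<close>, up to null sets, is forced by
  the existence of the approximating sequence; it is not demanded pathwise because processes
  that are continuous only almost surely need not be jointly measurable on the exceptional set.
\<close>

definition has_ito_integral ::
    "'w measure \<Rightarrow> (real \<Rightarrow> 'w measure) \<Rightarrow> (real \<Rightarrow> 'w \<Rightarrow> real^'m) \<Rightarrow> real \<Rightarrow>
     (real \<Rightarrow> 'w \<Rightarrow> real^'m^'k) \<Rightarrow> (real \<Rightarrow> 'w \<Rightarrow> real^'k) \<Rightarrow> bool" where
  "has_ito_integral M F W T H I \<longleftrightarrow>
     (AE \<omega> in M. set_integrable lborel {0..T} (\<lambda>s. (norm (H s \<omega>))\<^sup>2)) \<and>
     (\<forall>t\<in>{0..T}. I t \<in> borel_measurable (F t)) \<and>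
     (AE \<omega> in M. continuous_on {0..T} (\<lambda>t. I t \<omega>)) \<and>
     (\<exists>N P \<Xi>.
        (\<forall>j. simple_integrand M F (N j) (P j) (\<Xi> j)) \<and>
        tendsto_0_in_prob M (\<lambda>j \<omega>. \<integral>\<^sup>+s\<in>{0..T}.
          ennreal ((norm (simple_process (N j) (P j) (\<Xi> j) s \<omega> - H s \<omega>))\<^sup>2) \<partial>lborel) \<and>
        tendsto_0_in_prob M (\<lambda>j \<omega>. SUP t\<in>{0..T}.
          ennreal (norm (simple_integral W (N j) (P j) (\<Xi> j) t \<omega> - I t \<omega>))))"

text \<open>Strong solution of \<open>dY = \<alpha>(t, Y) dt + \<beta>(t, Y) dW\<close> on \<open>[0, T]\<close>, started from \<open>Y 0\<close>.\<close>

definition strong_SDE_solution ::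
    "'w measure \<Rightarrow> (real \<Rightarrow> 'w measure) \<Rightarrow> (real \<Rightarrow> 'w \<Rightarrow> real^'m) \<Rightarrow> real \<Rightarrow>
     (real \<Rightarrow> real^'k \<Rightarrow> real^'k) \<Rightarrow> (real \<Rightarrow> real^'k \<Rightarrow> real^'m^'k) \<Rightarrow>
     (real \<Rightarrow> 'w \<Rightarrow> real^'k) \<Rightarrow> bool" where
  "strong_SDE_solution M F W T \<alpha> \<beta> Y \<longleftrightarrow>
     (\<forall>t\<in>{0..T}. Y t \<in> borel_measurable (F t)) \<and>
     (AE \<omega> in M. continuous_on {0..T} (\<lambda>t. Y t \<omega>)) \<and>
     (AE \<omega> in M. set_integrable lborel {0..T} (\<lambda>s. \<alpha> s (Y s \<omega>))) \<and>
     (\<exists>I. has_ito_integral M F W T (\<lambda>s \<omega>. \<beta> s (Y s \<omega>)) I \<and>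
          (AE \<omega> in M. \<forall>t\<in>{0..T}.
             Y t \<omega> = Y 0 \<omega> + set_lebesgue_integral lborel {0..t} (\<lambda>s. \<alpha> s (Y s \<omega>)) + I t \<omega>))"

section \<open>Conditions on the coefficients\<close>

definition jointly_measurable ::
    "(real \<Rightarrow> real^'d \<Rightarrow> 'b::topological_space) \<Rightarrow> bool" where
  "jointly_measurable f \<longleftrightarrow>
     (\<lambda>(s, x). f s x) \<in> borel_measurable (restrict_space borel {0..} \<Otimes>\<^sub>M borel)"

definition lipschitz_condition ::
    "(real \<Rightarrow> real^'d \<Rightarrow> real^'d) \<Rightarrow> (real \<Rightarrow> real^'d \<Rightarrow> real^'m^'d) \<Rightarrow> bool" where
  "lipschitz_condition a b \<longleftrightarrow>
     (\<exists>C>0. \<forall>s\<ge>0. \<forall>x y. norm (a s x - a s y) \<le> C * norm (x - y) \<and>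
                        norm (b s x - b s y) \<le> C * norm (x - y))"

definition linear_growth_bound ::
    "(real \<Rightarrow> real^'d \<Rightarrow> real^'d) \<Rightarrow> (real \<Rightarrow> real^'d \<Rightarrow> real^'m^'d) \<Rightarrow> bool" where
  "linear_growth_bound a b \<longleftrightarrow>
     (\<exists>C>0. \<forall>s\<ge>0. \<forall>x. (norm (a s x))\<^sup>2 + (norm (b s x))\<^sup>2 \<le> C * (1 + (norm x)\<^sup>2))"

section \<open>Square-integrable random vectors\<close>

definition L2_vector :: "'w measure \<Rightarrow> ('w \<Rightarrow> real^'k) \<Rightarrow> bool" where
  "L2_vector M X \<longleftrightarrow> X \<in> borel_measurable M \<and> integrable M (\<lambda>\<omega>. (norm (X \<omega>))\<^sup>2)"

definition L2_vector_norm :: "'w measure \<Rightarrow> ('w \<Rightarrow> real^'k) \<Rightarrow> real" where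
  "L2_vector_norm M X = sqrt (\<integral>\<omega>. (norm (X \<omega>))\<^sup>2 \<partial>M)"

text \<open>Linear independence in \<open>L\<^sup>2(\<Omega>)\<close>, i.e. modulo almost sure equality.\<close>

definition linearly_independent_components :: "'w measure \<Rightarrow> ('w \<Rightarrow> real^'k) \<Rightarrow> bool" where
  "linearly_independent_components M X \<longleftrightarrow>
     (\<forall>c::'k \<Rightarrow> real. (AE \<omega> in M. (\<Sum>i\<in>UNIV. c i * X \<omega> $ i) = 0) \<longrightarrow> (\<forall>i. c i = 0))"

text \<open>The matrix \<open>\<E>[X Z\<^sup>T]\<close>.\<close>

definition cross_moment :: "'w measure \<Rightarrow> ('w \<Rightarrow> real^'k) \<Rightarrow> ('w \<Rightarrow> real^'l) \<Rightarrow> real^'l^'k" where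
  "cross_moment M X Z = (\<chi> i j. \<integral>\<omega>. X \<omega> $ i * Z \<omega> $ j \<partial>M)"

abbreviation second_moment :: "'w measure \<Rightarrow> ('w \<Rightarrow> real^'k) \<Rightarrow> real^'k^'k" where
  "second_moment M X \<equiv> cross_moment M X X"

section \<open>Strong DO solutions\<close>

definition orthonormal_rows :: "real^'d^'r \<Rightarrow> bool" where
  "orthonormal_rows U \<longleftrightarrow> (\<forall>i j. row i U \<bullet> row j U = (if i = j then 1 else 0))"

definition row_projection :: "real^'d^'r \<Rightarrow> real^'d^'d" where
  "row_projection U =
     (THE P. \<forall>x. P *v x \<in> span (rows U) \<and> (\<forall>y\<in>span (rows U). (x - P *v x) \<bullet> y = 0))"

definition abs_continuous_on :: "real \<Rightarrow> real \<Rightarrow> (real \<Rightarrow> 'b::real_normed_vector) \<Rightarrow> bool" where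
  "abs_continuous_on l u f \<longleftrightarrow>
     (\<forall>\<epsilon>>0. \<exists>\<delta>>0. \<forall>(n::nat) (s::nat \<Rightarrow> real) (t::nat \<Rightarrow> real).
        (\<forall>k<n. l \<le> s k \<and> s k \<le> t k \<and> t k \<le> u) \<and>
        pairwise (\<lambda>i j. {s i<..<t i} \<inter> {s j<..<t j} = {}) {..<n} \<and>
        (\<Sum>k<n. t k - s k) < \<delta>
        \<longrightarrow> (\<Sum>k<n. norm (f (t k) - f (s k))) < \<epsilon>)"

text \<open>
  \<open>strong_DO_solution M F W a b T U0 Y0 U Y\<close>: \<open>(U, Y)\<close> is a strong DO solution on \<open>[0, T]\<close> with
  initial datum \<open>(U0, Y0)\<close>; the values of \<open>U\<close> and \<open>Y\<close> outside \<open>[0, T]\<close> are irrelevant.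
  The derivative \<open>D\<close> is taken at almost every \<open>t\<close>, so the end points, where a
  two-sided derivative would involve values outside \<open>[0, T]\<close>, play no role.
\<close>

definition strong_DO_solution ::
    "'w measure \<Rightarrow> (real \<Rightarrow> 'w measure) \<Rightarrow> (real \<Rightarrow> 'w \<Rightarrow> real^'m) \<Rightarrow>
     (real \<Rightarrow> real^'d \<Rightarrow> real^'d) \<Rightarrow> (real \<Rightarrow> real^'d \<Rightarrow> real^'m^'d) \<Rightarrow> real \<Rightarrow>
     real^'d^'r \<Rightarrow> ('w \<Rightarrow> real^'r) \<Rightarrow>
     (real \<Rightarrow> real^'d^'r) \<Rightarrow> (real \<Rightarrow> 'w \<Rightarrow> real^'r) \<Rightarrow> bool" where
  "strong_DO_solution M F W a b T U0 Y0 U Y \<longleftrightarrow>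
     U 0 = U0 \<and> (AE \<omega> in M. Y 0 \<omega> = Y0 \<omega>) \<and>
     (\<forall>t\<in>{0..T}. L2_vector M (Y t)) \<and>
     orthonormal_rows (U 0) \<and> linearly_independent_components M (Y 0) \<and>
     abs_continuous_on 0 T U \<and>
     (AE t in lborel. t \<in> {0..T} \<longrightarrow>
        (\<exists>D. (U has_vector_derivative D) (at t) \<and> U t ** transpose D = 0)) \<and>
     (AE \<omega> in M. continuous_on {0..T} (\<lambda>t. Y t \<omega>)) \<and>
     (\<forall>t\<in>{0..T}. Y t \<in> borel_measurable (F t)) \<and>
     (\<forall>t\<in>{0..T}. linearly_independent_components M (Y t)) \<and>
     (AE t in lborel. t \<in> {0..T} \<longrightarrow>
        (\<exists>D. (U has_vector_derivative D) (at t) \<and>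
             second_moment M (Y t) ** D =
               cross_moment M (Y t) (\<lambda>\<omega>. a t (transpose (U t) *v Y t \<omega>)) **
                 (mat 1 - row_projection (U t)))) \<and>
     strong_SDE_solution M F W T
       (\<lambda>t y. U t *v a t (transpose (U t) *v y))
       (\<lambda>t y. U t ** b t (transpose (U t) *v y)) Y"

definition DO_existence_interval ::
    "'w measure \<Rightarrow> (real \<Rightarrow> 'w measure) \<Rightarrow> (real \<Rightarrow> 'w \<Rightarrow> real^'m) \<Rightarrow>
     (real \<Rightarrow> real^'d \<Rightarrow> real^'d) \<Rightarrow> (real \<Rightarrow> real^'d \<Rightarrow> real^'m^'d) \<Rightarrow>
     real^'d^'r \<Rightarrow> ('w \<Rightarrow> real^'r) \<Rightarrow> real set" where
  "DO_existence_interval M F W a b U0 Y0 =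
     \<Union>{{0..T} | T. 0 < T \<and> (\<exists>U Y. strong_DO_solution M F W a b T U0 Y0 U Y)}"

definition maximal_DO_solution ::
    "'w measure \<Rightarrow> (real \<Rightarrow> 'w measure) \<Rightarrow> (real \<Rightarrow> 'w \<Rightarrow> real^'m) \<Rightarrow>
     (real \<Rightarrow> real^'d \<Rightarrow> real^'d) \<Rightarrow> (real \<Rightarrow> real^'d \<Rightarrow> real^'m^'d) \<Rightarrow>
     real^'d^'r \<Rightarrow> ('w \<Rightarrow> real^'r) \<Rightarrow>
     (real \<Rightarrow> real^'d^'r) \<Rightarrow> (real \<Rightarrow> 'w \<Rightarrow> real^'r) \<Rightarrow> bool" where
  "maximal_DO_solution M F W a b U0 Y0 U Y \<longleftrightarrow>
     (\<forall>T>0. (\<exists>U' Y'. strong_DO_solution M F W a b T U0 Y0 U' Y') \<longrightarrow>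
            strong_DO_solution M F W a b T U0 Y0 U Y)"

section \<open>Explosion time\<close>

text \<open>
  In the next definitions \<open>J\<close> is the interval of existence.  The infima are taken in \<^typ>\<open>ereal\<close>,
  where \<open>Inf {} = \<infinity>\<close>.
\<close>

definition tau1 :: "'w measure \<Rightarrow> real set \<Rightarrow> (real \<Rightarrow> 'w \<Rightarrow> real^'r) \<Rightarrow> nat \<Rightarrow> ereal" where
  "tau1 M J Y n = Inf {ereal t | t. t \<in> J \<and> 0 < t \<and>
     norm (matrix_inv (second_moment M (Y t))) =
       norm (matrix_inv (second_moment M (Y 0))) + real n}"

definition tau2 :: "'w measure \<Rightarrow> real set \<Rightarrow> (real \<Rightarrow> 'w \<Rightarrow> real^'r) \<Rightarrow> nat \<Rightarrow> ereal" where
  "tau2 M J Y n = Inf {ereal t | t. t \<in> J \<and> 0 < t \<and>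
     L2_vector_norm M (Y t) = L2_vector_norm M (Y 0) + real n}"

definition tau :: "'w measure \<Rightarrow> real set \<Rightarrow> (real \<Rightarrow> 'w \<Rightarrow> real^'r) \<Rightarrow> nat \<Rightarrow> ereal" where
  "tau M J Y n = min (tau1 M J Y n) (tau2 M J Y n)"

definition explosion_time :: "'w measure \<Rightarrow> real set \<Rightarrow> (real \<Rightarrow> 'w \<Rightarrow> real^'r) \<Rightarrow> ereal" where
  "explosion_time M J Y = lim (\<lambda>n. tau M J Y n)"

end

theory Submission
  imports Defs
begin

text \<open>
  Up to a finite explosion time the second moment of \<open>Y\<close> cannot blow up, and the second moment matrix
  \<open>C t = \<E>[Y t (Y t)\<^sup>T]\<close> moves so slowly that it has a limit there.  The limit must be singular, which is
  exactly the blow-up of the inverse.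

  In more detail, let \<open>Te\<close> be finite.  Since \<open>U U'\<^sup>T = 0\<close>, the rows of \<open>U t\<close> stay orthonormal
  (\<open>orthonormal_rows_preserved\<close>, which rests on \<open>abs_continuous_on_zero_derivative\<close>), so the drift
  and diffusion of the equation for \<open>Y\<close> grow linearly with the constant of \<open>a\<close> and \<open>b\<close>.  Gronwall's
  inequality then bounds \<open>\<E>|Y t|\<^sup>2\<close> by a constant \<open>K\<close> and \<open>\<E>|Y t - Y s|\<^sup>2\<close> by a multiple of \<open>t - s\<close>, with
  constants that depend on the horizon \<open>Te\<close> but not on how close \<open>s\<close> and \<open>t\<close> are to it
  (\<open>DO_moment_bounds\<close>).  By the first bound \<open>\<tau>\<^sup>2\<close> is infinite for large levels, hence the inverse of \<open>C\<close>
  reaches every large level \<open>n\<close> before \<open>Te\<close>.  By the second bound \<open>C\<close> is uniformly continuous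
  (\<open>second_moment_Hoelder\<close>) and extends continuously to \<open>Te\<close>.  If the extension were invertible at
  \<open>Te\<close>, the inverse would be bounded on \<open>[0, Te]\<close>, contradicting the levels.  So \<open>det (C t)\<close> tends to \<open>0\<close>,
  and the norm of the inverse tends to infinity (\<open>norm_matrix_inv_blowup\<close>).  Monotonicity of \<open>\<tau>\<close>
  from level \<open>1\<close> on, and thereby convergence to \<open>Te\<close>, is the intermediate value theorem.

  The Gronwall argument has to cope with moments whose local integrability in time is not known
  beforehand, and with an It\^o integral that is defined as a limit in probability.  To make all
  quantities finite, everything is truncated at a bound \<open>c\<close> on the accumulated energy: simple integrands are switched
  off when their energy would exceed \<open>c\<close> (\<open>ito_simple_truncated\<close>), the resulting inequality passes to the
  limit (\<open>ito_integral_truncated_bound\<close>), and the energy capped at \<open>c\<close> grows only while it is below \<open>c\<close>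
  (\<open>capped_running_integral\<close>), so that Gronwall's inequality applies to its expectation uniformly in \<open>c\<close>.
\<close>

section \<open>Absolutely continuous functions\<close>

lemma abs_continuous_on_subinterval:
  assumes "abs_continuous_on l u f" "l \<le> l'" "u' \<le> u"
  shows "abs_continuous_on l' u' f"
  unfolding abs_continuous_on_def
proof (intro allI impI)
  fix \<epsilon> :: real assume "\<epsilon> > 0"
  then obtain \<delta> where "\<delta> > 0" and \<delta>: "\<And>(n::nat) (s::nat \<Rightarrow> real) (t::nat \<Rightarrow> real).
        (\<forall>k<n. l \<le> s k \<and> s k \<le> t k \<and> t k \<le> u) \<and>
        pairwise (\<lambda>i j. {s i<..<t i} \<inter> {s j<..<t j} = {}) {..<n} \<and>
        (\<Sum>k<n. t k - s k) < \<delta> \<Longrightarrow> (\<Sum>k<n. norm (f (t k) - f (s k))) < \<epsilon>"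
    using assms(1) unfolding abs_continuous_on_def by meson
  show "\<exists>\<delta>>0. \<forall>(n::nat) (s::nat \<Rightarrow> real) (t::nat \<Rightarrow> real).
        (\<forall>k<n. l' \<le> s k \<and> s k \<le> t k \<and> t k \<le> u') \<and>
        pairwise (\<lambda>i j. {s i<..<t i} \<inter> {s j<..<t j} = {}) {..<n} \<and>
        (\<Sum>k<n. t k - s k) < \<delta> \<longrightarrow> (\<Sum>k<n. norm (f (t k) - f (s k))) < \<epsilon>"
    using \<open>\<delta> > 0\<close> assms(2,3) by (intro exI[of _ \<delta>]) (force intro!: \<delta>)
qed

lemma abs_continuous_on_dominated:
  assumes f: "abs_continuous_on l u f"
    and g: "\<And>s t. s \<in> {l..u} \<Longrightarrow> t \<in> {l..u} \<Longrightarrow> norm (g t - g s) \<le> B * norm (f t - f s)"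
  shows "abs_continuous_on l u g"
  unfolding abs_continuous_on_def
proof (intro allI impI)
  fix \<epsilon> :: real assume "\<epsilon> > 0"
  define B' where "B' = \<bar>B\<bar> + 1"
  have "B' > 0" "B \<le> B'" by (auto simp: B'_def)
  have "\<epsilon> / B' > 0" using \<open>\<epsilon> > 0\<close> \<open>B' > 0\<close> by simp
  then obtain \<delta> where "\<delta> > 0" and \<delta>: "\<And>(n::nat) (s::nat \<Rightarrow> real) (t::nat \<Rightarrow> real).
        (\<forall>k<n. l \<le> s k \<and> s k \<le> t k \<and> t k \<le> u) \<and>
        pairwise (\<lambda>i j. {s i<..<t i} \<inter> {s j<..<t j} = {}) {..<n} \<and>
        (\<Sum>k<n. t k - s k) < \<delta> \<Longrightarrow> (\<Sum>k<n. norm (f (t k) - f (s k))) < \<epsilon> / B'"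
    using f unfolding abs_continuous_on_def by meson
  show "\<exists>\<delta>>0. \<forall>(n::nat) (s::nat \<Rightarrow> real) (t::nat \<Rightarrow> real).
        (\<forall>k<n. l \<le> s k \<and> s k \<le> t k \<and> t k \<le> u) \<and>
        pairwise (\<lambda>i j. {s i<..<t i} \<inter> {s j<..<t j} = {}) {..<n} \<and>
        (\<Sum>k<n. t k - s k) < \<delta> \<longrightarrow> (\<Sum>k<n. norm (g (t k) - g (s k))) < \<epsilon>"
  proof (intro exI[of _ \<delta>] conjI allI impI \<open>\<delta> > 0\<close>)
    fix n :: nat and s t :: "nat \<Rightarrow> real"
    assume *: "(\<forall>k<n. l \<le> s k \<and> s k \<le> t k \<and> t k \<le> u) \<and>
        pairwise (\<lambda>i j. {s i<..<t i} \<inter> {s j<..<t j} = {}) {..<n} \<and>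
        (\<Sum>k<n. t k - s k) < \<delta>"
    have "norm (g (t k) - g (s k)) \<le> B' * norm (f (t k) - f (s k))" if "k < n" for k
    proof -
      have "s k \<in> {l..u}" "t k \<in> {l..u}" using * that by force+
      from g[OF this] show ?thesis
        using mult_right_mono[OF \<open>B \<le> B'\<close>, of "norm (f (t k) - f (s k))"] by simp
    qed
    then have "(\<Sum>k<n. norm (g (t k) - g (s k))) \<le> B' * (\<Sum>k<n. norm (f (t k) - f (s k)))"
      unfolding sum_distrib_left by (intro sum_mono) auto
    also have "\<dots> < B' * (\<epsilon> / B')"
      using \<delta>[OF *] \<open>B' > 0\<close> by (intro mult_strict_left_mono)
    finally show "(\<Sum>k<n. norm (g (t k) - g (s k))) < \<epsilon>" using \<open>B' > 0\<close> by simp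
  qed
qed

lemma abs_continuous_on_imp_continuous_on:
  assumes "abs_continuous_on l u f"
  shows "continuous_on {l..u} f"
  unfolding continuous_on_iff
proof (intro ballI allI impI)
  fix x and \<epsilon> :: real assume x: "x \<in> {l..u}" and "\<epsilon> > 0"
  then obtain \<delta> where "\<delta> > 0" and \<delta>: "\<And>(n::nat) (s::nat \<Rightarrow> real) (t::nat \<Rightarrow> real).
        (\<forall>k<n. l \<le> s k \<and> s k \<le> t k \<and> t k \<le> u) \<and>
        pairwise (\<lambda>i j. {s i<..<t i} \<inter> {s j<..<t j} = {}) {..<n} \<and>
        (\<Sum>k<n. t k - s k) < \<delta> \<Longrightarrow> (\<Sum>k<n. norm (f (t k) - f (s k))) < \<epsilon>"
    using assms unfolding abs_continuous_on_def by meson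
  have "dist (f y) (f x) < \<epsilon>" if "y \<in> {l..u}" "dist y x < \<delta>" for y
  proof -
    have "(\<Sum>k<1::nat. norm (f (max x y) - f (min x y))) < \<epsilon>"
      using that x by (intro \<delta>) (auto simp: pairwise_def dist_real_def)
    then show ?thesis by (auto simp: dist_norm max_def min_def norm_minus_commute split: if_splits)
  qed
  then show "\<exists>d>0. \<forall>x'\<in>{l..u}. dist x' x < d \<longrightarrow> dist (f x') (f x) < \<epsilon>"
    using \<open>\<delta> > 0\<close> by blast
qed

lemma abs_continuous_on_sum_finite:
  fixes s t :: "'i \<Rightarrow> real"
  assumes "finite P"
    and \<delta>: "\<And>(n::nat) (s::nat \<Rightarrow> real) (t::nat \<Rightarrow> real).
        (\<forall>k<n. l \<le> s k \<and> s k \<le> t k \<and> t k \<le> u) \<and>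
        pairwise (\<lambda>i j. {s i<..<t i} \<inter> {s j<..<t j} = {}) {..<n} \<and>
        (\<Sum>k<n. t k - s k) < \<delta> \<Longrightarrow> (\<Sum>k<n. norm (f (t k) - f (s k))) < \<epsilon>"
    and "\<And>i. i \<in> P \<Longrightarrow> l \<le> s i \<and> s i \<le> t i \<and> t i \<le> u"
    and "pairwise (\<lambda>i j. {s i<..<t i} \<inter> {s j<..<t j} = {}) P"
    and "(\<Sum>i\<in>P. t i - s i) < \<delta>"
  shows "(\<Sum>i\<in>P. norm (f (t i) - f (s i))) < \<epsilon>"
proof -
  obtain h where h: "bij_betw h {..<card P} P"
    using ex_bij_betw_nat_finite[OF \<open>finite P\<close>] by (auto simp: atLeast0LessThan)
  then have hP: "h k \<in> P" if "k < card P" for k using that by (auto simp: bij_betw_def)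
  have "inj_on h {..<card P}" using h by (simp add: bij_betw_def)
  have "(\<Sum>i\<in>P. norm (f (t i) - f (s i))) = (\<Sum>k<card P. norm (f (t (h k)) - f (s (h k))))"
    by (rule sum.reindex_bij_betw[OF h, symmetric])
  also have "\<dots> < \<epsilon>"
  proof (rule \<delta>[of "card P" "\<lambda>k. s (h k)" "\<lambda>k. t (h k)"], intro conjI)
    show "\<forall>k<card P. l \<le> s (h k) \<and> s (h k) \<le> t (h k) \<and> t (h k) \<le> u"
      using assms(3) hP by blast
    show "pairwise (\<lambda>i j. {s (h i)<..<t (h i)} \<inter> {s (h j)<..<t (h j)} = {}) {..<card P}"
      using assms(4) hP \<open>inj_on h _\<close> unfolding pairwise_def inj_on_def by (metis lessThan_iff)
    show "(\<Sum>k<card P. t (h k) - s (h k)) < \<delta>"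
      using assms(5) by (subst sum.reindex_bij_betw[OF h, of "\<lambda>i. t i - s i"])
  qed
  finally show ?thesis .
qed

text \<open>
  The Cantor function shows that a vanishing derivative almost everywhere is not enough without
  absolute continuity.  The proof is a Cousin argument: a fine tagged division of \<open>[l, u]\<close> has its
  pieces either tagged at a point of zero derivative, where the increments are at most
  \<open>\<epsilon>\<close> times the length, or tagged in the exceptional null set, in which case they lie in an open
  set of small measure and absolute continuity bounds the sum of their increments.
\<close>

lemma abs_continuous_on_zero_derivative:
  fixes f :: "real \<Rightarrow> 'b::real_normed_vector"
  assumes "l \<le> u" and ac: "abs_continuous_on l u f"
    and deriv: "AE t in lborel. t \<in> {l..u} \<longrightarrow> (f has_vector_derivative 0) (at t)"
  shows "f u = f l"
proof -
  obtain N where N: "N \<in> null_sets lborel"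
    and D: "\<And>t. t \<in> {l..u} \<Longrightarrow> t \<notin> N \<Longrightarrow> (f has_vector_derivative 0) (at t)"
    using deriv by (auto elim!: AE_E3)
  have small: "norm (f u - f l) \<le> \<epsilon> * (u - l) + \<epsilon>" if "\<epsilon> > 0" for \<epsilon>
  proof -
    obtain \<delta> where "\<delta> > 0" and \<delta>: "\<And>(n::nat) (s::nat \<Rightarrow> real) (t::nat \<Rightarrow> real).
        (\<forall>k<n. l \<le> s k \<and> s k \<le> t k \<and> t k \<le> u) \<and>
        pairwise (\<lambda>i j. {s i<..<t i} \<inter> {s j<..<t j} = {}) {..<n} \<and>
        (\<Sum>k<n. t k - s k) < \<delta> \<Longrightarrow> (\<Sum>k<n. norm (f (t k) - f (s k))) < \<epsilon>"
      using ac \<open>\<epsilon> > 0\<close> unfolding abs_continuous_on_def by meson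
    have "N \<in> sets borel" using N by auto
    then obtain G where G: "open G" "N \<subseteq> G" "emeasure lborel (G - N) \<le> ennreal (\<delta> / 2)"
      using outer_regular_lborel_le[of N "\<delta> / 2"] \<open>\<delta> > 0\<close> by auto
    have "emeasure lborel G = emeasure lborel (G - N)"
      using N G(1) by (simp add: emeasure_Diff_null_set)
    then have mG: "emeasure lborel G \<le> ennreal (\<delta> / 2)" using G(3) by simp
    have "\<exists>r>0. (x \<in> N \<longrightarrow> ball x r \<subseteq> G) \<and>
        (x \<in> {l..u} - N \<longrightarrow> (\<forall>y\<in>ball x r. norm (f y - f x) \<le> \<epsilon> * \<bar>y - x\<bar>))" for x
    proof (cases "x \<in> N")
      case True
      then show ?thesis using G(1,2) by (meson DiffD2 openE subsetD)
    next
      case False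
      show ?thesis
      proof (cases "x \<in> {l..u}")
        case True
        have "(f has_derivative (\<lambda>h. h *\<^sub>R 0)) (at x)"
          using D[OF True False] by (simp add: has_vector_derivative_def)
        then obtain d where "d > 0" "\<And>y. norm (y - x) < d \<Longrightarrow> norm (f y - f x - (y - x) *\<^sub>R 0) \<le> \<epsilon> * norm (y - x)"
          unfolding has_derivative_at_alt using \<open>\<epsilon> > 0\<close> by blast
        then show ?thesis using False by (intro exI[of _ d]) (auto simp: dist_real_def abs_minus_commute)
      qed (use False in \<open>auto intro: exI[of _ 1]\<close>)
    qed
    then obtain r where r: "\<And>x. r x > 0" "\<And>x. x \<in> N \<Longrightarrow> ball x (r x) \<subseteq> G"
      "\<And>x y. x \<in> {l..u} - N \<Longrightarrow> y \<in> ball x (r x) \<Longrightarrow> norm (f y - f x) \<le> \<epsilon> * \<bar>y - x\<bar>"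
      by metis
    have "gauge (\<lambda>x. ball x (r x))" using r(1) by (intro gauge_ball_dependent) auto
    then obtain p where p: "p tagged_division_of {l..u}" "(\<lambda>x. ball x (r x)) fine p"
      using fine_division_exists_real by blast
    have "finite p" using p(1) by auto
    have pK: "x \<in> K \<and> x \<in> {l..u} \<and> K = {Inf K..Sup K} \<and> Inf K \<le> x \<and> x \<le> Sup K \<and> l \<le> Inf K
        \<and> Sup K \<le> u \<and> K \<subseteq> ball x (r x)"
      if xK: "(x, K) \<in> p" for x K
    proof -
      obtain a b where ab: "K = {a..b}" using tagged_division_ofD(4)[OF p(1) xK] by auto
      have "x \<in> K" "K \<subseteq> {l..u}" using p(1) xK by blast+
      then show ?thesis using ab fineD[OF p(2) xK] by auto
    qed
    define P where "P = {q \<in> p. fst q \<in> N}"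
    have Pp: "P \<subseteq> p" "finite P" using \<open>finite p\<close> by (auto simp: P_def)
    define s t where "s q = Inf (snd q)" and "t q = Sup (snd q)" for q :: "real \<times> real set"
    have disj: "pairwise (\<lambda>i j. {s i<..<t i} \<inter> {s j<..<t j} = {}) p"
    proof (intro pairwiseI)
      fix i j assume ij: "i \<in> p" "j \<in> p" "i \<noteq> j"
      then have "interior (snd i) \<inter> interior (snd j) = {}"
        using tagged_division_ofD(5)[OF p(1), of "fst i" "snd i" "fst j" "snd j"] by auto
      moreover have "snd i = {s i..t i}" "snd j = {s j..t j}"
        using pK[of "fst i" "snd i"] pK[of "fst j" "snd j"] ij by (auto simp: s_def t_def)
      ultimately show "{s i<..<t i} \<inter> {s j<..<t j} = {}" by simp
    qed
    have bad: "(\<Sum>q\<in>P. norm (f (t q) - f (s q))) < \<epsilon>"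
    proof (rule abs_continuous_on_sum_finite[OF \<open>finite P\<close> \<delta>])
      show "l \<le> s q \<and> s q \<le> t q \<and> t q \<le> u" if "q \<in> P" for q
        using that pK[of "fst q" "snd q"] by (force simp: P_def s_def t_def)
      show "pairwise (\<lambda>i j. {s i<..<t i} \<inter> {s j<..<t j} = {}) P"
        using disj Pp(1) by (rule pairwise_subset)
      have st: "s q \<le> t q" if "q \<in> P" for q
        using that pK[of "fst q" "snd q"] by (force simp: P_def s_def t_def)
      have "ennreal (\<Sum>q\<in>P. t q - s q) = (\<Sum>q\<in>P. emeasure lborel {s q<..<t q})"
        using st by (simp add: sum_ennreal)
      also have "\<dots> = emeasure lborel (\<Union>q\<in>P. {s q<..<t q})"
        using pairwise_subset[OF disj Pp(1)] Pp(2)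
        by (intro sum_emeasure) (auto simp: disjoint_family_on_def pairwise_def)
      also have "\<dots> \<le> emeasure lborel G"
      proof (rule emeasure_mono)
        show "(\<Union>q\<in>P. {s q<..<t q}) \<subseteq> G"
        proof
          fix y assume "y \<in> (\<Union>q\<in>P. {s q<..<t q})"
          then obtain x K where q: "(x, K) \<in> p" "x \<in> N" "y \<in> {Inf K<..<Sup K}"
            by (auto simp: P_def s_def t_def)
          then have "y \<in> ball x (r x)" 
          proof -
            have "y \<in> {Inf K..Sup K}" using q(3) by auto
            with pK[OF q(1)] show ?thesis by blast
          qed
          then show "y \<in> G" using r(2)[OF q(2)] by blast
        qed
      qed (use G in auto)
      also note mG
      finally have "(\<Sum>q\<in>P. t q - s q) \<le> \<delta> / 2" using \<open>\<delta> > 0\<close> by (simp add: ennreal_le_iff)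
      then show "(\<Sum>q\<in>P. t q - s q) < \<delta>" using \<open>\<delta> > 0\<close> by simp
    qed
    have good: "norm (f (t q) - f (s q)) \<le> \<epsilon> * (t q - s q)" if "q \<in> p - P" for q
    proof -
      obtain x K where q: "q = (x, K)" "(x, K) \<in> p" "x \<notin> N" using \<open>q \<in> p - P\<close> by (cases q) (auto simp: P_def)
      have e: "K = {s q..t q}" "s q \<le> x" "x \<le> t q" "K \<subseteq> ball x (r x)" "x \<in> {l..u} - N"
        using pK[OF q(2)] q by (auto simp: s_def t_def)
      then have "s q \<in> ball x (r x)" "t q \<in> ball x (r x)"
        by (metis atLeastAtMost_iff order_refl order_trans subsetD)+
      then have "norm (f (s q) - f x) \<le> \<epsilon> * \<bar>s q - x\<bar>" "norm (f (t q) - f x) \<le> \<epsilon> * \<bar>t q - x\<bar>"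
        using r(3)[OF e(5)] by blast+
      moreover have "norm (f (t q) - f (s q)) \<le> norm (f (t q) - f x) + norm (f (s q) - f x)"
        using norm_triangle_ineq4[of "f (t q) - f x" "f (s q) - f x"] by simp
      ultimately show ?thesis using e(2,3) by (simp add: algebra_simps)
    qed
    have "f u - f l = (\<Sum>q\<in>p. f (t q) - f (s q))"
      using additive_tagged_division_1[OF \<open>l \<le> u\<close> p(1), of f] by (simp add: s_def t_def case_prod_beta)
    also have "norm \<dots> \<le> (\<Sum>q\<in>p. norm (f (t q) - f (s q)))" by (rule norm_sum)
    also have "\<dots> = (\<Sum>q\<in>p - P. norm (f (t q) - f (s q))) + (\<Sum>q\<in>P. norm (f (t q) - f (s q)))"
      using Pp \<open>finite p\<close> by (simp add: sum.subset_diff)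
    also have "\<dots> \<le> (\<Sum>q\<in>p. \<epsilon> * (t q - s q)) + \<epsilon>"
    proof (intro add_mono less_imp_le[OF bad])
      have "(\<Sum>q\<in>p - P. norm (f (t q) - f (s q))) \<le> (\<Sum>q\<in>p - P. \<epsilon> * (t q - s q))"
        by (intro sum_mono good)
      also have "\<dots> \<le> (\<Sum>q\<in>p. \<epsilon> * (t q - s q))"
      proof (intro sum_mono2 \<open>finite p\<close> Diff_subset)
        fix q assume "q \<in> p - (p - P)"
        then show "0 \<le> \<epsilon> * (t q - s q)" using pK[of "fst q" "snd q"] \<open>\<epsilon> > 0\<close>
          by (force simp: P_def s_def t_def)
      qed
      finally show "(\<Sum>q\<in>p - P. norm (f (t q) - f (s q))) \<le> (\<Sum>q\<in>p. \<epsilon> * (t q - s q))" .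
    qed
    also have "(\<Sum>q\<in>p. \<epsilon> * (t q - s q)) = \<epsilon> * (u - l)"
      using additive_tagged_division_1[OF \<open>l \<le> u\<close> p(1), of "\<lambda>x. x"]
      by (simp add: s_def t_def case_prod_beta sum_distrib_left[symmetric])
    finally show ?thesis .
  qed
  have "norm (f u - f l) \<le> e" if "e > 0" for e
  proof -
    have "e / (u - l + 1) > 0" using that \<open>l \<le> u\<close> by simp
    from small[OF this] have "norm (f u - f l) \<le> e / (u - l + 1) * (u - l + 1)"
      by (simp only: distrib_left mult_1_right)
    then show ?thesis using \<open>l \<le> u\<close> by simp
  qed
  then have "norm (f u - f l) \<le> 0" by (rule field_le_epsilon[where y = 0, simplified])
  then show ?thesis by simp
qed

section \<open>Orthonormal rows and matrix inversion\<close>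

lemma orthonormal_rows_iff: "orthonormal_rows U \<longleftrightarrow> (\<forall>i j. U $ i \<bullet> U $ j = (if i = j then 1 else 0))"
  by (simp add: orthonormal_rows_def row_def)

text \<open>
  The condition \<open>U U'\<^sup>T = 0\<close> kills the derivative of every inner product of two rows.  These inner
  products are absolutely continuous because \<open>U\<close> is so and is bounded, hence they are constant.
\<close>

lemma orthonormal_rows_preserved:
  fixes U :: "real \<Rightarrow> real^'d^'r"
  assumes "abs_continuous_on 0 T U"
    and "AE t in lborel. t \<in> {0..T} \<longrightarrow>
        (\<exists>D. (U has_vector_derivative D) (at t) \<and> U t ** transpose D = 0)"
    and "orthonormal_rows (U 0)" and t: "t \<in> {0..T}"
  shows "orthonormal_rows (U t)"
proof -
  have ac: "abs_continuous_on 0 t U"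
    using assms(1) t by (auto intro: abs_continuous_on_subinterval)
  have "compact (U ` {0..t})"
    using abs_continuous_on_imp_continuous_on[OF ac] by (intro compact_continuous_image) auto
  then have "bounded (U ` {0..t})" by (rule compact_imp_bounded)
  then obtain B where "\<forall>x \<in> U ` {0..t}. norm x \<le> B"
    unfolding bounded_iff ..
  then have B: "\<And>s. s \<in> {0..t} \<Longrightarrow> norm (U s) \<le> B" by blast
  have "U t $ i \<bullet> U t $ j = U 0 $ i \<bullet> U 0 $ j" for i j
  proof (rule abs_continuous_on_zero_derivative[where f = "\<lambda>s. U s $ i \<bullet> U s $ j"])
    show "0 \<le> t" using t by simp
    show "abs_continuous_on 0 t (\<lambda>s. U s $ i \<bullet> U s $ j)"
    proof (rule abs_continuous_on_dominated[OF ac])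
      fix u v assume uv: "u \<in> {0..t}" "v \<in> {0..t}"
      have "U v $ i \<bullet> U v $ j - U u $ i \<bullet> U u $ j
          = U v $ i \<bullet> (U v - U u) $ j + (U v - U u) $ i \<bullet> U u $ j"
        by (simp add: inner_diff_left inner_diff_right)
      also have "norm \<dots> \<le> norm (U v $ i) * norm ((U v - U u) $ j) + norm ((U v - U u) $ i) * norm (U u $ j)"
        unfolding real_norm_def
        by (rule order_trans[OF abs_triangle_ineq add_mono[OF Cauchy_Schwarz_ineq2 Cauchy_Schwarz_ineq2]])
      also have "\<dots> \<le> B * norm (U v - U u) + norm (U v - U u) * B"
        by (rule add_mono[OF mult_mono mult_mono])
          (rule Finite_Cartesian_Product.norm_nth_le norm_ge_zero order_trans[OF Finite_Cartesian_Product.norm_nth_le B[OF uv(2)]]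
            order_trans[OF Finite_Cartesian_Product.norm_nth_le B[OF uv(1)]] order_trans[OF norm_ge_zero B[OF uv(1)]])+
      finally show "norm (U v $ i \<bullet> U v $ j - U u $ i \<bullet> U u $ j) \<le> (2 * B) * norm (U v - U u)"
        by simp
    qed
    show "AE s in lborel. s \<in> {0..t} \<longrightarrow>
        ((\<lambda>s. U s $ i \<bullet> U s $ j) has_vector_derivative 0) (at s)"
      using assms(2)
    proof eventually_elim
      case (elim s)
      show ?case
      proof
        assume "s \<in> {0..t}"
        then obtain D where D: "(U has_vector_derivative D) (at s)" "U s ** transpose D = 0"
          using elim t by auto
        have orth: "U s $ k \<bullet> D $ l = 0" for k l
        proof -
          have "U s $ k \<bullet> D $ l = (U s ** transpose D) $ k $ l"
            by (simp add: matrix_matrix_mult_def transpose_def inner_vec_def)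
          then show ?thesis using D(2) by simp
        qed
        have d: "((\<lambda>s. U s $ k) has_vector_derivative D $ k) (at s)" for k
          by (rule bounded_linear.has_vector_derivative[OF bounded_linear_vec_nth D(1)])
        show "((\<lambda>s. U s $ i \<bullet> U s $ j) has_vector_derivative 0) (at s)"
          using bounded_bilinear.has_vector_derivative[OF bounded_bilinear_inner d d, of i j]
          by (simp add: orth inner_commute[of "D $ i"])
      qed
    qed
  qed
  then show ?thesis using assms(3) by (simp add: orthonormal_rows_iff)
qed

lemma orthonormal_rows_mult_transpose:
  fixes U :: "real^'d^'r"
  assumes "orthonormal_rows U"
  shows "U ** transpose U = mat 1"
  using assms unfolding orthonormal_rows_iff
  by (simp add: matrix_matrix_mult_def transpose_def mat_def inner_vec_def vec_eq_iff)

lemma norm_transpose_orthonormal_mult: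
  fixes U :: "real^'d^'r"
  assumes "orthonormal_rows U"
  shows "norm (transpose U *v y) = norm y"
proof -
  have "(transpose U *v y) \<bullet> (transpose U *v y) = y \<bullet> (U *v (transpose U *v y))"
    by (simp add: dot_lmul_matrix)
  also have "\<dots> = y \<bullet> y"
    by (simp add: matrix_vector_mul_assoc orthonormal_rows_mult_transpose[OF assms]
        del: transpose_matrix_vector)
  finally show ?thesis by (simp add: norm_eq_sqrt_inner)
qed

lemma norm_orthonormal_mult_le:
  fixes U :: "real^'d^'r"
  assumes "orthonormal_rows U"
  shows "norm (U *v x) \<le> norm x"
proof -
  have "norm (U *v x) * norm (U *v x) = (U *v x) \<bullet> (U *v x)"
    by (simp add: norm_eq_sqrt_inner)
  also have "\<dots> = (transpose U *v (U *v x)) \<bullet> x"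
    by (simp add: dot_lmul_matrix)
  also have "\<dots> \<le> norm (transpose U *v (U *v x)) * norm x" by (rule norm_cauchy_schwarz)
  also have "\<dots> = norm (U *v x) * norm x"
    by (simp only: norm_transpose_orthonormal_mult[OF assms])
  finally show ?thesis by (cases "norm (U *v x) = 0") (auto simp: mult_le_cancel_left)
qed

lemma norm_matrix_squared: "(norm (A :: real^'m^'k))\<^sup>2 = (\<Sum>i\<in>UNIV. \<Sum>j\<in>UNIV. (A $ i $ j)\<^sup>2)"
  by (simp add: norm_vec_def L2_set_def sum_nonneg)

lemma norm_matrix_columns: "(norm (A :: real^'m^'k))\<^sup>2 = (\<Sum>j\<in>UNIV. (norm (column j A))\<^sup>2)"
  unfolding norm_matrix_squared
  by (subst sum.swap) (simp add: norm_vec_def L2_set_def column_def sum_nonneg)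

text \<open>
  The Frobenius norm is computed column by column, and \<open>U\<close> contracts each column.
\<close>

lemma norm_orthonormal_matrix_mult_le:
  fixes U :: "real^'d^'r" and B :: "real^'m^'d"
  assumes "orthonormal_rows U"
  shows "(norm (U ** B))\<^sup>2 \<le> (norm B)\<^sup>2"
proof -
  have "column j (U ** B) = U *v column j B" for j
    by (simp add: column_def matrix_matrix_mult_def matrix_vector_mult_def vec_eq_iff)
  then show ?thesis
    unfolding norm_matrix_columns
    by (auto intro!: sum_mono power_mono norm_orthonormal_mult_le[OF assms])
qed

text \<open>
  Cramer's rule for the columns of the inverse; it exhibits the inverse as a continuous function of
  the entries wherever the determinant does not vanish.
\<close>

lemma
  fixes A :: "real^'n^'n"
  assumes "det A \<noteq> 0"
  shows matrix_mult_matrix_inv: "A ** matrix_inv A = mat 1"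
    and matrix_inv_nth: "matrix_inv A $ k $ j =
      det (\<chi> i l. if l = k then axis j 1 $ i else A $ i $ l) / det A"
proof -
  have "\<exists>B. A ** B = mat 1 \<and> B ** A = mat 1"
    using assms by (simp add: invertible_det_nz[symmetric] invertible_def)
  then show inv: "A ** matrix_inv A = mat 1"
    unfolding matrix_inv_def by (rule someI2_ex) simp
  have "A *v (matrix_inv A *v axis j 1) = axis j 1"
    by (simp add: matrix_vector_mul_assoc inv)
  then have "matrix_inv A *v axis j 1 = (\<chi> k. det(\<chi> i l. if l=k then axis j 1 $ i else A$i$l) / det A)"
    by (simp add: cramer[OF assms])
  moreover have "(matrix_inv A *v axis j 1) $ k = matrix_inv A $ k $ j"
    by (simp add: matrix_vector_mult_basis column_def)
  ultimately show "matrix_inv A $ k $ j =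
      det (\<chi> i l. if l = k then axis j 1 $ i else A $ i $ l) / det A"
    by simp
qed

lemma continuous_on_det:
  fixes A :: "'a::topological_space \<Rightarrow> real^'n^'n"
  assumes "\<And>i j. continuous_on S (\<lambda>x. A x $ i $ j)"
  shows "continuous_on S (\<lambda>x. det (A x))"
  unfolding det_def by (intro continuous_intros assms)

lemma continuous_on_matrix_inv:
  fixes A :: "'a::topological_space \<Rightarrow> real^'n^'n"
  assumes "continuous_on S A" "\<And>x. x \<in> S \<Longrightarrow> det (A x) \<noteq> 0"
  shows "continuous_on S (\<lambda>x. matrix_inv (A x))"
proof -
  have A: "continuous_on S (\<lambda>x. A x $ i $ j)" for i j
    by (intro continuous_intros assms)
  have "continuous_on S (\<lambda>x. \<chi> k j. det (\<chi> i l. if l = k then axis j 1 $ i else A x $ i $ l) / det (A x))"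
  proof (intro continuous_on_vec_lambda continuous_on_divide continuous_on_det)
    fix j k i l :: 'n
    show "continuous_on S (\<lambda>x. (\<chi> i l. if l = k then axis j 1 $ i else A x $ i $ l) $ i $ l)"
      by (cases "l = k") (auto intro: A)
  qed (use A assms(2) in auto)
  moreover have "(\<chi> k j. det (\<chi> i l. if l = k then axis j 1 $ i else A x $ i $ l) / det (A x)) = matrix_inv (A x)"
    if "x \<in> S" for x
    using matrix_inv_nth[OF assms(2)[OF that]] by (simp add: vec_eq_iff)
  ultimately show ?thesis by (rule continuous_on_eq)
qed

text \<open>
  On a ball of matrices the determinant is bounded, whereas \<open>det (A\<^sup>-\<^sup>1) = 1 / det A\<close> escapes every bound.
\<close>

lemma norm_matrix_inv_blowup:
  fixes A :: "'a \<Rightarrow> real^'n^'n"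
  assumes "((\<lambda>x. det (A x)) \<longlongrightarrow> 0) G" and "eventually (\<lambda>x. det (A x) \<noteq> 0) G"
  shows "filterlim (\<lambda>x. norm (matrix_inv (A x))) at_top G"
  unfolding filterlim_at_top
proof
  fix Z :: real
  have "compact ((det :: real^'n^'n \<Rightarrow> real) ` cball 0 Z)"
    by (intro compact_continuous_image continuous_on_det compact_cball continuous_intros)
  then have "bounded ((det :: real^'n^'n \<Rightarrow> real) ` cball 0 Z)" by (rule compact_imp_bounded)
  then obtain L where "\<forall>d \<in> (det :: real^'n^'n \<Rightarrow> real) ` cball 0 Z. norm d \<le> L"
    unfolding bounded_iff ..
  then have L: "\<And>B :: real^'n^'n. norm B \<le> Z \<Longrightarrow> \<bar>det B\<bar> \<le> L" by simp
  have "eventually (\<lambda>x. \<bar>det (A x)\<bar> < 1 / (\<bar>L\<bar> + 1)) G"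
    using tendstoD[OF assms(1), of "1 / (\<bar>L\<bar> + 1)"] by (simp add: dist_real_def)
  then show "eventually (\<lambda>x. Z \<le> norm (matrix_inv (A x))) G"
    using assms(2)
  proof eventually_elim
    case (elim x)
    have "det (A x) * det (matrix_inv (A x)) = 1"
      unfolding det_mul[symmetric] matrix_mult_matrix_inv[OF elim(2)] by simp
    then have one: "\<bar>det (A x)\<bar> * \<bar>det (matrix_inv (A x))\<bar> = 1" by (simp flip: abs_mult)
    show ?case
    proof (rule ccontr)
      assume "\<not> ?case"
      then have "\<bar>det (matrix_inv (A x))\<bar> \<le> \<bar>L\<bar> + 1" using L[of "matrix_inv (A x)"] by linarith
      then have "1 \<le> \<bar>det (A x)\<bar> * (\<bar>L\<bar> + 1)" 
        using one mult_left_mono[OF _ abs_ge_zero[of "det (A x)"]] by metis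
      then show False using elim(1) by (simp add: field_simps)
    qed
  qed
qed

section \<open>Brownian increments and It\^o's isometry\<close>

lemma borel_measurable_vec_nth [measurable]:
  fixes f :: "'a \<Rightarrow> ('b::real_normed_vector)^'n"
  assumes "f \<in> borel_measurable N"
  shows "(\<lambda>x. f x $ i) \<in> borel_measurable N"
  using assms by (rule borel_measurable_continuous_on[rotated]) (intro continuous_intros)

context usual_filtered_prob_space
begin

lemma measurable_filtration: "0 \<le> t \<Longrightarrow> X \<in> measurable (F t) N \<Longrightarrow> X \<in> measurable M N"
  using filtration_subalgebra measurable_from_subalg by blast

lemma space_filtration: "0 \<le> t \<Longrightarrow> space (F t) = space M"
  using filtration_subalgebra[of t] by (auto simp: subalgebra_def)

lemma measurable_filtration_mono:
  assumes "0 \<le> s" "s \<le> t" "X \<in> measurable (F s) N"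
  shows "X \<in> measurable (F t) N"
  using assms filtration_mono[OF assms(1,2)] space_filtration[of s] space_filtration[of t]
  by (intro measurable_from_subalg[OF _ assms(3)]) (auto simp: subalgebra_def)

lemma brownian_adapted: "brownian_motion M F W \<Longrightarrow> 0 \<le> t \<Longrightarrow> W t \<in> borel_measurable (F t)"
  by (simp add: brownian_motion_def)

lemma brownian_measurable: "brownian_motion M F W \<Longrightarrow> 0 \<le> t \<Longrightarrow> W t \<in> borel_measurable M"
  using brownian_adapted measurable_filtration by blast

text \<open>
  Independence is needed for arbitrary functions of the increment vector, because the isometry
  involves products of two components of the same increment.
\<close>

lemma brownian_increment_indep:
  fixes A :: "'w \<Rightarrow> real" and g :: "real^'m \<Rightarrow> real"
  assumes W: "brownian_motion M F W" and st: "0 \<le> s" "s < t"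
    and A: "A \<in> borel_measurable (F s)" and g: "g \<in> borel_measurable borel"
  shows "indep_var borel A borel (\<lambda>\<omega>. g (W t \<omega> - W s \<omega>))"
proof -
  let ?D = "\<lambda>\<omega>. W t \<omega> - W s \<omega>"
  have D: "?D \<in> borel_measurable M" using brownian_measurable[OF W] st by auto
  have ind: "indep_set (sets (F s)) (sets (vimage_algebra (space M) ?D borel))"
    using W st by (simp add: brownian_motion_def)
  have 1: "sigma_sets (space M) {A -` B \<inter> space M | B. B \<in> sets borel} \<subseteq> sets (F s)"
  proof -
    have "{A -` B \<inter> space M | B. B \<in> sets borel} \<subseteq> sets (F s)"
      using measurable_sets[OF A] unfolding space_filtration[OF st(1)] by blast
    then show ?thesis
      using sets.sigma_sets_subset[of _ "F s"] unfolding space_filtration[OF st(1)] by blast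
  qed
  have "{(\<lambda>\<omega>. g (?D \<omega>)) -` B \<inter> space M | B. B \<in> sets borel} \<subseteq> sets (vimage_algebra (space M) ?D borel)"
  proof clarify
    fix B :: "real set" assume "B \<in> sets borel"
    then have "g -` B \<in> sets borel" using measurable_sets[OF g] by simp
    moreover have "(\<lambda>\<omega>. g (?D \<omega>)) -` B \<inter> space M = ?D -` (g -` B) \<inter> space M" by auto
    ultimately show "(\<lambda>\<omega>. g (?D \<omega>)) -` B \<inter> space M \<in> sets (vimage_algebra (space M) ?D borel)"
      using in_vimage_algebra by simp
  qed
  then have 2: "sigma_sets (space M) {(\<lambda>\<omega>. g (?D \<omega>)) -` B \<inter> space M | B. B \<in> sets borel}
      \<subseteq> sets (vimage_algebra (space M) ?D borel)"
    using sets.sigma_sets_subset[of _ "vimage_algebra (space M) ?D borel"] by simp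
  show ?thesis
    unfolding indep_var_eq
  proof (intro conjI)
    show "random_variable borel A" using A st measurable_filtration by blast
    show "random_variable borel (\<lambda>\<omega>. g (?D \<omega>))" using measurable_compose[OF D g] .
    show "indep_set (sigma_sets (space M) {A -` B \<inter> space M | B. B \<in> sets borel})
      (sigma_sets (space M) {(\<lambda>\<omega>. g (?D \<omega>)) -` B \<inter> space M | B. B \<in> sets borel})"
      using ind unfolding indep_set_def
      by (rule indep_sets_mono_sets) (use 1 2 in \<open>auto split: bool.split\<close>)
  qed
qed

lemma brownian_increment_moments:
  fixes W :: "real \<Rightarrow> 'w \<Rightarrow> real^'m"
  assumes W: "brownian_motion M F W" and st: "0 \<le> s" "s < t"
  shows "integrable M (\<lambda>\<omega>. (W t \<omega> - W s \<omega>) $ j)"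
    and "expectation (\<lambda>\<omega>. (W t \<omega> - W s \<omega>) $ j) = 0"
    and "integrable M (\<lambda>\<omega>. (W t \<omega> - W s \<omega>) $ j * (W t \<omega> - W s \<omega>) $ l)"
    and "expectation (\<lambda>\<omega>. (W t \<omega> - W s \<omega>) $ j * (W t \<omega> - W s \<omega>) $ l) = (if j = l then t - s else 0)"
proof -
  let ?D = "\<lambda>j \<omega>. (W t \<omega> - W s \<omega>) $ j"
  let ?f = "\<lambda>x. ennreal (normal_density 0 (sqrt (t - s)) x)"
  have dist: "distributed M lborel (?D j) ?f" for j
    using W st by (simp add: brownian_motion_def)
  have \<sigma>: "0 < sqrt (t - s)" using st by simp
  show int: "integrable M (?D j)" for j
    by (rule distributed_integrable_var[OF dist]) (use integrable_normal_moment_nz_1[OF \<sigma>] in auto)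
  show ex: "expectation (?D j) = 0" for j
    by (rule normal_distributed_expectation[OF \<sigma> dist])
  have sq: "integrable M (\<lambda>\<omega>. ?D j \<omega> * ?D j \<omega>)" for j
    using distributed_integrable[OF dist, of "\<lambda>x. x\<^sup>2" j] integrable_normal_moment[OF \<sigma>, of 0 2]
    by (simp add: power2_eq_square)
  have ex2: "expectation (\<lambda>\<omega>. ?D j \<omega> * ?D j \<omega>) = t - s" for j
    using normal_distributed_variance[OF \<sigma> dist, of j] st by (simp only: ex) (simp add: power2_eq_square)
  have "indep_vars (\<lambda>_. borel) ?D UNIV" using W st by (simp add: brownian_motion_def)
  then have ind: "indep_vars (\<lambda>_. borel) ?D {j, l}" by (rule indep_vars_subset) auto
  show "integrable M (\<lambda>\<omega>. ?D j \<omega> * ?D l \<omega>)"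
  proof (cases "j = l")
    case False
    then show ?thesis using indep_vars_integrable[OF _ ind int] by simp
  qed (use sq in simp)
  show "expectation (\<lambda>\<omega>. ?D j \<omega> * ?D l \<omega>) = (if j = l then t - s else 0)"
  proof (cases "j = l")
    case False
    then show ?thesis using indep_vars_lebesgue_integral[OF _ ind int] ex by simp
  qed (use ex2 in simp)
qed

lemma brownian_increment_mult:
  fixes W :: "real \<Rightarrow> 'w \<Rightarrow> real^'m"
  assumes W: "brownian_motion M F W" and st: "0 \<le> s" "s \<le> t"
    and A: "A \<in> borel_measurable (F s)" "integrable M A"
  shows "integrable M (\<lambda>\<omega>. A \<omega> * (W t \<omega> - W s \<omega>) $ j)"
    and "expectation (\<lambda>\<omega>. A \<omega> * (W t \<omega> - W s \<omega>) $ j) = 0"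
    and "integrable M (\<lambda>\<omega>. A \<omega> * ((W t \<omega> - W s \<omega>) $ j * (W t \<omega> - W s \<omega>) $ l))"
    and "expectation (\<lambda>\<omega>. A \<omega> * ((W t \<omega> - W s \<omega>) $ j * (W t \<omega> - W s \<omega>) $ l))
           = expectation A * (if j = l then t - s else 0)"
proof -
  consider "s = t" | "s < t" using st by linarith
  then have "integrable M (\<lambda>\<omega>. A \<omega> * (W t \<omega> - W s \<omega>) $ j) \<and>
    expectation (\<lambda>\<omega>. A \<omega> * (W t \<omega> - W s \<omega>) $ j) = 0 \<and>
    integrable M (\<lambda>\<omega>. A \<omega> * ((W t \<omega> - W s \<omega>) $ j * (W t \<omega> - W s \<omega>) $ l)) \<and>
    expectation (\<lambda>\<omega>. A \<omega> * ((W t \<omega> - W s \<omega>) $ j * (W t \<omega> - W s \<omega>) $ l))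
           = expectation A * (if j = l then t - s else 0)"
  proof cases
    case 2
    note m = brownian_increment_moments[OF W st(1) 2]
    have 1: "indep_var borel A borel (\<lambda>\<omega>. (W t \<omega> - W s \<omega>) $ j)"
      by (rule brownian_increment_indep[OF W st(1) 2 A(1)]) measurable
    have 2: "indep_var borel A borel (\<lambda>\<omega>. (W t \<omega> - W s \<omega>) $ j * (W t \<omega> - W s \<omega>) $ l)"
      by (rule brownian_increment_indep[OF W st(1) 2 A(1)]) measurable
    show ?thesis
      using indep_var_integrable[OF 1 A(2) m(1)] indep_var_lebesgue_integral[OF 1 A(2) m(1)]
        indep_var_integrable[OF 2 A(2) m(3)] indep_var_lebesgue_integral[OF 2 A(2) m(3)]
      by (simp only: m(2,4)) simp
  qed simp
  then show "integrable M (\<lambda>\<omega>. A \<omega> * (W t \<omega> - W s \<omega>) $ j)"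
    and "expectation (\<lambda>\<omega>. A \<omega> * (W t \<omega> - W s \<omega>) $ j) = 0"
    and "integrable M (\<lambda>\<omega>. A \<omega> * ((W t \<omega> - W s \<omega>) $ j * (W t \<omega> - W s \<omega>) $ l))"
    and "expectation (\<lambda>\<omega>. A \<omega> * ((W t \<omega> - W s \<omega>) $ j * (W t \<omega> - W s \<omega>) $ l))
           = expectation A * (if j = l then t - s else 0)"
    by blast+
qed

lemma simple_integrand_nonneg:
  assumes "simple_integrand M F n q \<xi>" "k \<le> n"
  shows "0 \<le> q k"
  using assms(2)
proof (induction k)
  case 0
  then show ?case using assms(1) by (simp add: simple_integrand_def)
next
  case (Suc k)
  then show ?case using assms(1) order_trans[of 0 "q k" "q (Suc k)"] by (simp add: simple_integrand_def)
qed

lemma simple_integrand_Suc: "simple_integrand M F (Suc n) q \<xi> \<Longrightarrow> simple_integrand M F n q \<xi>"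
  by (simp add: simple_integrand_def)

lemma bounded_mult_integrable:
  fixes f g :: "'w \<Rightarrow> real"
  assumes "integrable M f" "g \<in> borel_measurable M" "\<And>\<omega>. \<omega> \<in> space M \<Longrightarrow> \<bar>g \<omega>\<bar> \<le> B"
  shows "integrable M (\<lambda>\<omega>. f \<omega> * g \<omega>)"
proof (rule Bochner_Integration.integrable_bound[of M "\<lambda>\<omega>. B * f \<omega>"])
  show "AE \<omega> in M. norm (f \<omega> * g \<omega>) \<le> norm (B * f \<omega>)"
  proof (rule AE_I2)
    fix \<omega> assume "\<omega> \<in> space M"
    then have "\<bar>g \<omega>\<bar> \<le> \<bar>B\<bar>" using assms(3) by fastforce
    then show "norm (f \<omega> * g \<omega>) \<le> norm (B * f \<omega>)"
      by (simp add: abs_mult mult.commute[of "\<bar>f \<omega>\<bar>"] mult_right_mono)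
  qed
qed (use assms in auto)

text \<open>
  Induction on the number of steps.  The square of the sum is the previous square plus mixed terms,
  which vanish because the new increment is centred and independent of everything before it, plus
  the products of components of the new increment, of which only the diagonal ones survive.
\<close>

lemma ito_isometry_component:
  fixes \<xi> :: "nat \<Rightarrow> 'w \<Rightarrow> real^'m^'k" and i :: 'k
  assumes W: "brownian_motion M F W" and \<xi>: "simple_integrand M F n q \<xi>"
  defines "X \<equiv> \<lambda>\<omega>. \<Sum>k<n. \<Sum>j\<in>UNIV. \<xi> k \<omega> $ i $ j * (W (q (Suc k)) \<omega> - W (q k) \<omega>) $ j"
  shows "X \<in> borel_measurable (F (q n)) \<and> integrable M (\<lambda>\<omega>. (X \<omega>)\<^sup>2) \<and>
    expectation (\<lambda>\<omega>. (X \<omega>)\<^sup>2) =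
      (\<Sum>k<n. \<Sum>j\<in>UNIV. expectation (\<lambda>\<omega>. (\<xi> k \<omega> $ i $ j)\<^sup>2) * (q (Suc k) - q k))"
  using \<xi> unfolding X_def
proof (induction n)
  case 0
  then show ?case by simp
next
  case (Suc n)
  define X where "X \<omega> = (\<Sum>k<n. \<Sum>j\<in>UNIV. \<xi> k \<omega> $ i $ j * (W (q (Suc k)) \<omega> - W (q k) \<omega>) $ j)" for \<omega>
  define D where "D \<omega> j = (W (q (Suc n)) \<omega> - W (q n) \<omega>) $ j" for \<omega> j
  define a where "a \<omega> j = \<xi> n \<omega> $ i $ j" for \<omega> j
  note IH = Suc.IH[OF simple_integrand_Suc[OF Suc.prems], folded X_def]
  have q: "0 \<le> q n" "q n \<le> q (Suc n)" "\<xi> n \<in> borel_measurable (F (q n))" "bounded (\<xi> n ` space M)"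
    using Suc.prems simple_integrand_nonneg[OF Suc.prems, of n] by (auto simp: simple_integrand_def)
  obtain B where B: "\<And>\<omega>. \<omega> \<in> space M \<Longrightarrow> norm (\<xi> n \<omega>) \<le> B"
    using q(4) unfolding bounded_iff by blast
  have aB: "\<bar>a \<omega> j\<bar> \<le> B" if "\<omega> \<in> space M" for \<omega> j
    using order_trans[OF Finite_Cartesian_Product.norm_nth_le order_trans[OF Finite_Cartesian_Product.norm_nth_le B[OF that]]]
    by (auto simp: a_def)
  have aF: "(\<lambda>\<omega>. a \<omega> j) \<in> borel_measurable (F (q n))" for j
    using q(3) unfolding a_def by measurable
  have aM: "(\<lambda>\<omega>. a \<omega> j) \<in> borel_measurable M" for j
    using aF measurable_filtration[OF q(1)] by blast
  have XF: "X \<in> borel_measurable (F (q n))" and X2: "integrable M (\<lambda>\<omega>. (X \<omega>)\<^sup>2)" using IH by auto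
  have X1: "integrable M X"
    by (rule square_integrable_imp_integrable) (use X2 XF measurable_filtration[OF q(1)] in auto)
  have XaF: "(\<lambda>\<omega>. X \<omega> * a \<omega> j) \<in> borel_measurable (F (q n))" for j
    using XF aF by measurable
  have Xa: "integrable M (\<lambda>\<omega>. X \<omega> * a \<omega> j)" for j
    by (rule bounded_mult_integrable[OF X1 aM aB])
  have aaF: "(\<lambda>\<omega>. a \<omega> j * a \<omega> l) \<in> borel_measurable (F (q n))" for j l
    using aF by measurable
  have a1: "integrable M (\<lambda>\<omega>. a \<omega> j)" for j
    by (rule integrable_const_bound[where B = B]) (use aB aM in auto)
  have aa: "integrable M (\<lambda>\<omega>. a \<omega> j * a \<omega> l)" for j l
    by (rule bounded_mult_integrable[OF a1 aM aB])
  note m1 = brownian_increment_mult(1,2)[OF W q(1,2) XaF Xa, folded D_def]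
  note m2 = brownian_increment_mult(3,4)[OF W q(1,2) aaF aa, folded D_def]
  have expand: "(X \<omega> + (\<Sum>j\<in>UNIV. a \<omega> j * D \<omega> j))\<^sup>2 =
      (X \<omega>)\<^sup>2 + 2 * (\<Sum>j\<in>UNIV. X \<omega> * a \<omega> j * D \<omega> j) +
      (\<Sum>j\<in>UNIV. \<Sum>l\<in>UNIV. a \<omega> j * a \<omega> l * (D \<omega> j * D \<omega> l))" for \<omega>
  proof -
    have "(\<Sum>j\<in>UNIV. a \<omega> j * D \<omega> j)\<^sup>2 = (\<Sum>j\<in>UNIV. \<Sum>l\<in>UNIV. a \<omega> j * a \<omega> l * (D \<omega> j * D \<omega> l))"
      unfolding power2_eq_square sum_product by (simp add: mult_ac)
    then show ?thesis by (simp add: power2_sum sum_distrib_left mult_ac)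
  qed
  have int: "integrable M (\<lambda>\<omega>. (X \<omega> + (\<Sum>j\<in>UNIV. a \<omega> j * D \<omega> j))\<^sup>2)"
    unfolding expand using X2 m1(1) m2(1) by (intro Bochner_Integration.integrable_add integrable_mult_right Bochner_Integration.integrable_sum) auto
  have "expectation (\<lambda>\<omega>. (X \<omega> + (\<Sum>j\<in>UNIV. a \<omega> j * D \<omega> j))\<^sup>2) =
      expectation (\<lambda>\<omega>. (X \<omega>)\<^sup>2) + 2 * (\<Sum>j\<in>UNIV. expectation (\<lambda>\<omega>. X \<omega> * a \<omega> j * D \<omega> j)) +
      (\<Sum>j\<in>UNIV. \<Sum>l\<in>UNIV. expectation (\<lambda>\<omega>. a \<omega> j * a \<omega> l * (D \<omega> j * D \<omega> l)))"
    unfolding expand using X2 m1(1) m2(1) by simp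
  also have "\<dots> = expectation (\<lambda>\<omega>. (X \<omega>)\<^sup>2) + (\<Sum>j\<in>UNIV. expectation (\<lambda>\<omega>. (a \<omega> j)\<^sup>2) * (q (Suc n) - q n))"
    by (simp add: m1(2) m2(2) power2_eq_square if_distrib cong: if_cong)
  finally have ex: "expectation (\<lambda>\<omega>. (X \<omega> + (\<Sum>j\<in>UNIV. a \<omega> j * D \<omega> j))\<^sup>2) =
    expectation (\<lambda>\<omega>. (X \<omega>)\<^sup>2) + (\<Sum>j\<in>UNIV. expectation (\<lambda>\<omega>. (a \<omega> j)\<^sup>2) * (q (Suc n) - q n))" .
  have DF: "(\<lambda>\<omega>. D \<omega> j) \<in> borel_measurable (F (q (Suc n)))" for j
  proof -
    have [measurable]: "W (q (Suc n)) \<in> borel_measurable (F (q (Suc n)))"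
      "W (q n) \<in> borel_measurable (F (q (Suc n)))"
      using brownian_adapted[OF W] q measurable_filtration_mono[OF q(1,2)] by auto
    show ?thesis unfolding D_def by measurable
  qed
  have meas: "(\<lambda>\<omega>. X \<omega> + (\<Sum>j\<in>UNIV. a \<omega> j * D \<omega> j)) \<in> borel_measurable (F (q (Suc n)))"
    using measurable_filtration_mono[OF q(1,2)] XF aF DF
    by (intro borel_measurable_add borel_measurable_sum borel_measurable_times) auto
  show ?case
    using int ex meas IH unfolding sum.lessThan_Suc X_def[symmetric] a_def D_def by simp
qed

text \<open>
  The squared Euclidean norm of the integral and the squared Frobenius norm of the integrand are both
  sums over rows, and each row satisfies the scalar isometry.
\<close>

lemma ito_isometry_simple:
  fixes \<xi> :: "nat \<Rightarrow> 'w \<Rightarrow> real^'m^'k"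
  assumes W: "brownian_motion M F W" and \<xi>: "simple_integrand M F n q \<xi>"
  defines "S \<equiv> \<lambda>\<omega>. \<Sum>k<n. \<xi> k \<omega> *v (W (q (Suc k)) \<omega> - W (q k) \<omega>)"
  shows "integrable M (\<lambda>\<omega>. (norm (S \<omega>))\<^sup>2)"
    and "integrable M (\<lambda>\<omega>. \<Sum>k<n. (norm (\<xi> k \<omega>))\<^sup>2 * (q (Suc k) - q k))"
    and "expectation (\<lambda>\<omega>. (norm (S \<omega>))\<^sup>2) =
      expectation (\<lambda>\<omega>. \<Sum>k<n. (norm (\<xi> k \<omega>))\<^sup>2 * (q (Suc k) - q k))"
proof -
  let ?X = "\<lambda>i \<omega>. \<Sum>k<n. \<Sum>j\<in>UNIV. \<xi> k \<omega> $ i $ j * (W (q (Suc k)) \<omega> - W (q k) \<omega>) $ j"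
  note iso = ito_isometry_component[OF W \<xi>]
  have S: "(norm (S \<omega>))\<^sup>2 = (\<Sum>i\<in>UNIV. (?X i \<omega>)\<^sup>2)" for \<omega>
    by (simp add: S_def norm_vec_def L2_set_def sum_nonneg matrix_vector_mult_def)
  have N: "(norm (\<xi> k \<omega>))\<^sup>2 = (\<Sum>i\<in>UNIV. \<Sum>j\<in>UNIV. (\<xi> k \<omega> $ i $ j)\<^sup>2)" for k \<omega>
    by (simp add: norm_vec_def L2_set_def sum_nonneg)
  show "integrable M (\<lambda>\<omega>. (norm (S \<omega>))\<^sup>2)"
    unfolding S using iso by (intro Bochner_Integration.integrable_sum) blast
  have \<xi>2: "integrable M (\<lambda>\<omega>. (\<xi> k \<omega> $ i $ j)\<^sup>2)" if "k < n" for i j k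
  proof -
    have q: "0 \<le> q k" "\<xi> k \<in> borel_measurable (F (q k))" "bounded (\<xi> k ` space M)"
      using that \<xi> simple_integrand_nonneg[OF \<xi>, of k] by (auto simp: simple_integrand_def)
    obtain B where B: "\<And>\<omega>. \<omega> \<in> space M \<Longrightarrow> norm (\<xi> k \<omega>) \<le> B"
      using q(3) unfolding bounded_iff by blast
    have "\<xi> k \<in> borel_measurable M" using measurable_filtration[OF q(1,2)] .
    then have [measurable]: "(\<lambda>\<omega>. \<xi> k \<omega> $ i $ j) \<in> borel_measurable M" by measurable
    have "norm ((\<xi> k \<omega> $ i $ j)\<^sup>2) \<le> B\<^sup>2" if "\<omega> \<in> space M" for \<omega>
      using order_trans[OF Finite_Cartesian_Product.norm_nth_le order_trans[OF Finite_Cartesian_Product.norm_nth_le B[OF that]], of i j]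
      by (simp add: abs_le_square_iff[symmetric])
    then show ?thesis by (intro integrable_const_bound[where B = "B\<^sup>2"] AE_I2) auto
  qed
  show "integrable M (\<lambda>\<omega>. \<Sum>k<n. (norm (\<xi> k \<omega>))\<^sup>2 * (q (Suc k) - q k))"
    unfolding N using \<xi>2 by (intro Bochner_Integration.integrable_sum integrable_mult_left) auto
  have "expectation (\<lambda>\<omega>. (norm (S \<omega>))\<^sup>2) = (\<Sum>i\<in>UNIV. expectation (\<lambda>\<omega>. (?X i \<omega>)\<^sup>2))"
    unfolding S using iso by (intro Bochner_Integration.integral_sum) blast
  also have "\<dots> = (\<Sum>i\<in>UNIV. \<Sum>k<n. \<Sum>j\<in>UNIV. expectation (\<lambda>\<omega>. (\<xi> k \<omega> $ i $ j)\<^sup>2) * (q (Suc k) - q k))"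
    using iso by simp
  also have "\<dots> = (\<Sum>k<n. \<Sum>i\<in>UNIV. \<Sum>j\<in>UNIV. expectation (\<lambda>\<omega>. (\<xi> k \<omega> $ i $ j)\<^sup>2) * (q (Suc k) - q k))"
    by (rule sum.swap)
  also have "\<dots> = expectation (\<lambda>\<omega>. \<Sum>k<n. (norm (\<xi> k \<omega>))\<^sup>2 * (q (Suc k) - q k))"
    unfolding N using \<xi>2 by (simp add: sum_distrib_right Bochner_Integration.integral_sum Bochner_Integration.integrable_sum)
  finally show "expectation (\<lambda>\<omega>. (norm (S \<omega>))\<^sup>2) =
      expectation (\<lambda>\<omega>. \<Sum>k<n. (norm (\<xi> k \<omega>))\<^sup>2 * (q (Suc k) - q k))" .
qed

end

section \<open>The truncated isometry for It\^o integrals\<close>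

lemma simple_process_norm_squared:
  assumes mono: "\<And>k. k < n \<Longrightarrow> p k \<le> p (Suc k)"
  shows "(norm (simple_process n p \<xi> r \<omega>))\<^sup>2 =
    (\<Sum>k<n. indicator {p k<..p (Suc k)} r * (norm (\<xi> k \<omega>))\<^sup>2)"
proof (cases "\<exists>k<n. r \<in> {p k<..p (Suc k)}")
  case True
  then obtain k where k: "k < n" "r \<in> {p k<..p (Suc k)}" by blast
  have le: "p i \<le> p j" if "i \<le> j" "j \<le> n" for i j
    using that by (induction j rule: dec_induct) (use mono in \<open>auto intro: order_trans\<close>)
  have other: "r \<notin> {p i<..p (Suc i)}" if "i < n" "i \<noteq> k" for i
  proof (cases "i < k")
    case True
    then show ?thesis using le[of "Suc i" k] k by auto
  next
    case False
    then show ?thesis using le[of "Suc k" i] k that by auto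
  qed
  define u where "u i = (indicator {p i<..p (Suc i)} r :: real)" for i
  have u: "u k = 1" "\<And>i. i < n \<Longrightarrow> i \<noteq> k \<Longrightarrow> u i = 0"
    using k other by (auto simp: u_def)
  have "simple_process n p \<xi> r \<omega> = (\<Sum>i\<in>{k}. u i *\<^sub>R \<xi> i \<omega>)"
    unfolding simple_process_def u_def[symmetric] using k u by (intro sum.mono_neutral_right) auto
  moreover have "(\<Sum>i<n. u i * (norm (\<xi> i \<omega>))\<^sup>2) = (\<Sum>i\<in>{k}. u i * (norm (\<xi> i \<omega>))\<^sup>2)"
    using k u by (intro sum.mono_neutral_right) auto
  ultimately show ?thesis unfolding u_def[symmetric] by (simp add: u(1))
next
  case False
  then have u: "indicator {p k<..p (Suc k)} r = (0::real)" if "k < n" for k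
    using that by (auto simp: indicator_def)
  have "simple_process n p \<xi> r \<omega> = 0"
    unfolding simple_process_def by (rule sum.neutral) (use u in auto)
  moreover have "(\<Sum>k<n. indicator {p k<..p (Suc k)} r * (norm (\<xi> k \<omega>))\<^sup>2) = 0"
    by (rule sum.neutral) (use u in auto)
  ultimately show ?thesis by (simp only:) simp
qed

lemma simple_process_borel: "(\<lambda>r. simple_process n p \<xi> r \<omega>) \<in> borel_measurable borel"
  unfolding simple_process_def by measurable

lemma simple_process_norm_integral:
  assumes mono: "\<And>k. k < n \<Longrightarrow> p k \<le> p (Suc k)" and st: "s \<le> t"
  shows "(\<integral>\<^sup>+r\<in>{s..t}. ennreal ((norm (simple_process n p \<xi> r \<omega>))\<^sup>2) \<partial>lborel) =
    ennreal (\<Sum>k<n. (norm (\<xi> k \<omega>))\<^sup>2 * (max s (min t (p (Suc k))) - max s (min t (p k))))"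
proof -
  let ?q = "\<lambda>k. max s (min t (p k))"
  have q: "?q k \<le> ?q (Suc k)" if "k < n" for k using mono[OF that] by auto
  have sq: "(norm (simple_process n p \<xi> r \<omega>))\<^sup>2 =
      (\<Sum>k<n. indicator {p k<..p (Suc k)} r * (norm (\<xi> k \<omega>))\<^sup>2)" for r
    by (intro simple_process_norm_squared mono)
  have ind_nn: "0 \<le> indicator {p k<..p (Suc k)} r * (norm (\<xi> k \<omega>))\<^sup>2" for k r by simp
  have "(\<integral>\<^sup>+r\<in>{s..t}. ennreal ((norm (simple_process n p \<xi> r \<omega>))\<^sup>2) \<partial>lborel) =
    (\<integral>\<^sup>+r. (\<Sum>k<n. ennreal ((norm (\<xi> k \<omega>))\<^sup>2) * indicator {?q k<..?q (Suc k)} r) \<partial>lborel)"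
  proof (rule nn_integral_cong_AE)
    show "AE r in lborel. ennreal ((norm (simple_process n p \<xi> r \<omega>))\<^sup>2) * indicator {s..t} r =
      (\<Sum>k<n. ennreal ((norm (\<xi> k \<omega>))\<^sup>2) * indicator {?q k<..?q (Suc k)} r)"
      using AE_lborel_singleton[of s]
    proof eventually_elim
      case (elim r)
      have iff: "r \<in> {?q k<..?q (Suc k)} \<longleftrightarrow> r \<in> {p k<..p (Suc k)} \<and> r \<in> {s..t}" for k
        using elim st by (auto simp: max_def min_def split: if_splits)
      have ind: "ennreal ((norm (\<xi> k \<omega>))\<^sup>2) * indicator {?q k<..?q (Suc k)} r =
          ennreal (indicator {p k<..p (Suc k)} r * (norm (\<xi> k \<omega>))\<^sup>2) * indicator {s..t} r" for k
        unfolding indicator_def iff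
        by (cases "r \<in> {p k<..p (Suc k)}"; cases "r \<in> {s..t}") simp_all
      show ?case
        unfolding sq ind by (simp only: sum_distrib_right[symmetric]) (simp only: sum_ennreal ind_nn)
    qed
  qed
  also have "\<dots> = (\<Sum>k<n. ennreal ((norm (\<xi> k \<omega>))\<^sup>2) * emeasure lborel {?q k<..?q (Suc k)})"
    by (subst nn_integral_sum) (auto simp: nn_integral_cmult)
  also have "\<dots> = (\<Sum>k<n. ennreal ((norm (\<xi> k \<omega>))\<^sup>2 * (?q (Suc k) - ?q k)))"
    using q by (intro sum.cong) (simp_all add: ennreal_mult)
  also have "\<dots> = ennreal (\<Sum>k<n. (norm (\<xi> k \<omega>))\<^sup>2 * (?q (Suc k) - ?q k))"
    using q by (intro sum_ennreal) simp
  finally show ?thesis .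
qed

context usual_filtered_prob_space
begin

lemma simple_integrand_mono:
  assumes "simple_integrand M F n q \<xi>" "i \<le> j" "j \<le> n"
  shows "q i \<le> q j"
  using assms(2,3)
  by (induction j rule: dec_induct) (use assms(1) in \<open>auto simp: simple_integrand_def intro: order_trans\<close>)

text \<open>
  The integrand is switched off before its accumulated energy exceeds \<open>c\<close>.  The energy spent up to
  and including step \<open>k\<close> is already known at time \<open>q k\<close>, so the result is again a simple integrand,
  and where the total energy is at most \<open>c\<close> nothing has changed.  This plays the part of
  localization by a stopping time.
\<close>

lemma ito_simple_truncated:
  fixes \<xi> :: "nat \<Rightarrow> 'w \<Rightarrow> real^'m^'k"
  assumes W: "brownian_motion M F W" and \<xi>: "simple_integrand M F n q \<xi>" and c: "0 \<le> c"
  defines "S \<equiv> \<lambda>\<omega>. \<Sum>k<n. \<xi> k \<omega> *v (W (q (Suc k)) \<omega> - W (q k) \<omega>)"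
    and "E \<equiv> \<lambda>k \<omega>. \<Sum>i<k. (norm (\<xi> i \<omega>))\<^sup>2 * (q (Suc i) - q i)"
  shows "E n \<in> borel_measurable M" and "S \<in> borel_measurable M"
    and "(\<integral>\<^sup>+\<omega>. (if E n \<omega> \<le> c then ennreal ((norm (S \<omega>))\<^sup>2) else 0) \<partial>M)
      \<le> (\<integral>\<^sup>+\<omega>. ennreal (min c (E n \<omega>)) \<partial>M)"
proof -
  define \<eta> where "\<eta> k \<omega> = (if E (Suc k) \<omega> \<le> c then \<xi> k \<omega> else 0)" for k \<omega>
  have q: "0 \<le> q k" "q k \<le> q (Suc k)" "\<xi> k \<in> borel_measurable (F (q k))" if "k < n" for k
    using that \<xi> simple_integrand_nonneg[OF \<xi>, of k] by (auto simp: simple_integrand_def)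
  have \<xi>F: "\<xi> i \<in> borel_measurable (F (q k))" if "i \<le> k" "k < n" for i k
    using that q(1,3)[of i] simple_integrand_mono[OF \<xi>, of i k] measurable_filtration_mono by auto
  have EF: "E (Suc k) \<in> borel_measurable (F (q k))" if "k < n" for k
    unfolding E_def using that \<xi>F
    by (intro borel_measurable_sum borel_measurable_times borel_measurable_power borel_measurable_norm) auto
  have \<eta>: "simple_integrand M F n q \<eta>"
    unfolding simple_integrand_def
  proof (intro conjI allI impI)
    fix k assume k: "k < n"
    show "\<eta> k \<in> borel_measurable (F (q k))"
      unfolding \<eta>_def using EF[OF k] q(3)[OF k] by measurable
    have "bounded (insert 0 (\<xi> k ` space M))" using \<xi> k by (simp add: simple_integrand_def)
    then show "bounded (\<eta> k ` space M)" by (rule bounded_subset) (auto simp: \<eta>_def)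
  qed (use \<xi> in \<open>auto simp: simple_integrand_def\<close>)
  have \<xi>M: "\<xi> k \<in> borel_measurable M" if "k < n" for k
    using q[OF that] measurable_filtration by blast
  show "E n \<in> borel_measurable M"
    unfolding E_def using \<xi>M
    by (intro borel_measurable_sum borel_measurable_times borel_measurable_power borel_measurable_norm) auto
  have WM: "W (q k) \<in> borel_measurable M" if "k \<le> n" for k
    using brownian_measurable[OF W] simple_integrand_nonneg[OF \<xi> that] .
  have "(\<lambda>\<omega>. S \<omega> $ i) \<in> borel_measurable M" for i
  proof -
    have "(\<lambda>\<omega>. \<Sum>k<n. \<Sum>j\<in>UNIV. \<xi> k \<omega> $ i $ j * (W (q (Suc k)) \<omega> - W (q k) \<omega>) $ j) \<in> borel_measurable M"
      using \<xi>M WM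
      by (intro borel_measurable_sum borel_measurable_times borel_measurable_vec_nth borel_measurable_diff) auto
    then show ?thesis by (simp add: S_def matrix_vector_mult_def)
  qed
  then show "S \<in> borel_measurable M"
    by (subst borel_measurable_euclidean_space) (auto simp: Basis_vec_def inner_axis)
  have E_mono: "E i \<omega> \<le> E j \<omega>" if "i \<le> j" "j \<le> n" for i j \<omega>
    unfolding E_def using that q(2) by (intro sum_mono2) auto
  have E_eq: "E j \<omega> = (\<Sum>i<j. (norm (\<xi> i \<omega>))\<^sup>2 * (q (Suc i) - q i))" for j \<omega>
    by (simp add: E_def)
  define E\<eta> where "E\<eta> \<omega> = (\<Sum>i<n. (norm (\<eta> i \<omega>))\<^sup>2 * (q (Suc i) - q i))" for \<omega>
  have budget: "(\<Sum>i<k. (norm (\<eta> i \<omega>))\<^sup>2 * (q (Suc i) - q i)) \<le> min c (E k \<omega>)" if "k \<le> n" for k \<omega>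
    using that
  proof (induction k)
    case 0
    then show ?case using c by (simp add: E_def)
  next
    case (Suc k)
    show ?case
    proof (cases "E (Suc k) \<omega> \<le> c")
      case True
      have "E (Suc i) \<omega> \<le> c" if "i < Suc k" for i
        using E_mono[of "Suc i" "Suc k" \<omega>] that Suc.prems True by simp
      then have "\<eta> i \<omega> = \<xi> i \<omega>" if "i < Suc k" for i using that by (simp add: \<eta>_def)
      then have "(\<Sum>i<Suc k. (norm (\<eta> i \<omega>))\<^sup>2 * (q (Suc i) - q i)) = E (Suc k) \<omega>"
        unfolding E_eq by (intro sum.cong) auto
      then show ?thesis using True by simp
    next
      case False
      then have "\<eta> k \<omega> = 0" by (simp add: \<eta>_def)
      then show ?thesis using Suc.IH Suc.prems E_mono[of k "Suc k" \<omega>] by auto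
    qed
  qed
  let ?S\<eta> = "\<lambda>\<omega>. \<Sum>k<n. \<eta> k \<omega> *v (W (q (Suc k)) \<omega> - W (q k) \<omega>)"
  have S\<eta>: "S \<omega> = ?S\<eta> \<omega>" if "E n \<omega> \<le> c" for \<omega>
  proof -
    have "E (Suc i) \<omega> \<le> c" if "i < n" for i
      using E_mono[of "Suc i" n \<omega>] that \<open>E n \<omega> \<le> c\<close> by simp
    then show ?thesis unfolding S_def by (intro sum.cong) (auto simp: \<eta>_def)
  qed
  note iso = ito_isometry_simple[OF W \<eta>]
  have "(\<integral>\<^sup>+\<omega>. (if E n \<omega> \<le> c then ennreal ((norm (S \<omega>))\<^sup>2) else 0) \<partial>M)
      \<le> (\<integral>\<^sup>+\<omega>. ennreal ((norm (?S\<eta> \<omega>))\<^sup>2) \<partial>M)"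
    by (intro nn_integral_mono) (auto simp: S\<eta>)
  also have "\<dots> = ennreal (expectation (\<lambda>\<omega>. (norm (?S\<eta> \<omega>))\<^sup>2))"
    by (intro nn_integral_eq_integral iso) auto
  also have "\<dots> = (\<integral>\<^sup>+\<omega>. ennreal (E\<eta> \<omega>) \<partial>M)"
    unfolding iso(3) E\<eta>_def using q(2)
    by (intro nn_integral_eq_integral[symmetric] iso) (auto intro!: sum_nonneg)
  also have "\<dots> \<le> (\<integral>\<^sup>+\<omega>. ennreal (min c (E n \<omega>)) \<partial>M)"
    unfolding E\<eta>_def using budget[of n] by (intro nn_integral_mono ennreal_leI) auto
  finally show "(\<integral>\<^sup>+\<omega>. (if E n \<omega> \<le> c then ennreal ((norm (S \<omega>))\<^sup>2) else 0) \<partial>M)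
      \<le> (\<integral>\<^sup>+\<omega>. ennreal (min c (E n \<omega>)) \<partial>M)" .
qed

text \<open>
  The increment of the integral over \<open>[s, t]\<close> is again the final value of a simple integral, for the
  partition points clamped to \<open>[s, t]\<close>.  Steps beginning after \<open>t\<close> are set to zero: their values are
  not yet known at the clamped partition point, and their increments vanish anyway.
\<close>

lemma simple_integral_increment_truncated:
  fixes \<xi> :: "nat \<Rightarrow> 'w \<Rightarrow> real^'m^'k"
  assumes W: "brownian_motion M F W" and \<xi>: "simple_integrand M F n p \<xi>" and c: "0 \<le> c"
    and st: "0 \<le> s" "s \<le> t"
  defines "Q \<equiv> \<lambda>\<omega>. \<integral>\<^sup>+r\<in>{s..t}. ennreal ((norm (simple_process n p \<xi> r \<omega>))\<^sup>2) \<partial>lborel"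
    and "S \<equiv> \<lambda>\<omega>. simple_integral W n p \<xi> t \<omega> - simple_integral W n p \<xi> s \<omega>"
  shows "Q \<in> borel_measurable M" and "S \<in> borel_measurable M"
    and "(\<integral>\<^sup>+\<omega>. (if Q \<omega> \<le> ennreal c then ennreal ((norm (S \<omega>))\<^sup>2) else 0) \<partial>M)
      \<le> (\<integral>\<^sup>+\<omega>. min (ennreal c) (Q \<omega>) \<partial>M)"
proof -
  define q where "q k = max s (min t (p k))" for k
  define \<eta> where "\<eta> k = (if p k \<le> t then \<xi> k else (\<lambda>_. 0))" for k
  have p: "p k \<le> p (Suc k)" if "k < n" for k using \<xi> that by (simp add: simple_integrand_def)
  have \<eta>: "simple_integrand M F n q \<eta>"
    unfolding simple_integrand_def
  proof (intro conjI allI impI)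
    show "0 \<le> q 0" using st by (simp add: q_def)
    fix k assume k: "k < n"
    show "q k \<le> q (Suc k)" using p[OF k] by (auto simp: q_def)
    show "bounded (\<eta> k ` space M)"
      using \<xi> k by (auto simp: \<eta>_def simple_integrand_def image_constant_conv)
    show "\<eta> k \<in> borel_measurable (F (q k))"
    proof (cases "p k \<le> t")
      case True
      then have "p k \<le> q k" by (simp add: q_def)
      then have "\<xi> k \<in> borel_measurable (F (q k))"
        using \<xi> k simple_integrand_nonneg[OF \<xi>, of k]
        by (intro measurable_filtration_mono[of "p k" "q k"]) (auto simp: simple_integrand_def)
      then show ?thesis using True by (simp add: \<eta>_def)
    qed (simp add: \<eta>_def)
  qed
  have qt: "q k = t \<and> q (Suc k) = t" if "\<not> p k \<le> t" "k < n" for k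
    using that p[of k] st by (auto simp: q_def)
  have Q: "Q \<omega> = ennreal (\<Sum>k<n. (norm (\<eta> k \<omega>))\<^sup>2 * (q (Suc k) - q k))" for \<omega>
    unfolding Q_def simple_process_norm_integral[of n p, OF p st(2), simplified] q_def[symmetric]
    using qt by (intro arg_cong[where f = ennreal] sum.cong) (auto simp: \<eta>_def)
  have S: "S \<omega> = (\<Sum>k<n. \<eta> k \<omega> *v (W (q (Suc k)) \<omega> - W (q k) \<omega>))" for \<omega>
  proof -
    have W_q: "W (min t x) \<omega> = W (max s (min t x)) \<omega> - W s \<omega> + W (min s x) \<omega>" for x
      using st by (auto simp: min_def max_def)
    have "S \<omega> = (\<Sum>k<n. \<xi> k \<omega> *v (W (min t (p (Suc k))) \<omega> - W (min t (p k)) \<omega>) -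
        \<xi> k \<omega> *v (W (min s (p (Suc k))) \<omega> - W (min s (p k)) \<omega>))"
      by (simp add: S_def simple_integral_def sum_subtractf)
    also have "\<dots> = (\<Sum>k<n. \<xi> k \<omega> *v (W (q (Suc k)) \<omega> - W (q k) \<omega>))"
    proof (intro sum.cong refl)
      fix k
      have "W (min t (p (Suc k))) \<omega> - W (min t (p k)) \<omega> - (W (min s (p (Suc k))) \<omega> - W (min s (p k)) \<omega>)
          = W (q (Suc k)) \<omega> - W (q k) \<omega>"
        unfolding q_def W_q[of "p k"] W_q[of "p (Suc k)"] by simp
      then show "\<xi> k \<omega> *v (W (min t (p (Suc k))) \<omega> - W (min t (p k)) \<omega>) -
        \<xi> k \<omega> *v (W (min s (p (Suc k))) \<omega> - W (min s (p k)) \<omega>) = \<xi> k \<omega> *v (W (q (Suc k)) \<omega> - W (q k) \<omega>)"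
        by (metis matrix_vector_mult_diff_distrib)
    qed
    also have "\<dots> = (\<Sum>k<n. \<eta> k \<omega> *v (W (q (Suc k)) \<omega> - W (q k) \<omega>))"
      using qt by (intro sum.cong) (auto simp: \<eta>_def)
    finally show ?thesis .
  qed
  note tr = ito_simple_truncated[OF W \<eta> c]
  show "Q \<in> borel_measurable M" unfolding Q using tr(1) by measurable
  show "S \<in> borel_measurable M" unfolding S using tr(2) .
  have nn: "0 \<le> (\<Sum>k<n. (norm (\<eta> k \<omega>))\<^sup>2 * (q (Suc k) - q k))" for \<omega>
    using \<eta> by (intro sum_nonneg) (auto simp: simple_integrand_def)
  have mm: "min (ennreal c) (ennreal x) = ennreal (min c x)" for x
    using c by (auto simp: min_def ennreal_le_iff2 ennreal_neg)
  show "(\<integral>\<^sup>+\<omega>. (if Q \<omega> \<le> ennreal c then ennreal ((norm (S \<omega>))\<^sup>2) else 0) \<partial>M)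
      \<le> (\<integral>\<^sup>+\<omega>. min (ennreal c) (Q \<omega>) \<partial>M)"
    unfolding Q S mm ennreal_le_iff[OF c] by (rule tr(3))
qed

text \<open>
  Borel--Cantelli along indices at which both exceptional probabilities are below \<open>2\<^sup>-\<^sup>i\<close>.  One common
  sequence is extracted for the integrands and for the integrals.
\<close>

lemma tendsto_0_in_prob_subsequence:
  assumes X: "tendsto_0_in_prob M X" and Y: "tendsto_0_in_prob M Y"
  obtains \<phi> :: "nat \<Rightarrow> nat" where
    "AE \<omega> in M. (\<lambda>i. X (\<phi> i) \<omega>) \<longlonglongrightarrow> 0 \<and> (\<lambda>i. Y (\<phi> i) \<omega>) \<longlonglongrightarrow> 0"
proof -
  let ?e = "\<lambda>i. (1/2::real) ^ i"
  have "\<exists>j. measure M {\<omega> \<in> space M. X j \<omega> > ennreal (?e i)} < ?e i \<and>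
      measure M {\<omega> \<in> space M. Y j \<omega> > ennreal (?e i)} < ?e i" for i
  proof -
    have "(\<lambda>n. measure M {\<omega> \<in> space M. Z n \<omega> > ennreal (?e i)}) \<longlonglongrightarrow> 0"
      if "tendsto_0_in_prob M Z" for Z using that by (simp add: tendsto_0_in_prob_def)
    from order_tendstoD(2)[OF this[OF X], of "?e i"] order_tendstoD(2)[OF this[OF Y], of "?e i"]
    have "eventually (\<lambda>j. measure M {\<omega> \<in> space M. X j \<omega> > ennreal (?e i)} < ?e i \<and>
      measure M {\<omega> \<in> space M. Y j \<omega> > ennreal (?e i)} < ?e i) sequentially"
      by (simp add: eventually_conj)
    then show ?thesis by (rule eventually_happens'[OF sequentially_bot])
  qed
  then have "\<exists>\<phi>. \<forall>i. measure M {\<omega> \<in> space M. X (\<phi> i) \<omega> > ennreal (?e i)} < ?e i \<and>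
      measure M {\<omega> \<in> space M. Y (\<phi> i) \<omega> > ennreal (?e i)} < ?e i"
    by (intro choice allI)
  then obtain \<phi> where \<phi>: "\<And>i. measure M {\<omega> \<in> space M. X (\<phi> i) \<omega> > ennreal (?e i)} < ?e i"
      "\<And>i. measure M {\<omega> \<in> space M. Y (\<phi> i) \<omega> > ennreal (?e i)} < ?e i"
    by blast
  have lim: "AE \<omega> in M. (\<lambda>i. Z (\<phi> i) \<omega>) \<longlonglongrightarrow> 0"
    if Z: "tendsto_0_in_prob M Z" and le: "\<And>i. measure M {\<omega> \<in> space M. Z (\<phi> i) \<omega> > ennreal (?e i)} < ?e i" for Z
  proof -
    have [measurable]: "Z j \<in> borel_measurable M" for j using Z by (simp add: tendsto_0_in_prob_def)
    have "AE \<omega> in M. eventually (\<lambda>i. \<omega> \<in> space M - {\<omega> \<in> space M. Z (\<phi> i) \<omega> > ennreal (?e i)}) sequentially"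
    proof (rule borel_cantelli_AE1)
      show "summable (\<lambda>i. measure M {\<omega> \<in> space M. Z (\<phi> i) \<omega> > ennreal (?e i)})"
        by (rule summable_comparison_test'[OF summable_geometric[of "1/2::real"]])
          (use le in \<open>auto intro: less_imp_le\<close>)
    qed (auto simp: less_top[symmetric])
    then show ?thesis
    proof eventually_elim
      case (elim \<omega>)
      have "(\<lambda>i. ennreal (?e i)) \<longlonglongrightarrow> ennreal 0"
        by (intro tendsto_ennrealI LIMSEQ_realpow_zero) auto
      then have e0: "(\<lambda>i. ennreal (?e i)) \<longlonglongrightarrow> 0" by simp
      have "eventually (\<lambda>i. Z (\<phi> i) \<omega> \<le> ennreal (?e i)) sequentially"
        using elim by (auto elim!: eventually_mono simp: not_less)
      then show ?case by (intro tendsto_sandwich[OF _ _ tendsto_const e0]) auto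
    qed
  qed
  show ?thesis
    by (rule that[of \<phi>]) (use lim[OF X \<phi>(1)] lim[OF Y \<phi>(2)] in auto)
qed

text \<open>
  It\^o's isometry, as an inequality, for integrands whose mean energy may be infinite: \<open>V\<close> is a random
  bound for twice the energy on \<open>[s, t]\<close>, the factor two leaving room for
  \<open>(x + y)\<^sup>2 \<le> 2 x\<^sup>2 + 2 y\<^sup>2\<close> when the integrand is compared with its simple approximations.  The
  left-hand side passes to the limit by Fatou's lemma, the right-hand side by bounded convergence,
  which is why the truncation at \<open>c\<close> appears on both sides.
\<close>

lemma ito_integral_truncated_bound:
  fixes H :: "real \<Rightarrow> 'w \<Rightarrow> real^'m^'k"
  assumes W: "brownian_motion M F W" and I: "has_ito_integral M F W T H I"
    and st: "0 \<le> s" "s \<le> t" "t \<le> T"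
    and H: "AE \<omega> in M. (\<lambda>r. indicator {0..T} r *\<^sub>R H r \<omega>) \<in> borel_measurable borel"
    and V: "V \<in> borel_measurable M"
      "AE \<omega> in M. 2 * (\<integral>\<^sup>+r\<in>{s..t}. ennreal ((norm (H r \<omega>))\<^sup>2) \<partial>lborel) \<le> V \<omega>"
    and c: "0 \<le> c"
  shows "(\<integral>\<^sup>+\<omega>. (if V \<omega> < ennreal c then ennreal ((norm (I t \<omega> - I s \<omega>))\<^sup>2) else 0) \<partial>M)
      \<le> (\<integral>\<^sup>+\<omega>. min (ennreal c) (V \<omega>) \<partial>M)"
proof -
  obtain N P \<Xi> where simple: "\<And>j. simple_integrand M F (N j) (P j) (\<Xi> j)"
    and limD: "tendsto_0_in_prob M (\<lambda>j \<omega>. \<integral>\<^sup>+s\<in>{0..T}.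
          ennreal ((norm (simple_process (N j) (P j) (\<Xi> j) s \<omega> - H s \<omega>))\<^sup>2) \<partial>lborel)"
    and limE: "tendsto_0_in_prob M (\<lambda>j \<omega>. SUP t\<in>{0..T}.
          ennreal (norm (simple_integral W (N j) (P j) (\<Xi> j) t \<omega> - I t \<omega>)))"
    using I unfolding has_ito_integral_def by blast
  define D where "D j \<omega> = (\<integral>\<^sup>+s\<in>{0..T}.
          ennreal ((norm (simple_process (N j) (P j) (\<Xi> j) s \<omega> - H s \<omega>))\<^sup>2) \<partial>lborel)" for j \<omega>
  define E where "E j \<omega> = (SUP t\<in>{0..T}.
          ennreal (norm (simple_integral W (N j) (P j) (\<Xi> j) t \<omega> - I t \<omega>)))" for j \<omega>
  obtain \<phi> where \<phi>: "AE \<omega> in M. (\<lambda>i. D (\<phi> i) \<omega>) \<longlonglongrightarrow> 0 \<and> (\<lambda>i. E (\<phi> i) \<omega>) \<longlonglongrightarrow> 0"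
    using tendsto_0_in_prob_subsequence[OF limD limE] unfolding D_def E_def by blast
  have DM [measurable]: "D j \<in> borel_measurable M" for j
    using limD by (simp add: tendsto_0_in_prob_def D_def[abs_def])
  note [measurable] = V(1)
  define Q where "Q i \<omega> = (\<integral>\<^sup>+r\<in>{s..t}.
          ennreal ((norm (simple_process (N (\<phi> i)) (P (\<phi> i)) (\<Xi> (\<phi> i)) r \<omega>))\<^sup>2) \<partial>lborel)" for i \<omega>
  define S where "S i \<omega> = simple_integral W (N (\<phi> i)) (P (\<phi> i)) (\<Xi> (\<phi> i)) t \<omega> -
      simple_integral W (N (\<phi> i)) (P (\<phi> i)) (\<Xi> (\<phi> i)) s \<omega>" for i \<omega>
  note tr = simple_integral_increment_truncated[OF W simple[of "\<phi> _"] c st(1,2), folded Q_def S_def]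
  have [measurable]: "Q i \<in> borel_measurable M" "S i \<in> borel_measurable M" for i
    using tr(1,2)[of i] unfolding Q_def[abs_def] S_def[abs_def] by auto
  define f where "f i \<omega> = (if Q i \<omega> \<le> ennreal c then ennreal ((norm (S i \<omega>))\<^sup>2) else 0)" for i \<omega>
  have fM [measurable]: "f i \<in> borel_measurable M" for i unfolding f_def[abs_def] by measurable
  have QD: "AE \<omega> in M. \<forall>i. Q i \<omega> \<le> V \<omega> + (D (\<phi> i) \<omega> + D (\<phi> i) \<omega>)"
    using H V(2)
  proof eventually_elim
    case (elim \<omega>)
    show ?case
    proof
      fix i
      let ?\<xi> = "\<lambda>r. simple_process (N (\<phi> i)) (P (\<phi> i)) (\<Xi> (\<phi> i)) r \<omega>"
      define h where "h r = indicator {0..T} r *\<^sub>R H r \<omega>" for r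
      have [measurable]: "?\<xi> \<in> borel_measurable borel" by (rule simple_process_borel)
      have [measurable]: "h \<in> borel_measurable borel" using elim(1) unfolding h_def[abs_def] .
      have hH: "h r = H r \<omega>" if "r \<in> {s..t}" for r using that st by (simp add: h_def)
      have sq: "ennreal ((norm x)\<^sup>2) \<le> 2 * ennreal ((norm y)\<^sup>2) + 2 * ennreal ((norm (x - y))\<^sup>2)"
        for x y :: "real^'m^'k"
      proof -
        have "(norm x)\<^sup>2 \<le> (norm y + norm (x - y))\<^sup>2"
          by (intro power_mono) (use norm_triangle_sub[of x y] in auto)
        also have "\<dots> \<le> 2 * (norm y)\<^sup>2 + 2 * (norm (x - y))\<^sup>2"
          using sum_squares_bound[of "norm y" "norm (x - y)"] by (simp add: power2_sum)
        finally have "ennreal ((norm x)\<^sup>2) \<le> ennreal (2 * (norm y)\<^sup>2 + 2 * (norm (x - y))\<^sup>2)"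
          by (rule ennreal_leI)
        then show ?thesis by (simp add: ennreal_mult)
      qed
      have "Q i \<omega> \<le> (\<integral>\<^sup>+r. 2 * (ennreal ((norm (h r))\<^sup>2) * indicator {s..t} r) +
          2 * (ennreal ((norm (?\<xi> r - h r))\<^sup>2) * indicator {s..t} r) \<partial>lborel)"
        unfolding Q_def using sq by (intro nn_integral_mono) (auto split: split_indicator)
      also have "\<dots> = 2 * (\<integral>\<^sup>+r\<in>{s..t}. ennreal ((norm (h r))\<^sup>2) \<partial>lborel) +
          2 * (\<integral>\<^sup>+r\<in>{s..t}. ennreal ((norm (?\<xi> r - h r))\<^sup>2) \<partial>lborel)"
        by (simp add: nn_integral_add nn_integral_cmult)
      also have "(\<integral>\<^sup>+r\<in>{s..t}. ennreal ((norm (h r))\<^sup>2) \<partial>lborel)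
          = (\<integral>\<^sup>+r\<in>{s..t}. ennreal ((norm (H r \<omega>))\<^sup>2) \<partial>lborel)"
        by (intro nn_integral_cong) (auto simp: hH split: split_indicator)
      also have "(\<integral>\<^sup>+r\<in>{s..t}. ennreal ((norm (?\<xi> r - h r))\<^sup>2) \<partial>lborel) \<le> D (\<phi> i) \<omega>"
        unfolding D_def using st by (intro nn_integral_mono) (auto simp: hH split: split_indicator)
      also note elim(2)
      finally show "Q i \<omega> \<le> V \<omega> + (D (\<phi> i) \<omega> + D (\<phi> i) \<omega>)"
        by (simp add: mult_2 add_mono mult_left_mono)
    qed
  qed
  have lim: "AE \<omega> in M. (if V \<omega> < ennreal c then ennreal ((norm (I t \<omega> - I s \<omega>))\<^sup>2) else 0)
      \<le> liminf (\<lambda>i. f i \<omega>)"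
    using QD \<phi>
  proof eventually_elim
    case (elim \<omega>)
    show ?case
    proof (cases "V \<omega> < ennreal c")
      case True
      have "(\<lambda>i. V \<omega> + (D (\<phi> i) \<omega> + D (\<phi> i) \<omega>)) \<longlonglongrightarrow> V \<omega> + (0 + 0)"
        using elim by (intro tendsto_intros) auto
      then have "eventually (\<lambda>i. V \<omega> + (D (\<phi> i) \<omega> + D (\<phi> i) \<omega>) < ennreal c) sequentially"
        using True by (intro order_tendstoD(2)) auto
      then have ev: "eventually (\<lambda>i. f i \<omega> = ennreal ((norm (S i \<omega>))\<^sup>2)) sequentially"
        by (rule eventually_mono) (use elim in \<open>auto simp: f_def intro: order_trans less_imp_le\<close>)
      have "(\<lambda>i. ennreal (norm (S i \<omega> - (I t \<omega> - I s \<omega>)))) \<longlonglongrightarrow> 0"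
      proof (rule tendsto_sandwich[OF _ _ tendsto_const])
        show "(\<lambda>i. E (\<phi> i) \<omega> + E (\<phi> i) \<omega>) \<longlonglongrightarrow> 0"
          using tendsto_add[of "\<lambda>i. E (\<phi> i) \<omega>" 0 sequentially "\<lambda>i. E (\<phi> i) \<omega>" 0] elim by auto
        show "eventually (\<lambda>i. ennreal (norm (S i \<omega> - (I t \<omega> - I s \<omega>))) \<le> E (\<phi> i) \<omega> + E (\<phi> i) \<omega>) sequentially"
        proof (intro always_eventually allI)
          fix i
          let ?J = "\<lambda>u. simple_integral W (N (\<phi> i)) (P (\<phi> i)) (\<Xi> (\<phi> i)) u \<omega> - I u \<omega>"
          have "ennreal (norm (S i \<omega> - (I t \<omega> - I s \<omega>))) = ennreal (norm (?J t - ?J s))"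
            by (simp add: S_def algebra_simps)
          also have "\<dots> \<le> ennreal (norm (?J t) + norm (?J s))"
            by (intro ennreal_leI norm_triangle_ineq4)
          also have "\<dots> = ennreal (norm (?J t)) + ennreal (norm (?J s))"
            by (rule ennreal_plus) (rule norm_ge_zero)+
          also have "\<dots> \<le> E (\<phi> i) \<omega> + E (\<phi> i) \<omega>"
            unfolding E_def using st by (intro add_mono SUP_upper) auto
          finally show "ennreal (norm (S i \<omega> - (I t \<omega> - I s \<omega>))) \<le> E (\<phi> i) \<omega> + E (\<phi> i) \<omega>" .
        qed
      qed auto
      then have "(\<lambda>i. norm (S i \<omega> - (I t \<omega> - I s \<omega>))) \<longlonglongrightarrow> 0"
        by (intro tendsto_ennrealD) auto
      then have "(\<lambda>i. S i \<omega>) \<longlonglongrightarrow> I t \<omega> - I s \<omega>"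
        by (simp add: tendsto_norm_zero_iff LIM_zero_iff)
      then have "(\<lambda>i. ennreal ((norm (S i \<omega>))\<^sup>2)) \<longlonglongrightarrow> ennreal ((norm (I t \<omega> - I s \<omega>))\<^sup>2)"
        by (intro tendsto_ennrealI tendsto_intros)
      then have "(\<lambda>i. f i \<omega>) \<longlonglongrightarrow> ennreal ((norm (I t \<omega> - I s \<omega>))\<^sup>2)"
        using ev by (subst tendsto_cong)
      then show ?thesis using True by (simp add: lim_imp_Liminf)
    qed simp
  qed
  have "(\<integral>\<^sup>+\<omega>. (if V \<omega> < ennreal c then ennreal ((norm (I t \<omega> - I s \<omega>))\<^sup>2) else 0) \<partial>M)
      \<le> (\<integral>\<^sup>+\<omega>. liminf (\<lambda>i. f i \<omega>) \<partial>M)"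
    by (rule nn_integral_mono_AE[OF lim])
  also have "\<dots> \<le> liminf (\<lambda>i. \<integral>\<^sup>+\<omega>. f i \<omega> \<partial>M)"
    by (rule nn_integral_liminf[OF fM])
  also have "\<dots> \<le> liminf (\<lambda>i. \<integral>\<^sup>+\<omega>. min (ennreal c) (V \<omega> + (D (\<phi> i) \<omega> + D (\<phi> i) \<omega>)) \<partial>M)"
  proof (intro Liminf_mono always_eventually allI)
    fix i
    have "(\<integral>\<^sup>+\<omega>. f i \<omega> \<partial>M) \<le> (\<integral>\<^sup>+\<omega>. min (ennreal c) (Q i \<omega>) \<partial>M)"
      unfolding f_def by (rule tr(3))
    also have "\<dots> \<le> (\<integral>\<^sup>+\<omega>. min (ennreal c) (V \<omega> + (D (\<phi> i) \<omega> + D (\<phi> i) \<omega>)) \<partial>M)"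
      by (intro nn_integral_mono_AE) (use QD in \<open>auto elim!: eventually_mono intro: min.coboundedI1 min.coboundedI2\<close>)
    finally show "(\<integral>\<^sup>+\<omega>. f i \<omega> \<partial>M) \<le> (\<integral>\<^sup>+\<omega>. min (ennreal c) (V \<omega> + (D (\<phi> i) \<omega> + D (\<phi> i) \<omega>)) \<partial>M)" .
  qed
  also have "\<dots> = (\<integral>\<^sup>+\<omega>. min (ennreal c) (V \<omega>) \<partial>M)"
  proof (intro lim_imp_Liminf nn_integral_dominated_convergence[where w = "\<lambda>_. ennreal c"])
    show "(\<integral>\<^sup>+\<omega>. ennreal c \<partial>M) < \<infinity>" by (simp add: emeasure_space_1)
    show "AE \<omega> in M. (\<lambda>i. min (ennreal c) (V \<omega> + (D (\<phi> i) \<omega> + D (\<phi> i) \<omega>))) \<longlonglongrightarrow> min (ennreal c) (V \<omega>)"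
      using \<phi>
    proof eventually_elim
      case (elim \<omega>)
      have "(\<lambda>i. V \<omega> + (D (\<phi> i) \<omega> + D (\<phi> i) \<omega>)) \<longlonglongrightarrow> V \<omega> + (0 + 0)"
        using elim by (intro tendsto_intros) auto
      then show ?case by (intro tendsto_min tendsto_const) simp
    qed
  qed auto
  finally show ?thesis .
qed

end

section \<open>Gronwall's inequality and processes with continuous paths\<close>

text \<open>
  A running integral of a positive density, capped at \<open>c\<close>, grows only while it is below \<open>c\<close>.
  Hence the expected capped energy satisfies an integral inequality to which Gronwall applies.
\<close>

lemma capped_running_integral:
  fixes g :: "real \<Rightarrow> real"
  assumes g: "continuous_on {0..t} g" "\<And>r. r \<in> {0..t} \<Longrightarrow> \<kappa> \<le> g r" and "0 < \<kappa>"
    and "0 \<le> c" and t: "0 \<le> t"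
  defines "G \<equiv> \<lambda>r. \<integral>\<^sup>+x\<in>{0..r}. ennreal (g x) \<partial>lborel"
  shows "G t < \<infinity>"
    and "min (ennreal c) (G t) \<le> (\<integral>\<^sup>+r\<in>{0..t}. (if G r < ennreal c then ennreal (g r) else 0) \<partial>lborel)"
proof -
  obtain A where A: "\<And>x. x \<in> {0..t} \<Longrightarrow> (A has_vector_derivative g x) (at x within {0..t})"
    using antiderivative_continuous[OF g(1)] by blast
  have A_int: "(g has_integral (A v - A u)) {u..v}" if "0 \<le> u" "u \<le> v" "v \<le> t" for u v
  proof (rule fundamental_theorem_of_calculus[OF that(2)])
    fix x assume "x \<in> {u..v}"
    then show "(A has_vector_derivative g x) (at x within {u..v})"
      using that by (intro has_vector_derivative_within_subset[OF A]) auto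
  qed
  have A_cont: "continuous_on {0..t} A"
    unfolding continuous_on_eq_continuous_within
    using A has_vector_derivative_continuous by blast
  have g0: "0 \<le> g r" if "r \<in> {0..t}" for r using g(2)[OF that] \<open>0 < \<kappa>\<close> by simp
  have G: "G r = ennreal (A r - A 0)" if "r \<in> {0..t}" for r
    unfolding G_def using that g0 by (intro nn_integral_has_integral_lebesgue' A_int) auto
  have A_less: "A u < A v" if "0 \<le> u" "u < v" "v \<le> t" for u v
  proof -
    have "measure lborel {u..v} *\<^sub>R \<kappa> \<le> A v - A u"
      using that g(2) by (intro has_integral_le[OF has_integral_const_real A_int]) auto
    moreover have "0 < measure lborel {u..v} *\<^sub>R \<kappa>" using that \<open>0 < \<kappa>\<close> by simp
    ultimately show ?thesis by linarith
  qed
  show "G t < \<infinity>" using G[of t] t by simp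
  have reach: "ennreal (A \<sigma> - A 0) \<le> (\<integral>\<^sup>+r\<in>{0..t}. (if G r < ennreal c then ennreal (g r) else 0) \<partial>lborel)"
    if \<sigma>: "0 \<le> \<sigma>" "\<sigma> \<le> t" "A \<sigma> - A 0 \<le> c" for \<sigma>
  proof -
    have "ennreal (A \<sigma> - A 0) = (\<integral>\<^sup>+r\<in>{0..\<sigma>}. ennreal (g r) \<partial>lborel)"
      using G[of \<sigma>] \<sigma> by (simp add: G_def)
    also have "\<dots> \<le> (\<integral>\<^sup>+r\<in>{0..t}. (if G r < ennreal c then ennreal (g r) else 0) \<partial>lborel)"
    proof (rule nn_integral_mono_AE)
      show "AE r in lborel. ennreal (g r) * indicator {0..\<sigma>} r \<le>
          (if G r < ennreal c then ennreal (g r) else 0) * indicator {0..t} r"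
        using AE_lborel_singleton[of \<sigma>]
      proof eventually_elim
        case (elim r)
        show ?case
        proof (cases "r \<in> {0..\<sigma>}")
          case True
          then have "A r - A 0 < c" "r \<in> {0..t}"
            using A_less[of r \<sigma>] \<sigma> elim by auto
          moreover have "0 \<le> A r - A 0"
            using A_less[of 0 r] True \<sigma> by (cases "r = 0") auto
          ultimately show ?thesis using G[of r] True by (simp add: ennreal_lessI)
        qed simp
      qed
    qed
    finally show ?thesis .
  qed
  show "min (ennreal c) (G t) \<le> (\<integral>\<^sup>+r\<in>{0..t}. (if G r < ennreal c then ennreal (g r) else 0) \<partial>lborel)"
  proof (cases "A t - A 0 \<le> c")
    case True
    then show ?thesis using reach[of t] G[of t] t by (simp add: min.coboundedI2)
  next
    case False
    then obtain \<sigma> where "0 \<le> \<sigma>" "\<sigma> \<le> t" "A \<sigma> = c + A 0"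
      using IVT'[of A 0 "c + A 0" t] \<open>0 \<le> c\<close> t A_cont by auto
    then show ?thesis using reach[of \<sigma>] by (simp add: min.coboundedI1)
  qed
qed

text \<open>
  With the weight \<open>e\<^sup>-\<^sup>2\<^sup>k\<^sup>t\<close> the integral term contributes at most half of the weighted supremum, which can
  therefore be absorbed on the left-hand side.  The a priori bound \<open>c\<close> serves only to make that
  supremum finite; it does not enter the conclusion, so the estimate survives \<open>c \<rightarrow> \<infinity>\<close>.
\<close>

lemma gronwall_ennreal:
  fixes v :: "real \<Rightarrow> ennreal"
  assumes bound: "\<And>t. t \<in> {0..T} \<Longrightarrow> v t \<le> ennreal c"
    and int: "\<And>t. t \<in> {0..T} \<Longrightarrow> v t \<le> (\<integral>\<^sup>+r\<in>{0..t}. (ennreal a + ennreal k * v r) \<partial>lborel)"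
    and pos: "0 \<le> a" "0 < k" and t: "t \<in> {0..T}"
  shows "v t \<le> ennreal (2 * a * T * exp (2 * k * T))"
proof -
  have T: "0 \<le> T" using t by simp
  define w where "w = (SUP t\<in>{0..T}. v t * ennreal (exp (- (2 * k * t))))"
  have "w \<le> ennreal c"
    unfolding w_def
  proof (rule SUP_least)
    fix t assume "t \<in> {0..T}"
    then have "v t * ennreal (exp (- (2 * k * t))) \<le> ennreal c * 1"
      using bound pos by (intro mult_mono) auto
    then show "v t * ennreal (exp (- (2 * k * t))) \<le> ennreal c" by simp
  qed
  then obtain w' where w': "w = ennreal w'" "0 \<le> w'"
    by (cases w) (auto simp: top_unique)
  have cancel: "ennreal (exp (- (2 * k * t))) * ennreal (exp (2 * k * t)) = 1" for t
    by (simp add: ennreal_mult[symmetric] exp_add[symmetric])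
  have vw: "v t \<le> ennreal (w' * exp (2 * k * t))" if "t \<in> {0..T}" for t
  proof -
    have "v t = (v t * ennreal (exp (- (2 * k * t)))) * ennreal (exp (2 * k * t))"
      unfolding mult.assoc[of "v t"] cancel by simp
    also have "\<dots> \<le> w * ennreal (exp (2 * k * t))"
      unfolding w_def by (intro mult_right_mono SUP_upper that) auto
    finally show ?thesis using w' by (simp add: ennreal_mult)
  qed
  have step: "v t \<le> ennreal (a * T + w' / 2 * exp (2 * k * t))" if t: "t \<in> {0..T}" for t
  proof -
    have "v t \<le> (\<integral>\<^sup>+r\<in>{0..t}. (ennreal a + ennreal k * v r) \<partial>lborel)" by (rule int[OF t])
    also have "\<dots> \<le> (\<integral>\<^sup>+r\<in>{0..t}. ennreal (a + k * (w' * exp (2 * k * r))) \<partial>lborel)"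
    proof (intro nn_integral_mono)
      fix r
      have "ennreal a + ennreal k * v r \<le> ennreal (a + k * (w' * exp (2 * k * r)))" if "r \<in> {0..t}"
      proof -
        have "ennreal k * v r \<le> ennreal k * ennreal (w' * exp (2 * k * r))"
          using that t by (intro mult_left_mono vw) auto
        then have "ennreal a + ennreal k * v r \<le> ennreal a + ennreal k * ennreal (w' * exp (2 * k * r))"
          by (rule add_left_mono)
        also have "\<dots> = ennreal (a + k * (w' * exp (2 * k * r)))"
          using pos w' by (simp add: ennreal_mult)
        finally show ?thesis .
      qed
      then show "(ennreal a + ennreal k * v r) * indicator {0..t} r \<le>
          ennreal (a + k * (w' * exp (2 * k * r))) * indicator {0..t} r"
        by (auto split: split_indicator)
    qed
    also have "\<dots> = ennreal ((a * t + w' / 2 * exp (2 * k * t)) - (a * 0 + w' / 2 * exp (2 * k * 0)))"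
      using t pos w' by (intro nn_integral_FTC_Icc) (auto intro!: derivative_eq_intros)
    also have "\<dots> \<le> ennreal (a * T + w' / 2 * exp (2 * k * t))"
    proof (rule ennreal_leI)
      have "a * t \<le> a * T" using t pos by (intro mult_left_mono) auto
      then show "a * t + w' / 2 * exp (2 * k * t) - (a * 0 + w' / 2 * exp (2 * k * 0)) \<le>
          a * T + w' / 2 * exp (2 * k * t)" using w' by simp
    qed
    finally show ?thesis .
  qed
  have "w \<le> ennreal (a * T + w' / 2)"
    unfolding w_def
  proof (rule SUP_least)
    fix t assume t: "t \<in> {0..T}"
    have "v t * ennreal (exp (- (2 * k * t))) \<le>
        ennreal (a * T + w' / 2 * exp (2 * k * t)) * ennreal (exp (- (2 * k * t)))"
      by (intro mult_right_mono step t) auto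
    also have "\<dots> = ennreal (a * T * exp (- (2 * k * t)) + w' / 2 * (exp (2 * k * t) * exp (- (2 * k * t))))"
      using t pos w' by (simp add: ennreal_mult[symmetric] algebra_simps)
    also have "\<dots> \<le> ennreal (a * T + w' / 2)"
    proof (rule ennreal_leI)
      have "a * T * exp (- (2 * k * t)) \<le> a * T * 1" using t pos by (intro mult_left_mono) auto
      moreover have "exp (2 * k * t) * exp (- (2 * k * t)) = 1" by (simp add: exp_add[symmetric])
      ultimately show "a * T * exp (- (2 * k * t)) + w' / 2 * (exp (2 * k * t) * exp (- (2 * k * t))) \<le> a * T + w' / 2"
        by simp
    qed
    finally show "v t * ennreal (exp (- (2 * k * t))) \<le> ennreal (a * T + w' / 2)" .
  qed
  then have "w' \<le> a * T + w' / 2"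
    unfolding w'(1) by (rule ennreal_le_iff[THEN iffD1, rotated]) (use w' pos T in auto)
  then have "w' \<le> 2 * a * T" by simp
  then have "w' * exp (2 * k * t) \<le> 2 * a * T * exp (2 * k * T)"
    using t pos T w' by (intro mult_mono) auto
  then show ?thesis using vw[OF t] by (meson ennreal_leI order_trans)
qed

text \<open>
  By continuity the process is the limit of its values at the next smaller point of the grid of mesh
  \<open>1 / (n + 1)\<close>, and these involve only countably many of the random variables \<open>Z s\<close>.
\<close>

lemma continuous_process_jointly_measurable:
  fixes Z :: "real \<Rightarrow> 'w \<Rightarrow> 'b::{metric_space}"
  assumes meas: "\<And>s. Z s \<in> borel_measurable M"
    and cont: "\<And>\<omega>. \<omega> \<in> space M \<Longrightarrow> continuous_on UNIV (\<lambda>s. Z s \<omega>)"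
  shows "(\<lambda>(s, \<omega>). Z s \<omega>) \<in> borel_measurable (borel \<Otimes>\<^sub>M M)"
proof (rule borel_measurable_LIMSEQ_metric)
  let ?d = "\<lambda>n s. real_of_int \<lfloor>s * real (Suc n)\<rfloor> / real (Suc n)"
  show "(\<lambda>(s, \<omega>). Z (?d n s) \<omega>) \<in> borel_measurable (borel \<Otimes>\<^sub>M M)" for n
  proof -
    have "(\<lambda>p. Z (real_of_int \<lfloor>fst p * real (Suc n)\<rfloor> / real (Suc n)) (snd p)) \<in> borel_measurable (borel \<Otimes>\<^sub>M M)"
    proof (rule measurable_compose_countable[where f = "\<lambda>i p. Z (real_of_int i / real (Suc n)) (snd p)"
          and g = "\<lambda>p. \<lfloor>fst p * real (Suc n)\<rfloor>"])
      show "(\<lambda>p. Z (real_of_int i / real (Suc n)) (snd p)) \<in> borel_measurable (borel \<Otimes>\<^sub>M M)" for i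
        using meas by measurable
    qed measurable
    then show ?thesis by (simp add: case_prod_beta)
  qed
  fix p assume "p \<in> space ((borel :: real measure) \<Otimes>\<^sub>M M)"
  then obtain s \<omega> where p: "p = (s, \<omega>)" "\<omega> \<in> space M" by (auto simp: space_pair_measure)
  have "(\<lambda>n. ?d n s) \<longlonglongrightarrow> s"
  proof (rule LIMSEQ_I)
    fix e :: real assume "e > 0"
    obtain N where N: "1 / real (Suc N) < e" using nat_approx_posE[OF \<open>e > 0\<close>] by blast
    have "norm (?d n s - s) < e" if "n \<ge> N" for n
    proof -
      have "\<bar>real_of_int \<lfloor>s * real (Suc n)\<rfloor> - s * real (Suc n)\<bar> \<le> 1" by linarith
      moreover have "?d n s - s = (real_of_int \<lfloor>s * real (Suc n)\<rfloor> - s * real (Suc n)) / real (Suc n)"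
        by (simp add: diff_divide_distrib del: of_nat_Suc)
      ultimately have "\<bar>?d n s - s\<bar> \<le> 1 / real (Suc n)"
        by (simp add: abs_divide divide_right_mono del: of_nat_Suc)
      also have "\<dots> \<le> 1 / real (Suc N)" using that by (simp add: frac_le)
      finally show ?thesis using N by simp
    qed
    then show "\<exists>no. \<forall>n\<ge>no. norm (?d n s - s) < e" by blast
  qed
  then show "(\<lambda>n. case p of (s, \<omega>) \<Rightarrow> Z (?d n s) \<omega>) \<longlonglongrightarrow> (case p of (s, \<omega>) \<Rightarrow> Z s \<omega>)"
    using continuous_on_tendsto_compose[OF cont[OF p(2)]] p by simp
qed

lemma nn_integral_truncated_le:
  assumes [measurable]: "f \<in> borel_measurable M" "V \<in> borel_measurable M"
    and fin: "AE \<omega> in M. V \<omega> < \<infinity>"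
    and le: "\<And>n::nat. (\<integral>\<^sup>+\<omega>. (if V \<omega> < ennreal (real n) then f \<omega> else 0) \<partial>M) \<le> K"
  shows "(\<integral>\<^sup>+\<omega>. f \<omega> \<partial>M) \<le> K"
proof -
  let ?f = "\<lambda>(n::nat) \<omega>. if V \<omega> < ennreal (real n) then f \<omega> else 0"
  have "(\<integral>\<^sup>+\<omega>. f \<omega> \<partial>M) \<le> (\<integral>\<^sup>+\<omega>. liminf (\<lambda>n. ?f n \<omega>) \<partial>M)"
  proof (rule nn_integral_mono_AE)
    show "AE \<omega> in M. f \<omega> \<le> liminf (\<lambda>n. ?f n \<omega>)"
      using fin
    proof eventually_elim
      case (elim \<omega>)
      then obtain x where x: "V \<omega> = ennreal x" "0 \<le> x" by (cases "V \<omega>") auto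
      obtain N :: nat where "x < real N" using reals_Archimedean2 by blast
      then have "eventually (\<lambda>n. ?f n \<omega> = f \<omega>) sequentially"
        using x by (intro eventually_sequentiallyI[of N]) (auto simp: ennreal_less_iff)
      then have "(\<lambda>n. ?f n \<omega>) \<longlonglongrightarrow> f \<omega>" by (rule tendsto_eventually)
      then show ?case by (simp add: lim_imp_Liminf)
    qed
  qed
  also have "\<dots> \<le> liminf (\<lambda>n. \<integral>\<^sup>+\<omega>. ?f n \<omega> \<partial>M)"
    by (rule nn_integral_liminf) measurable
  also have "\<dots> \<le> K"
    using le by (intro Liminf_le) (auto intro: always_eventually)
  finally show ?thesis .
qed

text \<open>
  The Cauchy--Schwarz inequality on an interval of length \<open>t - s\<close>.
\<close>

lemma norm_integral_squared_le:
  fixes f :: "real \<Rightarrow> 'b::{banach, second_countable_topology}"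
  assumes f: "set_integrable lborel {s<..t} f" and st: "s \<le> t"
  shows "ennreal ((norm (set_lebesgue_integral lborel {s<..t} f))\<^sup>2) \<le>
    ennreal (t - s) * (\<integral>\<^sup>+r\<in>{s..t}. ennreal ((norm (f r))\<^sup>2) \<partial>lborel)"
proof -
  define h where "h r = indicator {s<..t} r *\<^sub>R f r" for r
  have h: "integrable lborel h" using f unfolding set_integrable_def h_def .
  then have [measurable]: "h \<in> borel_measurable borel" by auto
  have "ennreal ((norm (set_lebesgue_integral lborel {s<..t} f))\<^sup>2) = (ennreal (norm (integral\<^sup>L lborel h)))\<^sup>2"
    by (simp add: set_lebesgue_integral_def h_def[abs_def] ennreal_power)
  also have "\<dots> \<le> (\<integral>\<^sup>+r. ennreal (norm (h r)) * indicator {s..t} r \<partial>lborel)\<^sup>2"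
  proof (rule power_mono)
    have "ennreal (norm (integral\<^sup>L lborel h)) \<le> (\<integral>\<^sup>+r. norm (h r) \<partial>lborel)"
      by (rule integral_norm_bound_ennreal[OF h])
    also have "\<dots> = (\<integral>\<^sup>+r. ennreal (norm (h r)) * indicator {s..t} r \<partial>lborel)"
      by (intro nn_integral_cong) (auto simp: h_def split: split_indicator)
    finally show "ennreal (norm (integral\<^sup>L lborel h)) \<le> (\<integral>\<^sup>+r. ennreal (norm (h r)) * indicator {s..t} r \<partial>lborel)" .
  qed simp
  also have "\<dots> \<le> (\<integral>\<^sup>+r. (ennreal (norm (h r)))\<^sup>2 \<partial>lborel) * (\<integral>\<^sup>+r. (indicator {s..t} r)\<^sup>2 \<partial>lborel)"
    by (rule Cauchy_Schwarz_nn_integral) measurable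
  also have "(\<integral>\<^sup>+r. (indicator {s..t} r :: ennreal)\<^sup>2 \<partial>lborel) = (\<integral>\<^sup>+r. indicator {s..t} r \<partial>lborel)"
    by (intro nn_integral_cong) (auto split: split_indicator)
  also have "\<dots> = ennreal (t - s)" using st by simp
  also have "(\<integral>\<^sup>+r. (ennreal (norm (h r)))\<^sup>2 \<partial>lborel) \<le> (\<integral>\<^sup>+r\<in>{s..t}. ennreal ((norm (f r))\<^sup>2) \<partial>lborel)"
    by (intro nn_integral_mono) (auto simp: h_def ennreal_power split: split_indicator)
  finally show ?thesis by (simp only: mult.commute[of "ennreal (t - s)"] mult_right_mono zero_le)
qed

section \<open>Moments of solutions of equations with linear growth\<close>

context usual_filtered_prob_space
begin

text \<open>
  Replacing the paths on a null set by zero, and freezing them outside \<open>[0, T]\<close>, gives a process that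
  is jointly measurable, as required for interchanging expectation and time integral.
\<close>

lemma continuous_modification:
  fixes Y :: "real \<Rightarrow> 'w \<Rightarrow> real^'k"
  assumes meas: "\<And>t. t \<in> {0..T} \<Longrightarrow> Y t \<in> borel_measurable M"
    and cont: "AE \<omega> in M. continuous_on {0..T} (\<lambda>t. Y t \<omega>)" and T: "0 \<le> T"
  obtains Z :: "real \<Rightarrow> 'w \<Rightarrow> real^'k" where
    "\<And>s. Z s \<in> borel_measurable M"
    "\<And>\<omega>. \<omega> \<in> space M \<Longrightarrow> continuous_on UNIV (\<lambda>s. Z s \<omega>)"
    "AE \<omega> in M. \<forall>s\<in>{0..T}. Z s \<omega> = Y s \<omega>"
proof -
  obtain N where N: "N \<in> null_sets M"
    "\<And>\<omega>. \<omega> \<in> space M \<Longrightarrow> \<omega> \<notin> N \<Longrightarrow> continuous_on {0..T} (\<lambda>t. Y t \<omega>)"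
    using cont by (auto elim!: AE_E3)
  define Z where "Z s \<omega> = (if \<omega> \<in> N then 0 else Y (max 0 (min T s)) \<omega>)" for s \<omega>
  have [measurable]: "N \<in> sets M" using N by auto
  have "Z s \<in> borel_measurable M" for s
  proof -
    have [measurable]: "Y (max 0 (min T s)) \<in> borel_measurable M" using T by (intro meas) auto
    show ?thesis unfolding Z_def[abs_def] by measurable
  qed
  moreover have "continuous_on UNIV (\<lambda>s. Z s \<omega>)" if "\<omega> \<in> space M" for \<omega>
  proof (cases "\<omega> \<in> N")
    case False
    have "continuous_on UNIV (\<lambda>s. Y (max 0 (min T s)) \<omega>)"
      using T by (intro continuous_on_compose2[OF N(2)[OF that False]] continuous_intros) auto
    then show ?thesis using False by (simp add: Z_def)
  qed (simp add: Z_def)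
  moreover have "AE \<omega> in M. \<forall>s\<in>{0..T}. Z s \<omega> = Y s \<omega>"
    using AE_not_in[OF N(1)] by eventually_elim (auto simp: Z_def min_def max_def)
  ultimately show ?thesis using that by blast
qed

end

text \<open>
  This is \<open>2 B + 2 (T + 2) v\<close>, where \<open>v = 2 A T e\<^sup>2\<^sup>k\<^sup>T\<close> is the Gronwall bound on the expected energy for
  the constants \<open>A = 2 C (1 + 2 B)\<close> and \<open>k = 4 C (T + 2)\<close>.
\<close>

definition moment_bound :: "real \<Rightarrow> real \<Rightarrow> real \<Rightarrow> real" where
  "moment_bound C T B = 2 * B + 2 * (T + 2) *
     (2 * (2 * C * (1 + 2 * B)) * T * exp (2 * (4 * C * (T + 2)) * T))"

text \<open>
  The solution \<open>Y\<close> has continuous paths only almost surely.  The estimates are carried out for a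
  modification \<open>Z\<close> all of whose paths are continuous, since time integrals along \<open>Z\<close> are measurable and
  finite at every sample point.
\<close>

locale linear_growth_SDE = usual_filtered_prob_space M F
  for M :: "'w measure" and F +
  fixes W :: "real \<Rightarrow> 'w \<Rightarrow> real^'m" and T C :: real
    and \<alpha> :: "real \<Rightarrow> real^'k \<Rightarrow> real^'k" and \<beta> :: "real \<Rightarrow> real^'k \<Rightarrow> real^'m^'k"
    and Y Z :: "real \<Rightarrow> 'w \<Rightarrow> real^'k"
  assumes W: "brownian_motion M F W" and T: "0 \<le> T" and C: "0 < C"
    and solution: "strong_SDE_solution M F W T \<alpha> \<beta> Y"
    and \<alpha>_growth: "\<And>s y. s \<in> {0..T} \<Longrightarrow> (norm (\<alpha> s y))\<^sup>2 \<le> C * (1 + (norm y)\<^sup>2)"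
    and \<beta>_growth: "\<And>s y. s \<in> {0..T} \<Longrightarrow> (norm (\<beta> s y))\<^sup>2 \<le> C * (1 + (norm y)\<^sup>2)"
    and \<beta>_measurable: "\<And>y. continuous_on {0..T} y \<Longrightarrow>
      (\<lambda>r. indicator {0..T} r *\<^sub>R \<beta> r (y r)) \<in> borel_measurable borel"
    and Z_measurable [measurable]: "\<And>s. Z s \<in> borel_measurable M"
    and Z_continuous: "\<And>\<omega>. \<omega> \<in> space M \<Longrightarrow> continuous_on UNIV (\<lambda>s. Z s \<omega>)"
    and ZY: "AE \<omega> in M. \<forall>s\<in>{0..T}. Z s \<omega> = Y s \<omega>"
begin

text \<open>
  Linear growth bounds the energy over \<open>[s, t]\<close> of the drift and of the diffusion by \<open>V s t / 2\<close>, in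
  accordance with the factor two in the truncated isometry.
\<close>

definition V :: "real \<Rightarrow> real \<Rightarrow> 'w \<Rightarrow> ennreal" where
  "V s t \<omega> = (\<integral>\<^sup>+r\<in>{s..t}. ennreal (2 * C * (1 + (norm (Z r \<omega>))\<^sup>2)) \<partial>lborel)"

lemma Z_jointly_measurable [measurable]: "(\<lambda>(s, \<omega>). Z s \<omega>) \<in> borel_measurable (borel \<Otimes>\<^sub>M M)"
  by (rule continuous_process_jointly_measurable[OF Z_measurable Z_continuous])

lemma Z_jointly_measurable' [measurable]: "(\<lambda>p. Z (fst p) (snd p)) \<in> borel_measurable (borel \<Otimes>\<^sub>M M)"
  using Z_jointly_measurable by (simp add: case_prod_beta)

lemma V_measurable [measurable]: "V s t \<in> borel_measurable M"
proof -
  have "(\<lambda>p. ennreal (2 * C * (1 + (norm (Z (snd p) (fst p)))\<^sup>2)) * indicator {s..t} (snd p))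
      \<in> borel_measurable (M \<Otimes>\<^sub>M lborel)"
    by measurable
  then show ?thesis
    unfolding V_def[abs_def] by (intro lborel.borel_measurable_nn_integral) (simp add: case_prod_beta)
qed

lemma V0_jointly_measurable: "(\<lambda>p. V 0 (fst p) (snd p)) \<in> borel_measurable (borel \<Otimes>\<^sub>M M)"
proof -
  have Z3: "(\<lambda>q. Z (snd q) (snd (fst q))) \<in> borel_measurable ((borel \<Otimes>\<^sub>M M) \<Otimes>\<^sub>M (borel :: real measure))"
  proof -
    have "(\<lambda>q. (snd q, snd (fst q))) \<in> (borel \<Otimes>\<^sub>M M) \<Otimes>\<^sub>M (borel :: real measure) \<rightarrow>\<^sub>M borel \<Otimes>\<^sub>M M"
      by measurable
    from measurable_compose[OF this Z_jointly_measurable'] show ?thesis by simp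
  qed
  have "(\<lambda>q. ennreal (2 * C * (1 + (norm (Z (snd q) (snd (fst q))))\<^sup>2)) *
      (if 0 \<le> snd q \<and> snd q \<le> fst (fst q) then 1 else 0))
      \<in> borel_measurable ((borel \<Otimes>\<^sub>M M) \<Otimes>\<^sub>M lborel)"
    using Z3 by measurable
  moreover have "(if 0 \<le> r \<and> r \<le> t then 1 else 0 :: ennreal) = indicator {0..t} r" for r t :: real
    by (simp add: indicator_def)
  ultimately show ?thesis
    unfolding V_def by (intro lborel.borel_measurable_nn_integral) (simp add: case_prod_beta)
qed

lemma density_continuous: "\<omega> \<in> space M \<Longrightarrow> continuous_on S (\<lambda>r. 2 * C * (1 + (norm (Z r \<omega>))\<^sup>2))"
  by (intro continuous_intros continuous_on_subset[OF Z_continuous]) auto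

lemma density_ge: "2 * C \<le> 2 * C * (1 + (norm (Z r \<omega>))\<^sup>2)"
  using C by (simp add: mult_le_cancel_left1)

lemma V0_finite: "\<omega> \<in> space M \<Longrightarrow> 0 \<le> t \<Longrightarrow> V 0 t \<omega> < \<infinity>"
  unfolding V_def using C
  by (intro capped_running_integral(1)[where \<kappa> = "2 * C" and c = 0] density_continuous density_ge) auto

lemma V_finite: "\<omega> \<in> space M \<Longrightarrow> 0 \<le> s \<Longrightarrow> 0 \<le> t \<Longrightarrow> V s t \<omega> < \<infinity>"
  using V0_finite[of \<omega> t]
  by (rule le_less_trans[rotated]) (auto simp: V_def intro!: nn_integral_mono split: split_indicator)

lemma capped_V_le:
  assumes "\<omega> \<in> space M" "0 \<le> t" "0 \<le> c"
  shows "min (ennreal c) (V 0 t \<omega>) \<le>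
    (\<integral>\<^sup>+r\<in>{0..t}. (if V 0 r \<omega> < ennreal c then ennreal (2 * C * (1 + (norm (Z r \<omega>))\<^sup>2)) else 0) \<partial>lborel)"
  unfolding V_def using C assms
  by (intro capped_running_integral(2)[where \<kappa> = "2 * C"] density_continuous density_ge) auto

text \<open>
  The drift is estimated by the Cauchy--Schwarz inequality, the stochastic integral by the truncated
  isometry.  Where \<open>V < c\<close>, the drift contribution \<open>T0 * V\<close> is at most \<open>T0 * min c V\<close>, and one
  expectation bounds both terms.
\<close>

lemma increment_truncated_bound:
  assumes st: "0 \<le> s" "s \<le> t" "t \<le> T" and c: "0 \<le> c" and T0: "T \<le> T0"
  shows "(\<integral>\<^sup>+\<omega>. (if V s t \<omega> < ennreal c then ennreal ((norm (Z t \<omega> - Z s \<omega>))\<^sup>2) else 0) \<partial>M)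
    \<le> ennreal (T0 + 2) * (\<integral>\<^sup>+\<omega>. min (ennreal c) (V s t \<omega>) \<partial>M)"
proof -
  obtain I where I: "has_ito_integral M F W T (\<lambda>s \<omega>. \<beta> s (Y s \<omega>)) I"
    and eq: "AE \<omega> in M. \<forall>t\<in>{0..T}.
       Y t \<omega> = Y 0 \<omega> + set_lebesgue_integral lborel {0..t} (\<lambda>s. \<alpha> s (Y s \<omega>)) + I t \<omega>"
    and Y_cont: "AE \<omega> in M. continuous_on {0..T} (\<lambda>t. Y t \<omega>)"
    and \<alpha>_int: "AE \<omega> in M. set_integrable lborel {0..T} (\<lambda>s. \<alpha> s (Y s \<omega>))"
    using solution unfolding strong_SDE_solution_def by blast
  have growth: "2 * (\<integral>\<^sup>+r\<in>{s..t}. ennreal ((norm (\<gamma> r))\<^sup>2) \<partial>lborel) \<le> V s t \<omega>"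
    if \<gamma>: "\<And>r. r \<in> {0..T} \<Longrightarrow> (norm (\<gamma> r))\<^sup>2 \<le> C * (1 + (norm (Y r \<omega>))\<^sup>2)"
      and ZY: "\<forall>s\<in>{0..T}. Z s \<omega> = Y s \<omega>" and \<omega>: "\<omega> \<in> space M"
    for \<gamma> :: "real \<Rightarrow> 'e::real_normed_vector" and \<omega>
  proof -
    have "(\<integral>\<^sup>+r\<in>{s..t}. ennreal ((norm (\<gamma> r))\<^sup>2) \<partial>lborel)
        \<le> (\<integral>\<^sup>+r\<in>{s..t}. ennreal (C * (1 + (norm (Z r \<omega>))\<^sup>2)) \<partial>lborel)"
      using \<gamma> ZY st by (intro nn_integral_mono) (auto intro!: ennreal_leI split: split_indicator)
    then have "2 * (\<integral>\<^sup>+r\<in>{s..t}. ennreal ((norm (\<gamma> r))\<^sup>2) \<partial>lborel)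
        \<le> 2 * (\<integral>\<^sup>+r\<in>{s..t}. ennreal (C * (1 + (norm (Z r \<omega>))\<^sup>2)) \<partial>lborel)"
      by (rule mult_left_mono) simp
    also have "\<dots> = (\<integral>\<^sup>+r. 2 * (ennreal (C * (1 + (norm (Z r \<omega>))\<^sup>2)) * indicator {s..t} r) \<partial>lborel)"
    proof (rule nn_integral_cmult[symmetric])
      have "(\<lambda>r. Z r \<omega>) \<in> borel_measurable borel"
        using Z_continuous[OF \<omega>] by (rule borel_measurable_continuous_onI)
      then show "(\<lambda>r. ennreal (C * (1 + (norm (Z r \<omega>))\<^sup>2)) * indicator {s..t} r) \<in> borel_measurable lborel"
        by measurable
    qed
    also have "\<dots> = V s t \<omega>"
      unfolding V_def using C by (intro nn_integral_cong) (auto simp: ennreal_mult mult.assoc split: split_indicator)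
    finally show ?thesis .
  qed
  have Q: "AE \<omega> in M. 2 * (\<integral>\<^sup>+r\<in>{s..t}. ennreal ((norm (\<beta> r (Y r \<omega>)))\<^sup>2) \<partial>lborel) \<le> V s t \<omega>"
    using ZY AE_space by eventually_elim (auto intro!: growth \<beta>_growth)
  have A: "AE \<omega> in M. 2 * (\<integral>\<^sup>+r\<in>{s..t}. ennreal ((norm (\<alpha> r (Y r \<omega>)))\<^sup>2) \<partial>lborel) \<le> V s t \<omega>"
    using ZY AE_space by eventually_elim (auto intro!: growth \<alpha>_growth)
  have \<beta>M: "AE \<omega> in M. (\<lambda>r. indicator {0..T} r *\<^sub>R \<beta> r (Y r \<omega>)) \<in> borel_measurable borel"
    using Y_cont by eventually_elim (rule \<beta>_measurable)
  note ito = ito_integral_truncated_bound[OF W I st \<beta>M V_measurable Q c]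
  have IM: "I t \<in> borel_measurable M" "I s \<in> borel_measurable M"
  proof -
    have "I u \<in> borel_measurable M" if "u \<in> {0..T}" for u
      using I that measurable_filtration[of u "I u"] unfolding has_ito_integral_def by simp
    then show "I t \<in> borel_measurable M" "I s \<in> borel_measurable M" using st by auto
  qed
  have drift: "AE \<omega> in M. ennreal ((norm (Z t \<omega> - Z s \<omega>))\<^sup>2) \<le>
      ennreal T0 * V s t \<omega> + 2 * ennreal ((norm (I t \<omega> - I s \<omega>))\<^sup>2)"
    using eq \<alpha>_int A ZY
  proof eventually_elim
    case (elim \<omega>)
    let ?a = "\<lambda>r. \<alpha> r (Y r \<omega>)"
    let ?x = "set_lebesgue_integral lborel {s<..t} ?a"
    have int: "set_integrable lborel S ?a" if "S \<subseteq> {0..T}" "S \<in> sets borel" for S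
      using elim(2) that by (auto intro: set_integrable_subset)
    have "{0..t} = {0..s} \<union> {s<..t}" "{0..s} \<inter> {s<..t} = {}" using st by auto
    then have "set_lebesgue_integral lborel {0..t} ?a = set_lebesgue_integral lborel {0..s} ?a + ?x"
      using st by (simp only:) (intro set_integral_Un int; auto)
    note split = this
    have regroup: "(p + (q + x) + i) - (p + q + j) = x + (i - j)" for p q x i j :: "real^'k"
      by simp
    have "t \<in> {0..T}" "s \<in> {0..T}" using st by auto
    then have "Z t \<omega> = Y 0 \<omega> + set_lebesgue_integral lborel {0..t} ?a + I t \<omega>"
        "Z s \<omega> = Y 0 \<omega> + set_lebesgue_integral lborel {0..s} ?a + I s \<omega>"
      using bspec[OF elim(1)] bspec[OF elim(4)] by presburger+
    then have inc: "Z t \<omega> - Z s \<omega> = ?x + (I t \<omega> - I s \<omega>)"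
      unfolding split by (simp only: regroup)
    have "(norm (Z t \<omega> - Z s \<omega>))\<^sup>2 \<le> (norm ?x + norm (I t \<omega> - I s \<omega>))\<^sup>2"
      unfolding inc by (intro power_mono norm_triangle_ineq) auto
    also have "\<dots> \<le> 2 * (norm ?x)\<^sup>2 + 2 * (norm (I t \<omega> - I s \<omega>))\<^sup>2"
      using sum_squares_bound[of "norm ?x" "norm (I t \<omega> - I s \<omega>)"] by (simp add: power2_sum)
    finally have "ennreal ((norm (Z t \<omega> - Z s \<omega>))\<^sup>2) \<le> ennreal (2 * (norm ?x)\<^sup>2 + 2 * (norm (I t \<omega> - I s \<omega>))\<^sup>2)"
      by (rule ennreal_leI)
    also have "\<dots> = 2 * ennreal ((norm ?x)\<^sup>2) + 2 * ennreal ((norm (I t \<omega> - I s \<omega>))\<^sup>2)"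
      by (simp add: ennreal_mult)
    also have "2 * ennreal ((norm ?x)\<^sup>2) \<le> ennreal T0 * V s t \<omega>"
    proof -
      have "2 * ennreal ((norm ?x)\<^sup>2) \<le>
          2 * (ennreal (t - s) * (\<integral>\<^sup>+r\<in>{s..t}. ennreal ((norm (?a r))\<^sup>2) \<partial>lborel))"
        using st by (intro mult_left_mono norm_integral_squared_le int) auto
      also have "\<dots> = ennreal (t - s) * (2 * (\<integral>\<^sup>+r\<in>{s..t}. ennreal ((norm (?a r))\<^sup>2) \<partial>lborel))"
        by (simp add: mult_ac)
      also have "\<dots> \<le> ennreal T0 * V s t \<omega>"
        using elim(3) st T0 by (intro mult_mono ennreal_leI) auto
      finally show ?thesis .
    qed
    finally show ?case by (simp add: add_right_mono)
  qed
  let ?i = "\<lambda>\<omega>. if V s t \<omega> < ennreal c then ennreal ((norm (I t \<omega> - I s \<omega>))\<^sup>2) else 0"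
  have iM: "?i \<in> borel_measurable M" using IM by measurable
  have "(\<integral>\<^sup>+\<omega>. (if V s t \<omega> < ennreal c then ennreal ((norm (Z t \<omega> - Z s \<omega>))\<^sup>2) else 0) \<partial>M)
      \<le> (\<integral>\<^sup>+\<omega>. ennreal T0 * min (ennreal c) (V s t \<omega>) + 2 * ?i \<omega> \<partial>M)"
  proof (rule nn_integral_mono_AE)
    show "AE \<omega> in M. (if V s t \<omega> < ennreal c then ennreal ((norm (Z t \<omega> - Z s \<omega>))\<^sup>2) else 0)
        \<le> ennreal T0 * min (ennreal c) (V s t \<omega>) + 2 * ?i \<omega>"
      using drift by eventually_elim (auto simp: min_def)
  qed
  also have "\<dots> = ennreal T0 * (\<integral>\<^sup>+\<omega>. min (ennreal c) (V s t \<omega>) \<partial>M) + 2 * (\<integral>\<^sup>+\<omega>. ?i \<omega> \<partial>M)"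
    using iM by (subst nn_integral_add) (auto simp: nn_integral_cmult)
  also have "\<dots> \<le> ennreal T0 * (\<integral>\<^sup>+\<omega>. min (ennreal c) (V s t \<omega>) \<partial>M) + 2 * (\<integral>\<^sup>+\<omega>. min (ennreal c) (V s t \<omega>) \<partial>M)"
    by (intro add_left_mono mult_left_mono ito) auto
  also have "\<dots> = ennreal (T0 + 2) * (\<integral>\<^sup>+\<omega>. min (ennreal c) (V s t \<omega>) \<partial>M)"
    using T T0 by (simp add: distrib_right)
  finally show ?thesis .
qed

text \<open>
  Gronwall's argument for the truncated quantities \<open>v c t = \<E>[min c (V 0 t)]\<close> and
  \<open>g c t = \<E>[|Z t|\<^sup>2; V 0 t < c]\<close>: the increment bound controls \<open>g\<close> by \<open>v\<close>, and the capped running integral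
  controls \<open>v\<close> by the time integral of \<open>g\<close>.  Both are finite by construction, and the resulting
  bound is independent of \<open>c\<close>.
\<close>

lemma second_moment_bound:
  assumes B: "(\<integral>\<^sup>+\<omega>. ennreal ((norm (Z 0 \<omega>))\<^sup>2) \<partial>M) \<le> ennreal B" "0 \<le> B"
    and T0: "T \<le> T0" and t: "t \<in> {0..T}"
  shows "(\<integral>\<^sup>+\<omega>. ennreal ((norm (Z t \<omega>))\<^sup>2) \<partial>M) \<le> ennreal (moment_bound C T0 B)"
proof -
  have T0': "0 \<le> T0" using T T0 by simp
  define v where "v c t = (\<integral>\<^sup>+\<omega>. min (ennreal c) (V 0 t \<omega>) \<partial>M)" for c t
  define g where "g c t = (\<integral>\<^sup>+\<omega>. (if V 0 t \<omega> < ennreal c then ennreal ((norm (Z t \<omega>))\<^sup>2) else 0) \<partial>M)" for c t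
  have gv: "g c t \<le> ennreal (2 * B) + ennreal (2 * (T0 + 2)) * v c t" if "0 \<le> c" "t \<in> {0..T}" for c t
  proof -
    let ?d = "\<lambda>\<omega>. if V 0 t \<omega> < ennreal c then ennreal ((norm (Z t \<omega> - Z 0 \<omega>))\<^sup>2) else 0"
    have "g c t \<le> (\<integral>\<^sup>+\<omega>. 2 * ennreal ((norm (Z 0 \<omega>))\<^sup>2) + 2 * ?d \<omega> \<partial>M)"
      unfolding g_def
    proof (rule nn_integral_mono)
      fix \<omega>
      have "(norm (Z t \<omega>))\<^sup>2 \<le> (norm (Z 0 \<omega>) + norm (Z t \<omega> - Z 0 \<omega>))\<^sup>2"
        by (intro power_mono) (use norm_triangle_sub[of "Z t \<omega>" "Z 0 \<omega>"] in auto)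
      also have "\<dots> \<le> 2 * (norm (Z 0 \<omega>))\<^sup>2 + 2 * (norm (Z t \<omega> - Z 0 \<omega>))\<^sup>2"
        using sum_squares_bound[of "norm (Z 0 \<omega>)" "norm (Z t \<omega> - Z 0 \<omega>)"] by (simp add: power2_sum)
      finally have "ennreal ((norm (Z t \<omega>))\<^sup>2) \<le> ennreal (2 * (norm (Z 0 \<omega>))\<^sup>2 + 2 * (norm (Z t \<omega> - Z 0 \<omega>))\<^sup>2)"
        by (rule ennreal_leI)
      then show "(if V 0 t \<omega> < ennreal c then ennreal ((norm (Z t \<omega>))\<^sup>2) else 0)
          \<le> 2 * ennreal ((norm (Z 0 \<omega>))\<^sup>2) + 2 * ?d \<omega>"
        by (simp add: ennreal_mult)
    qed
    also have "\<dots> = 2 * (\<integral>\<^sup>+\<omega>. ennreal ((norm (Z 0 \<omega>))\<^sup>2) \<partial>M) + 2 * (\<integral>\<^sup>+\<omega>. ?d \<omega> \<partial>M)"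
      by (subst nn_integral_add) (auto simp: nn_integral_cmult)
    also have "\<dots> \<le> 2 * ennreal B + 2 * (ennreal (T0 + 2) * v c t)"
      unfolding v_def using that by (intro add_mono mult_left_mono B(1) increment_truncated_bound T0) auto
    also have "\<dots> = ennreal (2 * B) + ennreal (2 * (T0 + 2)) * v c t"
      using B(2) T0' by (simp add: ennreal_mult mult.assoc del: distrib_left_numeral)
    finally show ?thesis .
  qed
  have v_int: "v c t \<le> (\<integral>\<^sup>+r\<in>{0..t}. (ennreal (2 * C * (1 + 2 * B)) + ennreal (4 * C * (T0 + 2)) * v c r) \<partial>lborel)"
    if c: "0 \<le> c" and t: "t \<in> {0..T}" for c t
  proof -
    let ?h = "\<lambda>r \<omega>. (if V 0 r \<omega> < ennreal c then ennreal (2 * C * (1 + (norm (Z r \<omega>))\<^sup>2)) else 0)"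
    have [measurable]: "(\<lambda>p. V 0 (snd p) (fst p)) \<in> borel_measurable (M \<Otimes>\<^sub>M lborel)"
    proof -
      have "(\<lambda>p. (snd p, fst p)) \<in> M \<Otimes>\<^sub>M (lborel :: real measure) \<rightarrow>\<^sub>M borel \<Otimes>\<^sub>M M" by measurable
      from measurable_compose[OF this V0_jointly_measurable] show ?thesis by simp
    qed
    have hM: "(\<lambda>p. ?h (snd p) (fst p) * indicator {0..t} (snd p)) \<in> borel_measurable (M \<Otimes>\<^sub>M lborel)"
      by measurable
    have "v c t \<le> (\<integral>\<^sup>+\<omega>. (\<integral>\<^sup>+r\<in>{0..t}. ?h r \<omega> \<partial>lborel) \<partial>M)"
      unfolding v_def using c t by (intro nn_integral_mono capped_V_le) auto
    also have "\<dots> = (\<integral>\<^sup>+r. (\<integral>\<^sup>+\<omega>. ?h r \<omega> * indicator {0..t} r \<partial>M) \<partial>lborel)"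
    proof -
      interpret P: pair_sigma_finite M "lborel :: real measure" by standard
      show ?thesis
        by (rule P.Fubini'[symmetric]) (use hM in \<open>simp add: case_prod_beta\<close>)
    qed
    also have "\<dots> \<le> (\<integral>\<^sup>+r\<in>{0..t}. (ennreal (2 * C * (1 + 2 * B)) + ennreal (4 * C * (T0 + 2)) * v c r) \<partial>lborel)"
    proof (rule nn_integral_mono)
      fix r
      have "(\<integral>\<^sup>+\<omega>. ?h r \<omega> \<partial>M) \<le> ennreal (2 * C * (1 + 2 * B)) + ennreal (4 * C * (T0 + 2)) * v c r"
        if r: "r \<in> {0..T}"
      proof -
        have "(\<integral>\<^sup>+\<omega>. ?h r \<omega> \<partial>M) \<le> (\<integral>\<^sup>+\<omega>. ennreal (2 * C) + ennreal (2 * C) *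
            (if V 0 r \<omega> < ennreal c then ennreal ((norm (Z r \<omega>))\<^sup>2) else 0) \<partial>M)"
          using C by (intro nn_integral_mono) (simp add: distrib_left ennreal_mult)
        also have "\<dots> = ennreal (2 * C) + ennreal (2 * C) * g c r"
          unfolding g_def by (subst nn_integral_add) (auto simp: nn_integral_cmult emeasure_space_1)
        also have "\<dots> \<le> ennreal (2 * C) + ennreal (2 * C) * (ennreal (2 * B) + ennreal (2 * (T0 + 2)) * v c r)"
          using gv[OF c r] by (intro add_left_mono mult_left_mono) auto
        also have "\<dots> = (ennreal (2 * C) + ennreal (2 * C) * ennreal (2 * B)) +
            ennreal (2 * C) * ennreal (2 * (T0 + 2)) * v c r"
          by (simp only: distrib_left add.assoc mult.assoc)
        also have "ennreal (2 * C) + ennreal (2 * C) * ennreal (2 * B) = ennreal (2 * C * (1 + 2 * B))"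
          using C B(2) by (simp add: ennreal_mult[symmetric] ennreal_plus[symmetric] distrib_left del: ennreal_plus)
        also have "ennreal (2 * C) * ennreal (2 * (T0 + 2)) = ennreal (4 * C * (T0 + 2))"
          using C T0' by (subst ennreal_mult[symmetric]) (auto simp: algebra_simps simp del: ennreal_plus)
        finally show ?thesis .
      qed
      then show "(\<integral>\<^sup>+\<omega>. ?h r \<omega> * indicator {0..t} r \<partial>M) \<le>
          (ennreal (2 * C * (1 + 2 * B)) + ennreal (4 * C * (T0 + 2)) * v c r) * indicator {0..t} r"
        using t by (auto split: split_indicator)
    qed
    finally show ?thesis .
  qed
  define K where "K = 2 * (2 * C * (1 + 2 * B)) * T0 * exp (2 * (4 * C * (T0 + 2)) * T0)"
  have vK: "v c t \<le> ennreal K" if "0 \<le> c" for c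
  proof -
    have "v c t \<le> ennreal (2 * (2 * C * (1 + 2 * B)) * T * exp (2 * (4 * C * (T0 + 2)) * T))"
    proof (rule gronwall_ennreal[where c = c and v = "v c"])
      show "v c t \<le> ennreal c" for t
      proof -
        have "v c t \<le> (\<integral>\<^sup>+\<omega>. ennreal c \<partial>M)" unfolding v_def by (intro nn_integral_mono) simp
        then show ?thesis by (simp add: emeasure_space_1)
      qed
    qed (use v_int[OF that] C B(2) T0' t in auto)
    also have "\<dots> \<le> ennreal K"
      unfolding K_def using C B(2) T T0 by (intro ennreal_leI mult_mono) auto
    finally show ?thesis .
  qed
  have "0 \<le> K" unfolding K_def using C B(2) T0' by simp
  have gK: "g c t \<le> ennreal (moment_bound C T0 B)" if "0 \<le> c" for c
  proof -
    have "g c t \<le> ennreal (2 * B) + ennreal (2 * (T0 + 2)) * ennreal K"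
      using gv[OF that t] vK[OF that] by (meson add_left_mono mult_left_mono order_trans zero_le)
    also have "\<dots> = ennreal (moment_bound C T0 B)"
      using B(2) T0' \<open>0 \<le> K\<close> unfolding moment_bound_def K_def[symmetric]
      by (simp add: ennreal_mult[symmetric] ennreal_plus[symmetric] del: ennreal_plus)
    finally show ?thesis .
  qed
  show ?thesis
  proof (rule nn_integral_truncated_le[where V = "V 0 t"])
    show "AE \<omega> in M. V 0 t \<omega> < \<infinity>" using t by (intro AE_I2 V0_finite) auto
  qed (use gK in \<open>auto simp: g_def\<close>)
qed

lemma increment_moment_bound:
  assumes B: "(\<integral>\<^sup>+\<omega>. ennreal ((norm (Z 0 \<omega>))\<^sup>2) \<partial>M) \<le> ennreal B" "0 \<le> B"
    and T0: "T \<le> T0" and st: "0 \<le> s" "s \<le> t" "t \<le> T"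
  shows "(\<integral>\<^sup>+\<omega>. ennreal ((norm (Z t \<omega> - Z s \<omega>))\<^sup>2) \<partial>M)
    \<le> ennreal ((T0 + 2) * (2 * C * (1 + moment_bound C T0 B)) * (t - s))"
proof -
  have T0': "0 \<le> T0" using T T0 by simp
  let ?K = "moment_bound C T0 B"
  have K: "0 \<le> ?K" unfolding moment_bound_def using C B(2) T0' by simp
  have "(\<integral>\<^sup>+\<omega>. V s t \<omega> \<partial>M) =
      (\<integral>\<^sup>+r. (\<integral>\<^sup>+\<omega>. ennreal (2 * C * (1 + (norm (Z r \<omega>))\<^sup>2)) * indicator {s..t} r \<partial>M) \<partial>lborel)"
  proof -
    interpret P: pair_sigma_finite M "lborel :: real measure" by standard
    show ?thesis
      unfolding V_def
    proof (rule P.Fubini'[symmetric])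
      have "(\<lambda>p. ennreal (2 * C * (1 + (norm (Z (snd p) (fst p)))\<^sup>2)) * indicator {s..t} (snd p))
          \<in> borel_measurable (M \<Otimes>\<^sub>M lborel)" by measurable
      then show "(\<lambda>(\<omega>, r). ennreal (2 * C * (1 + (norm (Z r \<omega>))\<^sup>2)) * indicator {s..t} r)
          \<in> borel_measurable (M \<Otimes>\<^sub>M lborel)" by (simp add: case_prod_beta)
    qed
  qed
  also have "\<dots> \<le> (\<integral>\<^sup>+r. ennreal (2 * C * (1 + ?K)) * indicator {s..t} r \<partial>lborel)"
  proof (rule nn_integral_mono)
    fix r
    have "(\<integral>\<^sup>+\<omega>. ennreal (2 * C * (1 + (norm (Z r \<omega>))\<^sup>2)) \<partial>M) \<le> ennreal (2 * C * (1 + ?K))"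
      if r: "r \<in> {0..T}"
    proof -
      have "(\<integral>\<^sup>+\<omega>. ennreal (2 * C * (1 + (norm (Z r \<omega>))\<^sup>2)) \<partial>M) =
          (\<integral>\<^sup>+\<omega>. ennreal (2 * C) + ennreal (2 * C) * ennreal ((norm (Z r \<omega>))\<^sup>2) \<partial>M)"
        using C by (intro nn_integral_cong) (simp add: distrib_left ennreal_mult)
      also have "\<dots> = ennreal (2 * C) + ennreal (2 * C) * (\<integral>\<^sup>+\<omega>. ennreal ((norm (Z r \<omega>))\<^sup>2) \<partial>M)"
        by (subst nn_integral_add) (auto simp: nn_integral_cmult emeasure_space_1)
      also have "\<dots> \<le> ennreal (2 * C) + ennreal (2 * C) * ennreal ?K"
        by (intro add_left_mono mult_left_mono second_moment_bound B T0 r) auto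
      also have "\<dots> = ennreal (2 * C * (1 + ?K))"
        using C K by (simp add: ennreal_mult[symmetric] ennreal_plus[symmetric] distrib_left del: ennreal_plus)
      finally show ?thesis .
    qed
    then show "(\<integral>\<^sup>+\<omega>. ennreal (2 * C * (1 + (norm (Z r \<omega>))\<^sup>2)) * indicator {s..t} r \<partial>M)
        \<le> ennreal (2 * C * (1 + ?K)) * indicator {s..t} r"
      using st by (auto split: split_indicator)
  qed
  also have "\<dots> = ennreal (2 * C * (1 + ?K) * (t - s))"
    using C K st by (simp add: nn_integral_cmult ennreal_mult)
  finally have V: "(\<integral>\<^sup>+\<omega>. V s t \<omega> \<partial>M) \<le> ennreal (2 * C * (1 + ?K) * (t - s))" .
  show ?thesis
  proof (rule nn_integral_truncated_le[where V = "V s t"])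
    show "AE \<omega> in M. V s t \<omega> < \<infinity>" using st by (intro AE_I2 V_finite) auto
    fix n :: nat
    have "(\<integral>\<^sup>+\<omega>. (if V s t \<omega> < ennreal (real n) then ennreal ((norm (Z t \<omega> - Z s \<omega>))\<^sup>2) else 0) \<partial>M)
        \<le> ennreal (T0 + 2) * (\<integral>\<^sup>+\<omega>. min (ennreal (real n)) (V s t \<omega>) \<partial>M)"
      by (intro increment_truncated_bound st T0) auto
    also have "\<dots> \<le> ennreal (T0 + 2) * (\<integral>\<^sup>+\<omega>. V s t \<omega> \<partial>M)"
      by (intro mult_left_mono nn_integral_mono) auto
    also have "\<dots> \<le> ennreal (T0 + 2) * ennreal (2 * C * (1 + ?K) * (t - s))"
      by (intro mult_left_mono V) auto
    also have "\<dots> = ennreal ((T0 + 2) * (2 * C * (1 + ?K)) * (t - s))"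
      using T0' by (subst ennreal_mult'[symmetric]) (auto simp: mult_ac simp del: ennreal_plus)
    finally show "(\<integral>\<^sup>+\<omega>. (if V s t \<omega> < ennreal (real n) then ennreal ((norm (Z t \<omega> - Z s \<omega>))\<^sup>2) else 0) \<partial>M)
        \<le> ennreal ((T0 + 2) * (2 * C * (1 + ?K)) * (t - s))" .
  qed auto
qed

end

section \<open>The second moment matrix of a DO solution\<close>

lemma borel_measurable_matrix:
  fixes f :: "'a \<Rightarrow> real^'m^'k"
  assumes "\<And>i j. (\<lambda>x. f x $ i $ j) \<in> borel_measurable N"
  shows "f \<in> borel_measurable N"
  using assms by (subst borel_measurable_euclidean_space) (auto simp: Basis_vec_def inner_axis)

lemma diffusion_along_path_measurable:
  fixes U :: "real \<Rightarrow> real^'d^'r" and b :: "real \<Rightarrow> real^'d \<Rightarrow> real^'m^'d"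
  assumes b: "jointly_measurable b" and U: "continuous_on {0..T} U"
    and y: "continuous_on {0..T} y" and T: "0 \<le> T"
  shows "(\<lambda>r. indicator {0..T} r *\<^sub>R (U r ** b r (transpose (U r) *v y r))) \<in> borel_measurable borel"
proof -
  let ?c = "\<lambda>r. max 0 (min T r)"
  have c: "continuous_on UNIV ?c" by (intro continuous_intros)
  have U': "continuous_on UNIV (\<lambda>r. U (?c r))"
    using T by (intro continuous_on_compose2[OF U c]) auto
  have y': "continuous_on UNIV (\<lambda>r. y (?c r))"
    using T by (intro continuous_on_compose2[OF y c]) auto
  have "continuous_on UNIV (\<lambda>r. \<chi> j. \<Sum>i\<in>UNIV. U (?c r) $ i $ j * y (?c r) $ i)"
    by (intro continuous_intros U' y')
  then have x: "continuous_on UNIV (\<lambda>r. transpose (U (?c r)) *v y (?c r))"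
    by (simp add: matrix_vector_mult_def transpose_def vector_matrix_mult_def)
  have [measurable]: "(\<lambda>r. transpose (U (?c r)) *v y (?c r)) \<in> borel_measurable borel"
    by (rule borel_measurable_continuous_onI[OF x])
  have [measurable]: "(\<lambda>r. U (?c r)) \<in> borel_measurable borel"
    by (rule borel_measurable_continuous_onI[OF U'])
  have "(\<lambda>r. (?c r, transpose (U (?c r)) *v y (?c r))) \<in> borel \<rightarrow>\<^sub>M restrict_space borel {0..} \<Otimes>\<^sub>M borel"
  proof (rule measurable_Pair)
    show "?c \<in> borel \<rightarrow>\<^sub>M restrict_space borel {0..}"
      by (rule measurable_restrict_space2) (auto intro: borel_measurable_continuous_onI[OF c])
  qed measurable
  from measurable_compose[OF this b[unfolded jointly_measurable_def]]
  have [measurable]: "(\<lambda>r. b (?c r) (transpose (U (?c r)) *v y (?c r))) \<in> borel_measurable borel" by simp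
  have "(\<lambda>r. U (?c r) ** b (?c r) (transpose (U (?c r)) *v y (?c r))) \<in> borel_measurable borel"
    by (rule borel_measurable_matrix) (simp add: matrix_matrix_mult_def del: transpose_matrix_vector)
  then have "(\<lambda>r. indicator {0..T} r *\<^sub>R (U (?c r) ** b (?c r) (transpose (U (?c r)) *v y (?c r)))) \<in> borel_measurable borel"
    by measurable
  moreover have "indicator {0..T} r *\<^sub>R (U (?c r) ** b (?c r) (transpose (U (?c r)) *v y (?c r))) =
      indicator {0..T} r *\<^sub>R (U r ** b r (transpose (U r) *v y r))" for r
    by (auto simp: indicator_def)
  ultimately show ?thesis by (simp only:)
qed

lemma L2_vector_nn_integral:
  "L2_vector M X \<Longrightarrow> (\<integral>\<^sup>+\<omega>. ennreal ((norm (X \<omega>))\<^sup>2) \<partial>M) = ennreal (\<integral>\<omega>. (norm (X \<omega>))\<^sup>2 \<partial>M)"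
  by (intro nn_integral_eq_integral) (auto simp: L2_vector_def)

lemma L2_vector_diff:
  assumes "L2_vector M X" "L2_vector M X'"
  shows "L2_vector M (\<lambda>\<omega>. X \<omega> - X' \<omega>)"
proof -
  have [measurable]: "X \<in> borel_measurable M" "X' \<in> borel_measurable M"
    using assms by (auto simp: L2_vector_def)
  have "integrable M (\<lambda>\<omega>. (norm (X \<omega> - X' \<omega>))\<^sup>2)"
  proof (rule Bochner_Integration.integrable_bound)
    show "integrable M (\<lambda>\<omega>. 2 * (norm (X \<omega>))\<^sup>2 + 2 * (norm (X' \<omega>))\<^sup>2)"
      using assms by (auto simp: L2_vector_def)
    show "AE \<omega> in M. norm ((norm (X \<omega> - X' \<omega>))\<^sup>2) \<le> norm (2 * (norm (X \<omega>))\<^sup>2 + 2 * (norm (X' \<omega>))\<^sup>2)"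
    proof (rule AE_I2)
      fix \<omega>
      have "(norm (X \<omega> - X' \<omega>))\<^sup>2 \<le> (norm (X \<omega>) + norm (X' \<omega>))\<^sup>2"
        by (intro power_mono norm_triangle_ineq4) auto
      then show "norm ((norm (X \<omega> - X' \<omega>))\<^sup>2) \<le> norm (2 * (norm (X \<omega>))\<^sup>2 + 2 * (norm (X' \<omega>))\<^sup>2)"
        using sum_squares_bound[of "norm (X \<omega>)" "norm (X' \<omega>)"] by (simp add: power2_sum)
    qed
  qed measurable
  then show ?thesis by (simp add: L2_vector_def)
qed

text \<open>
  Orthonormality of the rows of \<open>U\<close> makes lifting to the ambient space isometric and projecting back
  a contraction, so the reduced equation inherits the linear growth of \<open>a\<close> and \<open>b\<close> with the same
  constant.  Hence the moment bounds for \<open>Y\<close> involve only that constant, the horizon and the second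
  moment of the initial datum, and do not deteriorate as the horizon of existence is approached.
\<close>

lemma DO_moment_bounds:
  fixes Y :: "real \<Rightarrow> 'w \<Rightarrow> real^'r" and U :: "real \<Rightarrow> real^'d^'r"
    and a :: "real \<Rightarrow> real^'d \<Rightarrow> real^'d" and b :: "real \<Rightarrow> real^'d \<Rightarrow> real^'m^'d"
  assumes basis: "usual_filtered_prob_space M F" and W: "brownian_motion M F W"
    and b: "jointly_measurable b"
    and C: "0 < C" "\<And>s x. 0 \<le> s \<Longrightarrow> (norm (a s x))\<^sup>2 + (norm (b s x))\<^sup>2 \<le> C * (1 + (norm x)\<^sup>2)"
    and sol: "strong_DO_solution M F W a b T U0 Y0 U Y" and horizon: "0 \<le> T" "T \<le> T0"
    and B: "(\<integral>\<omega>. (norm (Y 0 \<omega>))\<^sup>2 \<partial>M) = B"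
    and K: "K = moment_bound C T0 B"
  shows "t \<in> {0..T} \<Longrightarrow> (\<integral>\<omega>. (norm (Y t \<omega>))\<^sup>2 \<partial>M) \<le> K"
    and "0 \<le> s \<Longrightarrow> s \<le> t \<Longrightarrow> t \<le> T \<Longrightarrow>
      (\<integral>\<omega>. (norm (Y t \<omega> - Y s \<omega>))\<^sup>2 \<partial>M) \<le> (T0 + 2) * (2 * C * (1 + K)) * (t - s)"
proof -
  interpret usual_filtered_prob_space M F by (rule basis)
  have ac: "abs_continuous_on 0 T U"
    and L2: "\<And>t. t \<in> {0..T} \<Longrightarrow> L2_vector M (Y t)"
    and Y_cont: "AE \<omega> in M. continuous_on {0..T} (\<lambda>t. Y t \<omega>)"
    and SDE: "strong_SDE_solution M F W T
       (\<lambda>t y. U t *v a t (transpose (U t) *v y)) (\<lambda>t y. U t ** b t (transpose (U t) *v y)) Y"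
    using sol by (auto simp: strong_DO_solution_def)
  have "AE t in lborel. t \<in> {0..T} \<longrightarrow>
      (\<exists>D. (U has_vector_derivative D) (at t) \<and> U t ** transpose D = 0)"
    and "orthonormal_rows (U 0)"
    using sol unfolding strong_DO_solution_def by blast+
  then have orth: "orthonormal_rows (U t)" if "t \<in> {0..T}" for t
    using orthonormal_rows_preserved[OF ac _ _ that] by blast
  have YM: "Y t \<in> borel_measurable M" if "t \<in> {0..T}" for t
    using L2[OF that] by (simp add: L2_vector_def)
  obtain Z where Z: "\<And>s. Z s \<in> borel_measurable M"
    "\<And>\<omega>. \<omega> \<in> space M \<Longrightarrow> continuous_on UNIV (\<lambda>s. Z s \<omega>)"
    "AE \<omega> in M. \<forall>s\<in>{0..T}. Z s \<omega> = Y s \<omega>"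
    using continuous_modification[OF YM Y_cont horizon(1)] by blast
  have growth: "(norm (a s (transpose (U s) *v y)))\<^sup>2 + (norm (b s (transpose (U s) *v y)))\<^sup>2 \<le> C * (1 + (norm y)\<^sup>2)"
    if "s \<in> {0..T}" for s y
    using C(2)[of s "transpose (U s) *v y"] norm_transpose_orthonormal_mult[OF orth[OF that], of y] that by simp
  interpret linear_growth_SDE M F W T C "\<lambda>t y. U t *v a t (transpose (U t) *v y)"
    "\<lambda>t y. U t ** b t (transpose (U t) *v y)" Y Z
  proof
    show "(norm (U s *v a s (transpose (U s) *v y)))\<^sup>2 \<le> C * (1 + (norm y)\<^sup>2)" if "s \<in> {0..T}" for s y
    proof -
      have "(norm (U s *v a s (transpose (U s) *v y)))\<^sup>2 \<le> (norm (a s (transpose (U s) *v y)))\<^sup>2"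
        by (intro power_mono norm_orthonormal_mult_le orth that norm_ge_zero)
      also have "\<dots> \<le> C * (1 + (norm y)\<^sup>2)"
        using growth[OF that, of y] zero_le_power2[of "norm (b s (transpose (U s) *v y))"] by linarith
      finally show ?thesis .
    qed
    show "(norm (U s ** b s (transpose (U s) *v y)))\<^sup>2 \<le> C * (1 + (norm y)\<^sup>2)" if "s \<in> {0..T}" for s y
    proof -
      have "(norm (U s ** b s (transpose (U s) *v y)))\<^sup>2 \<le> (norm (b s (transpose (U s) *v y)))\<^sup>2"
        by (intro norm_orthonormal_matrix_mult_le orth that)
      also have "\<dots> \<le> C * (1 + (norm y)\<^sup>2)"
        using growth[OF that, of y] zero_le_power2[of "norm (a s (transpose (U s) *v y))"] by linarith
      finally show ?thesis .
    qed
    show "(\<lambda>r. indicator {0..T} r *\<^sub>R (U r ** b r (transpose (U r) *v y r))) \<in> borel_measurable borel"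
      if "continuous_on {0..T} y" for y :: "real \<Rightarrow> real^'r"
      by (rule diffusion_along_path_measurable[OF b abs_continuous_on_imp_continuous_on[OF ac] that horizon(1)])
  qed (use W horizon C(1) SDE Z in auto)
  have B0: "0 \<le> B" using B by auto
  have ZY_norm: "AE \<omega> in M. \<forall>t\<in>{0..T}. norm (Z t \<omega>) = norm (Y t \<omega>)"
    using ZY by eventually_elim auto
  have "(\<integral>\<^sup>+\<omega>. ennreal ((norm (Z 0 \<omega>))\<^sup>2) \<partial>M) = (\<integral>\<^sup>+\<omega>. ennreal ((norm (Y 0 \<omega>))\<^sup>2) \<partial>M)"
    using ZY_norm horizon by (intro nn_integral_cong_AE) (auto elim!: eventually_mono)
  then have B': "(\<integral>\<^sup>+\<omega>. ennreal ((norm (Z 0 \<omega>))\<^sup>2) \<partial>M) \<le> ennreal B"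
    using L2_vector_nn_integral[OF L2[of 0]] horizon B by simp
  have "0 \<le> T0" using horizon by simp
  then have K0: "0 \<le> K" unfolding K moment_bound_def using C(1) B0 by simp
  show "(\<integral>\<omega>. (norm (Y t \<omega>))\<^sup>2 \<partial>M) \<le> K" if t: "t \<in> {0..T}"
  proof -
    have "ennreal (\<integral>\<omega>. (norm (Y t \<omega>))\<^sup>2 \<partial>M) = (\<integral>\<^sup>+\<omega>. ennreal ((norm (Z t \<omega>))\<^sup>2) \<partial>M)"
      unfolding L2_vector_nn_integral[OF L2[OF t], symmetric]
      using ZY_norm t by (intro nn_integral_cong_AE) (auto elim!: eventually_mono)
    also have "\<dots> \<le> ennreal K" unfolding K by (rule second_moment_bound[OF B' B0 horizon(2) t])
    finally show ?thesis using K0 by (simp add: ennreal_le_iff)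
  qed
  show "(\<integral>\<omega>. (norm (Y t \<omega> - Y s \<omega>))\<^sup>2 \<partial>M) \<le> (T0 + 2) * (2 * C * (1 + K)) * (t - s)"
    if st: "0 \<le> s" "s \<le> t" "t \<le> T"
  proof -
    have "L2_vector M (\<lambda>\<omega>. Y t \<omega> - Y s \<omega>)" using st by (intro L2_vector_diff L2) auto
    from L2_vector_nn_integral[OF this, symmetric]
    have "ennreal (\<integral>\<omega>. (norm (Y t \<omega> - Y s \<omega>))\<^sup>2 \<partial>M) = (\<integral>\<^sup>+\<omega>. ennreal ((norm (Z t \<omega> - Z s \<omega>))\<^sup>2) \<partial>M)"
      using ZY st by (auto intro!: nn_integral_cong_AE elim!: eventually_mono)
    also have "\<dots> \<le> ennreal ((T0 + 2) * (2 * C * (1 + K)) * (t - s))"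
      unfolding K by (rule increment_moment_bound[OF B' B0 horizon(2) st])
    finally show ?thesis using K0 C(1) horizon st by (subst (asm) ennreal_le_iff) auto
  qed
qed

lemma L2_vector_mult_integrable:
  assumes "L2_vector M X" "L2_vector M X'"
  shows "integrable M (\<lambda>\<omega>. X \<omega> $ i * X' \<omega> $ j)"
proof (rule Bochner_Integration.integrable_bound)
  have [measurable]: "X \<in> borel_measurable M" "X' \<in> borel_measurable M"
    using assms by (auto simp: L2_vector_def)
  show "(\<lambda>\<omega>. X \<omega> $ i * X' \<omega> $ j) \<in> borel_measurable M" by measurable
  show "integrable M (\<lambda>\<omega>. (norm (X \<omega>))\<^sup>2 + (norm (X' \<omega>))\<^sup>2)"
    using assms by (auto simp: L2_vector_def)
  show "AE \<omega> in M. norm (X \<omega> $ i * X' \<omega> $ j) \<le> norm ((norm (X \<omega>))\<^sup>2 + (norm (X' \<omega>))\<^sup>2)"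
  proof (rule AE_I2)
    fix \<omega>
    have "norm (X \<omega> $ i * X' \<omega> $ j) \<le> norm (X \<omega>) * norm (X' \<omega>)"
      unfolding norm_mult by (intro mult_mono Finite_Cartesian_Product.norm_nth_le norm_ge_zero)
    also have "\<dots> \<le> (norm (X \<omega>))\<^sup>2 + (norm (X' \<omega>))\<^sup>2"
      using sum_squares_bound[of "norm (X \<omega>)" "norm (X' \<omega>)"]
        mult_nonneg_nonneg[OF norm_ge_zero[of "X \<omega>"] norm_ge_zero[of "X' \<omega>"]] by linarith
    finally show "norm (X \<omega> $ i * X' \<omega> $ j) \<le> norm ((norm (X \<omega>))\<^sup>2 + (norm (X' \<omega>))\<^sup>2)" by simp
  qed
qed

lemma second_moment_trace:
  assumes "L2_vector M (X :: 'w \<Rightarrow> real^'k)"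
  shows "(\<integral>\<omega>. (norm (X \<omega>))\<^sup>2 \<partial>M) = (\<Sum>i\<in>UNIV. second_moment M X $ i $ i)"
proof -
  have "(norm (X \<omega>))\<^sup>2 = (\<Sum>i\<in>UNIV. X \<omega> $ i * X \<omega> $ i)" for \<omega>
    by (simp add: power2_norm_eq_inner inner_vec_def)
  then show ?thesis
    using L2_vector_mult_integrable[OF assms assms] by (simp add: cross_moment_def)
qed

text \<open>
  The quadratic form of the second moment matrix at \<open>c\<close> is the mean square of \<open>\<Sum>i. c i X i\<close>, so a vector
  in its kernel is a linear relation between the components.
\<close>

lemma second_moment_nonsingular:
  fixes X :: "'w \<Rightarrow> real^'k"
  assumes X: "L2_vector M X" and ind: "linearly_independent_components M X"
  shows "det (second_moment M X) \<noteq> 0"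
proof -
  have "c = 0" if c: "second_moment M X *v c = 0" for c
  proof -
    note int = L2_vector_mult_integrable[OF X X]
    let ?s = "\<lambda>\<omega>. \<Sum>i\<in>UNIV. c $ i * X \<omega> $ i"
    have sq: "(?s \<omega>)\<^sup>2 = (\<Sum>i\<in>UNIV. \<Sum>j\<in>UNIV. c $ i * c $ j * (X \<omega> $ i * X \<omega> $ j))" for \<omega>
      unfolding power2_eq_square sum_product by (simp add: mult_ac)
    have "(\<integral>\<omega>. (?s \<omega>)\<^sup>2 \<partial>M) = (\<Sum>i\<in>UNIV. \<Sum>j\<in>UNIV. c $ i * c $ j * (\<integral>\<omega>. X \<omega> $ i * X \<omega> $ j \<partial>M))"
      unfolding sq using int by simp
    also have "\<dots> = (\<Sum>i\<in>UNIV. c $ i * (second_moment M X *v c) $ i)"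
      by (simp add: matrix_vector_mult_def cross_moment_def sum_distrib_left mult_ac)
    also have "\<dots> = 0" by (simp add: c)
    finally have "(\<integral>\<omega>. (?s \<omega>)\<^sup>2 \<partial>M) = 0" .
    moreover have "integrable M (\<lambda>\<omega>. (?s \<omega>)\<^sup>2)" unfolding sq using int by simp
    ultimately have "AE \<omega> in M. (?s \<omega>)\<^sup>2 = 0"
      by (subst (asm) integral_nonneg_eq_0_iff_AE) auto
    then have "AE \<omega> in M. ?s \<omega> = 0" by simp
    then show ?thesis using ind by (simp add: linearly_independent_components_def vec_eq_iff)
  qed
  then have "\<exists>B. B ** second_moment M X = mat 1" by (simp add: matrix_left_invertible_ker)
  then show ?thesis by (simp add: invertible_left_inverse flip: invertible_det_nz)
qed

text \<open>
  The entries are expectations of products, and \<open>x y - x' y' = (x - x') y + x' (y - y')\<close>.  Young's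
  inequality with a weight of order \<open>\<surd>\<delta>\<close> balances the increment against the second moments.
\<close>

lemma second_moment_Hoelder:
  fixes X X' :: "'w \<Rightarrow> real^'k"
  assumes X: "L2_vector M X" "L2_vector M X'" and \<delta>: "0 \<le> \<delta>"
    and K: "(\<integral>\<omega>. (norm (X \<omega>))\<^sup>2 \<partial>M) \<le> K" "(\<integral>\<omega>. (norm (X' \<omega>))\<^sup>2 \<partial>M) \<le> K"
    and L: "(\<integral>\<omega>. (norm (X \<omega> - X' \<omega>))\<^sup>2 \<partial>M) \<le> L * \<delta>"
  shows "norm (second_moment M X - second_moment M X') \<le> real (CARD('k) * CARD('k)) * (K + L) * sqrt \<delta>"
proof -
  let ?D = "\<lambda>\<omega>. X \<omega> - X' \<omega>"
  note D = L2_vector_diff[OF X]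
  have sq_int: "integrable M (\<lambda>\<omega>. (norm (X \<omega>))\<^sup>2)" "integrable M (\<lambda>\<omega>. (norm (X' \<omega>))\<^sup>2)"
    "integrable M (\<lambda>\<omega>. (norm (?D \<omega>))\<^sup>2)"
    using X D by (auto simp: L2_vector_def)
  have entry: "\<bar>(second_moment M X - second_moment M X') $ i $ j\<bar> \<le> (K + L) * sqrt \<delta>" for i j
  proof -
    note int = L2_vector_mult_integrable[OF X(1) X(1), of i j] L2_vector_mult_integrable[OF X(2) X(2), of i j]
    have pointwise: "\<bar>X \<omega> $ i * X \<omega> $ j - X' \<omega> $ i * X' \<omega> $ j\<bar> \<le>
        norm (?D \<omega>) * norm (X \<omega>) + norm (X' \<omega>) * norm (?D \<omega>)" for \<omega>
    proof -
      have "X \<omega> $ i * X \<omega> $ j - X' \<omega> $ i * X' \<omega> $ j = ?D \<omega> $ i * X \<omega> $ j + X' \<omega> $ i * ?D \<omega> $ j"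
        by (simp add: algebra_simps)
      also have "\<bar>\<dots>\<bar> \<le> \<bar>?D \<omega> $ i\<bar> * \<bar>X \<omega> $ j\<bar> + \<bar>X' \<omega> $ i\<bar> * \<bar>?D \<omega> $ j\<bar>"
        by (metis abs_mult abs_triangle_ineq)
      also have "\<dots> \<le> norm (?D \<omega>) * norm (X \<omega>) + norm (X' \<omega>) * norm (?D \<omega>)"
        using Finite_Cartesian_Product.norm_nth_le[of "?D \<omega>"] Finite_Cartesian_Product.norm_nth_le[of "X \<omega>"]
          Finite_Cartesian_Product.norm_nth_le[of "X' \<omega>"]
        by (intro add_mono mult_mono) auto
      finally show ?thesis .
    qed
    have bound: "\<bar>(second_moment M X - second_moment M X') $ i $ j\<bar> \<le> h * K + L * \<delta> / h" if h: "0 < h" for h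
    proof -
      have young: "x * y \<le> h / 2 * y\<^sup>2 + 1 / (2 * h) * x\<^sup>2" for x y :: real
      proof -
        have "0 \<le> (h * y - x)\<^sup>2 / (2 * h)" using h by simp
        also have "\<dots> = h / 2 * y\<^sup>2 + 1 / (2 * h) * x\<^sup>2 - x * y"
          using h by (simp add: field_simps power2_eq_square)
        finally show ?thesis by simp
      qed
      let ?g = "\<lambda>\<omega>. h / 2 * (norm (X \<omega>))\<^sup>2 + h / 2 * (norm (X' \<omega>))\<^sup>2 + 1 / h * (norm (?D \<omega>))\<^sup>2"
      have "(second_moment M X - second_moment M X') $ i $ j =
          (\<integral>\<omega>. X \<omega> $ i * X \<omega> $ j - X' \<omega> $ i * X' \<omega> $ j \<partial>M)"
        using int by (simp add: cross_moment_def)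
      also have "\<bar>\<dots>\<bar> \<le> (\<integral>\<omega>. ?g \<omega> \<partial>M)"
      proof (rule order_trans[OF integral_abs_bound integral_mono])
        show "\<bar>X \<omega> $ i * X \<omega> $ j - X' \<omega> $ i * X' \<omega> $ j\<bar> \<le> ?g \<omega>" for \<omega>
        proof -
          have "norm (?D \<omega>) * norm (X \<omega>) + norm (?D \<omega>) * norm (X' \<omega>) \<le>
              (h / 2 * (norm (X \<omega>))\<^sup>2 + 1 / (2 * h) * (norm (?D \<omega>))\<^sup>2) +
              (h / 2 * (norm (X' \<omega>))\<^sup>2 + 1 / (2 * h) * (norm (?D \<omega>))\<^sup>2)"
            by (rule add_mono[OF young young])
          also have "\<dots> = ?g \<omega>" using h by (simp add: field_simps)
          finally show ?thesis using pointwise[of \<omega>] by (simp add: mult.commute)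
        qed
      qed (use int sq_int in auto)
      also have "\<dots> = h / 2 * (\<integral>\<omega>. (norm (X \<omega>))\<^sup>2 \<partial>M) + h / 2 * (\<integral>\<omega>. (norm (X' \<omega>))\<^sup>2 \<partial>M) +
          1 / h * (\<integral>\<omega>. (norm (?D \<omega>))\<^sup>2 \<partial>M)"
        using sq_int by simp
      also have "\<dots> \<le> h / 2 * K + h / 2 * K + 1 / h * (L * \<delta>)"
        using h K L by (intro add_mono mult_left_mono) auto
      finally show ?thesis by (simp add: mult.commute)
    qed
    \<comment> \<open>The optimal weight is \<open>h = \<surd>\<delta>\<close>; for \<open>\<delta> = 0\<close> it degenerates and \<open>h \<rightarrow> 0\<close> is used instead.\<close>
    show ?thesis
    proof (cases "\<delta> = 0")
      case False
      then have "0 < sqrt \<delta>" using \<delta> by simp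
      from bound[OF this] have "\<bar>(second_moment M X - second_moment M X') $ i $ j\<bar> \<le> sqrt \<delta> * K + L * (\<delta> / sqrt \<delta>)"
        by simp
      then show ?thesis using \<delta> by (simp add: real_div_sqrt algebra_simps)
    next
      case True
      have "\<bar>(second_moment M X - second_moment M X') $ i $ j\<bar> \<le> 0"
      proof (rule field_le_epsilon)
        fix e :: real assume "0 < e"
        have "0 \<le> K" by (rule order_trans[OF _ K(1)]) simp
        have h: "0 < e / (K + 1)" using \<open>0 < e\<close> \<open>0 \<le> K\<close> by simp
        have "\<bar>(second_moment M X - second_moment M X') $ i $ j\<bar> \<le> e / (K + 1) * K" using bound[OF h] True by simp
        also have "\<dots> \<le> e" using \<open>0 < e\<close> \<open>0 \<le> K\<close> by (simp add: field_simps)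
        finally show "\<bar>(second_moment M X - second_moment M X') $ i $ j\<bar> \<le> 0 + e" by simp
      qed
      then show ?thesis using True by simp
    qed
  qed
  let ?A = "second_moment M X - second_moment M X'"
  have "norm ?A \<le> (\<Sum>i\<in>UNIV. norm (?A $ i))" by (simp add: norm_vec_def[of ?A] L2_set_le_sum)
  also have "\<dots> \<le> (\<Sum>i\<in>(UNIV :: 'k set). \<Sum>j\<in>(UNIV :: 'k set). (K + L) * sqrt \<delta>)"
    by (intro sum_mono order_trans[OF norm_le_l1_cart] entry)
  finally show ?thesis by (simp add: mult.assoc)
qed

section \<open>Explosion\<close>

text \<open>
  The two hitting times \<open>\<tau>\<^sup>1\<close> and \<open>\<tau>\<^sup>2\<close> are instances of one notion, applied to the norm of the
  inverse second moment matrix and to the mean square norm.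
\<close>

definition rise_time :: "real set \<Rightarrow> (real \<Rightarrow> real) \<Rightarrow> nat \<Rightarrow> ereal" where
  "rise_time J f n = Inf {ereal t | t. t \<in> J \<and> 0 < t \<and> f t = f 0 + real n}"

text \<open>
  Here \<open>S\<close> stands for the set of horizons on which a solution exists; continuity is known on the closed
  intervals \<open>[0, T]\<close> with \<open>T \<in> S\<close>, whose union \<open>J\<close> may be half-open.
\<close>

context
  fixes S J :: "real set" and f :: "real \<Rightarrow> real"
  assumes J: "J = (\<Union>T\<in>S. {0..T})"
    and cont: "\<forall>T\<in>S. continuous_on {0..T} f"
begin

text \<open>
  A continuous function passes level \<open>n\<close> on its way to level \<open>n + 1\<close>.  Level \<open>0\<close> has to be excluded,
  since the initial value may be attained at time \<open>0\<close> alone.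
\<close>

lemma rise_time_mono:
  assumes "1 \<le> n"
  shows "rise_time J f n \<le> rise_time J f (Suc n)"
  unfolding rise_time_def
proof (rule Inf_greatest)
  fix x assume "x \<in> {ereal t | t. t \<in> J \<and> 0 < t \<and> f t = f 0 + real (Suc n)}"
  then obtain t where t: "x = ereal t" "t \<in> J" "0 < t" "f t = f 0 + real (Suc n)" by blast
  then obtain T where T: "T \<in> S" "t \<le> T" using J by auto
  have "continuous_on {0..t} f" using bspec[OF cont T(1)] T(2) by (auto intro: continuous_on_subset)
  then obtain u where u: "0 \<le> u" "u \<le> t" "f u = f 0 + real n"
    using IVT'[of f 0 "f 0 + real n" t] t by auto
  moreover have "u \<noteq> 0" using u assms by (intro notI) simp
  moreover have "u \<in> J" using u T J by (auto intro: order_trans)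
  ultimately have "ereal u \<in> {ereal t | t. t \<in> J \<and> 0 < t \<and> f t = f 0 + real n}" by auto
  then show "Inf {ereal t | t. t \<in> J \<and> 0 < t \<and> f t = f 0 + real n} \<le> x"
    using u(2) t(1) by (meson Inf_lower ereal_less_eq(3) order_trans)
qed

lemma rise_time_positive:
  assumes "1 \<le> n"
  shows "0 < rise_time J f n"
proof (cases "\<exists>T\<in>S. 0 < T")
  case True
  then obtain T where T: "T \<in> S" "0 < T" by blast
  then obtain d where d: "0 < d" "\<And>x. x \<in> {0..T} \<Longrightarrow> dist x 0 < d \<Longrightarrow> dist (f x) (f 0) < 1"
    using bspec[OF cont T(1)] unfolding continuous_on_iff
    by (metis atLeastAtMost_iff less_imp_le order_refl zero_less_one)
  have "ereal (min d T) \<le> rise_time J f n"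
    unfolding rise_time_def
  proof (rule Inf_greatest, clarify)
    fix t assume t: "0 < t" "f t = f 0 + real n"
    then have "\<not> (t < d \<and> t \<le> T)" using d(2)[of t] assms by (auto simp: dist_real_def)
    then have "min d T \<le> t" by auto
    then show "ereal (min d T) \<le> ereal t" by (simp only: ereal_less_eq(3))
  qed
  moreover have "0 < ereal (min d T)" using d(1) T(2) by simp
  ultimately show ?thesis by (rule less_le_trans[rotated])
next
  case False
  then have "{ereal t | t. t \<in> J \<and> 0 < t \<and> f t = f 0 + real n} = {}"
    using J by force
  then show ?thesis unfolding rise_time_def by (simp only:) (simp add: top_ereal_def)
qed

text \<open>
  High levels are not reached on the compact interval \<open>[0, T]\<close>.  The inequality is strict: either the
  same holds on a larger interval, or there is no time after \<open>T\<close> in \<open>J\<close> at which the level could be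
  reached.
\<close>

lemma rise_time_eventually_greater:
  assumes "T \<in> S"
  shows "\<forall>\<^sub>F n in sequentially. ereal T < rise_time J f n"
proof -
  have *: "\<forall>\<^sub>F n in sequentially. \<forall>t\<in>{0..T}. f t \<noteq> f 0 + real n" if "T \<in> S" for T
  proof -
    have "bounded (f ` {0..T})"
      by (intro compact_imp_bounded compact_continuous_image bspec[OF cont that]) auto
    then obtain B where B: "\<forall>x\<in>f ` {0..T}. norm x \<le> B" unfolding bounded_iff ..
    obtain N :: nat where N: "B - f 0 < real N" using reals_Archimedean2 by blast
    show ?thesis
    proof (rule eventually_sequentiallyI[of N], intro ballI)
      fix n t assume "N \<le> n" "t \<in> {0..T}"
      then have "f t \<le> B" using B by (metis abs_le_D1 image_eqI real_norm_def)
      then show "f t \<noteq> f 0 + real n" using N \<open>N \<le> n\<close> by auto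
    qed
  qed
  show ?thesis
  proof (cases "\<exists>T'\<in>S. T < T'")
    case True
    then obtain T' where T': "T' \<in> S" "T < T'" by blast
    show ?thesis
      using *[OF T'(1)]
    proof eventually_elim
      case (elim n)
      have "ereal T' \<le> rise_time J f n"
        unfolding rise_time_def
      proof (rule Inf_greatest, clarify)
        fix t assume "0 < t" "f t = f 0 + real n"
        then have "\<not> t \<le> T'" using elim by auto
        then show "ereal T' \<le> ereal t" by simp
      qed
      then show ?case using T'(2) by (meson ereal_less(3) less_ereal.simps(1) less_le_trans)
    qed
  next
    case False
    show ?thesis
      using *[OF assms]
    proof eventually_elim
      case (elim n)
      have "{ereal t | t. t \<in> J \<and> 0 < t \<and> f t = f 0 + real n} = {}"
        using False elim J by (auto simp: not_less dest: order_trans)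
      then show ?case unfolding rise_time_def by (simp only:) (simp add: top_ereal_def)
    qed
  qed
qed

lemma rise_time_attained:
  assumes "rise_time J f n < \<infinity>"
  shows "\<exists>t\<in>J. 0 < t \<and> f t = f 0 + real n \<and> rise_time J f n \<le> ereal t"
proof -
  have "{ereal t | t. t \<in> J \<and> 0 < t \<and> f t = f 0 + real n} \<noteq> {}"
  proof
    assume "{ereal t | t. t \<in> J \<and> 0 < t \<and> f t = f 0 + real n} = {}"
    then show False using assms unfolding rise_time_def by (simp only:) (simp add: top_ereal_def)
  qed
  then obtain t where "t \<in> J" "0 < t" "f t = f 0 + real n" by blast
  moreover from this have "rise_time J f n \<le> ereal t"
    unfolding rise_time_def by (intro Inf_lower) auto
  ultimately show ?thesis by blast
qed

end

theorem proposition4p1: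
  fixes M :: "'w measure" and F :: "real \<Rightarrow> 'w measure"
    and W :: "real \<Rightarrow> 'w \<Rightarrow> real^'m"
    and a :: "real \<Rightarrow> real^'d \<Rightarrow> real^'d"
    and b :: "real \<Rightarrow> real^'d \<Rightarrow> real^'m^'d"
    and U0 :: "real^'d^'r" and Y0 :: "'w \<Rightarrow> real^'r"
    and U :: "real \<Rightarrow> real^'d^'r" and Y :: "real \<Rightarrow> 'w \<Rightarrow> real^'r"
    and J :: "real set" and Te :: ereal
  assumes "CARD('r) \<le> CARD('d)"
    and "usual_filtered_prob_space M F"
    and "brownian_motion M F W"
    and "jointly_measurable a" and "jointly_measurable b"
    and "lipschitz_condition a b"
    and "linear_growth_bound a b"
    and "orthonormal_rows U0"
    and "L2_vector M Y0" and "Y0 \<in> borel_measurable (F 0)"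
    and "linearly_independent_components M Y0"
    and "maximal_DO_solution M F W a b U0 Y0 U Y"
    and J_def: "J = DO_existence_interval M F W a b U0 Y0"
    and Te_def: "Te = explosion_time M J Y"
  shows "(\<lambda>n. tau M J Y n) \<longlonglongrightarrow> Te \<and>
         (Te = \<infinity> \<or> Te < \<infinity>) \<and>
         (Te < \<infinity> \<longrightarrow>
            0 < Te \<and> {t. 0 \<le> t \<and> ereal t < Te} \<subseteq> J \<and>
            filterlim (\<lambda>t. norm (matrix_inv (second_moment M (Y t)))) at_top
              (at_left (real_of_ereal Te)))"
proof -
  define S where "S = {T. 0 < T \<and> strong_DO_solution M F W a b T U0 Y0 U Y}"
  have J: "J = (\<Union>T\<in>S. {0..T})"
    using assms(12) unfolding J_def DO_existence_interval_def maximal_DO_solution_def S_def by blast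
  have S_pos: "0 < T" and sol: "strong_DO_solution M F W a b T U0 Y0 U Y" if "T \<in> S" for T
    using that by (auto simp: S_def)
  obtain C where C: "0 < C"
    "\<And>s x. 0 \<le> s \<Longrightarrow> (norm (a s x))\<^sup>2 + (norm (b s x))\<^sup>2 \<le> C * (1 + (norm x)\<^sup>2)"
    using assms(7) unfolding linear_growth_bound_def by blast
  define B where "B = (\<integral>\<omega>. (norm (Y 0 \<omega>))\<^sup>2 \<partial>M)"
  define K where "K T0 = moment_bound C T0 B" for T0
  define H where "H T0 = real (CARD('r) * CARD('r)) * (K T0 + (T0 + 2) * (2 * C * (1 + K T0)))" for T0
  let ?C = "\<lambda>t. second_moment M (Y t)"
  let ?f = "\<lambda>t. norm (matrix_inv (?C t))"
  let ?g = "\<lambda>t. L2_vector_norm M (Y t)"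
  have moment: "(\<integral>\<omega>. (norm (Y t \<omega>))\<^sup>2 \<partial>M) \<le> K T0" if "T \<in> S" "T \<le> T0" "t \<in> {0..T}" for T T0 t
    using DO_moment_bounds(1)[OF assms(2,3,5) C sol[OF that(1)] _ that(2) B_def[symmetric] K_def that(3)]
      S_pos[OF that(1)] by simp
  have increment: "(\<integral>\<omega>. (norm (Y t \<omega> - Y s \<omega>))\<^sup>2 \<partial>M) \<le> (T0 + 2) * (2 * C * (1 + K T0)) * (t - s)"
    if "T \<in> S" "T \<le> T0" "0 \<le> s" "s \<le> t" "t \<le> T" for T T0 s t
    using DO_moment_bounds(2)[OF assms(2,3,5) C sol[OF that(1)] _ that(2) B_def[symmetric] K_def that(3-5)]
      S_pos[OF that(1)] by simp
  have L2: "L2_vector M (Y t)" and det: "det (?C t) \<noteq> 0" if "T \<in> S" "t \<in> {0..T}" for T t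
  proof -
    have "L2_vector M (Y t)" "linearly_independent_components M (Y t)"
      using sol[OF that(1)] that(2) unfolding strong_DO_solution_def by blast+
    then show "L2_vector M (Y t)" "det (?C t) \<noteq> 0" using second_moment_nonsingular by auto
  qed
  have Hoelder: "norm (?C t - ?C s) \<le> H T0 * sqrt (t - s)"
    if "T \<in> S" "T \<le> T0" "0 \<le> s" "s \<le> t" "t \<le> T" for T T0 s t
    unfolding H_def
    using that by (intro second_moment_Hoelder L2[OF that(1)] moment[OF that(1,2)] increment[OF that(1,2)]) auto
  have C_uniform: "uniformly_continuous_on A ?C"
    if A: "\<And>s t. s \<in> A \<Longrightarrow> t \<in> A \<Longrightarrow> s \<le> t \<Longrightarrow> norm (?C t - ?C s) \<le> L * sqrt (t - s)" for A L
    unfolding uniformly_continuous_on_def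
  proof (intro allI impI)
    fix e :: real assume "0 < e"
    define L' where "L' = \<bar>L\<bar> + 1"
    have L': "0 < L'" "L \<le> L'" by (auto simp: L'_def)
    have close: "norm (?C t - ?C s) < e" if "s \<in> A" "t \<in> A" "s \<le> t" "t - s < (e / L')\<^sup>2" for s t
    proof -
      have "norm (?C t - ?C s) \<le> L' * sqrt (t - s)"
        using A[OF that(1-3)] mult_right_mono[OF L'(2), of "sqrt (t - s)"] that(3) by simp
      also have "\<dots> < L' * (e / L')"
        using that(3,4) L' \<open>0 < e\<close> by (intro mult_strict_left_mono real_less_lsqrt) auto
      finally show ?thesis using L' by simp
    qed
    show "\<exists>d>0. \<forall>x\<in>A. \<forall>x'\<in>A. dist x' x < d \<longrightarrow> dist (?C x') (?C x) < e"
    proof (intro exI[of _ "(e / L')\<^sup>2"] conjI ballI impI)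
      show "0 < (e / L')\<^sup>2" using L' \<open>0 < e\<close> by simp
      fix x x' assume "x \<in> A" "x' \<in> A" "dist x' x < (e / L')\<^sup>2"
      then show "dist (?C x') (?C x) < e"
        using close[of x x'] close[of x' x] by (cases "x \<le> x'") (auto simp: dist_norm dist_real_def norm_minus_commute)
    qed
  qed
  have C_cont: "continuous_on {0..T} ?C" if "T \<in> S" for T
    by (rule uniformly_continuous_imp_continuous, rule C_uniform[of _ "H T"])
      (use Hoelder[OF that order_refl] in auto)
  have f_cont: "\<forall>T\<in>S. continuous_on {0..T} ?f"
    using C_cont det by (intro ballI continuous_on_norm continuous_on_matrix_inv) auto
  have g_cont: "\<forall>T\<in>S. continuous_on {0..T} ?g"
  proof
    fix T assume "T \<in> S"
    have "continuous_on {0..T} (\<lambda>t. sqrt (\<Sum>i\<in>UNIV. ?C t $ i $ i))"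
      using C_cont[OF \<open>T \<in> S\<close>] by (intro continuous_intros)
    moreover have "sqrt (\<Sum>i\<in>UNIV. ?C t $ i $ i) = ?g t" if "t \<in> {0..T}" for t
      using second_moment_trace[OF L2[OF \<open>T \<in> S\<close> that]] by (simp add: L2_vector_norm_def)
    ultimately show "continuous_on {0..T} ?g" by (rule continuous_on_eq)
  qed
  have tau1: "tau1 M J Y n = rise_time J ?f n" and tau2: "tau2 M J Y n = rise_time J ?g n" for n
    by (simp_all add: tau1_def tau2_def rise_time_def)
  note rf = rise_time_mono[OF J f_cont] rise_time_positive[OF J f_cont]
    rise_time_eventually_greater[OF J f_cont] rise_time_attained[OF J f_cont]
  note rg = rise_time_mono[OF J g_cont] rise_time_positive[OF J g_cont]
    rise_time_eventually_greater[OF J g_cont]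
  let ?\<tau> = "\<lambda>n. tau M J Y n"
  have inc: "incseq (\<lambda>n. ?\<tau> (Suc n))"
    unfolding tau_def tau1 tau2 using rf(1) rg(1) by (intro incseq_SucI min.mono) auto
  define L where "L = (SUP n. ?\<tau> (Suc n))"
  have "(\<lambda>n. ?\<tau> (Suc n)) \<longlonglongrightarrow> L" unfolding L_def by (rule LIMSEQ_SUP[OF inc])
  then have lim: "?\<tau> \<longlonglongrightarrow> L" by (rule LIMSEQ_imp_Suc)
  then have Te: "Te = L" unfolding Te_def explosion_time_def by (rule limI)
  have le_Te: "?\<tau> n \<le> Te" if "1 \<le> n" for n
    unfolding Te L_def using SUP_upper[of "n - 1" UNIV "\<lambda>n. ?\<tau> (Suc n)"] that by simp
  have "0 < ?\<tau> 1" using rf(2)[of 1] rg(2)[of 1] by (simp add: tau_def tau1 tau2)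
  then have Te_pos: "0 < Te" using le_Te[of 1] by (rule less_le_trans) simp
  have explosion: "{t. 0 \<le> t \<and> ereal t < Te} \<subseteq> J \<and> filterlim ?f at_top (at_left (real_of_ereal Te))"
    if fin: "Te < \<infinity>"
  proof -
    obtain \<theta> where \<theta>: "Te = ereal \<theta>" "0 < \<theta>" using fin Te_pos by (cases Te) auto
    \<comment> \<open>On a compact interval of existence high levels are never reached, so no such interval contains \<open>\<theta>\<close>.\<close>
    have S_less: "T < \<theta>" if "T \<in> S" for T
    proof -
      have "\<forall>\<^sub>F n in sequentially. ereal T < ?\<tau> n \<and> 1 \<le> n"
        using rf(3)[OF that] rg(3)[OF that] eventually_ge_at_top[of "1::nat"]
        by eventually_elim (simp add: tau_def tau1 tau2)
      then obtain n where "ereal T < ?\<tau> n" "1 \<le> n" by (metis (mono_tags, lifting) eventually_happens' sequentially_bot)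
      then have "ereal T < Te" using less_le_trans[OF _ le_Te] by blast
      then show ?thesis by (simp add: \<theta>)
    qed
    \<comment> \<open>The second moments stay bounded up to \<open>\<theta>\<close>, so it is \<open>\<tau>\<^sup>1\<close> that accumulates at \<open>\<theta>\<close>.\<close>
    have g_bound: "?g t \<le> sqrt (K \<theta>)" if "t \<in> J" for t
    proof -
      obtain T where "T \<in> S" "t \<in> {0..T}" using \<open>t \<in> J\<close> J by blast
      then show ?thesis
        using moment[of T \<theta> t] S_less[of T] by (simp add: L2_vector_norm_def)
    qed
    obtain N :: nat where N: "sqrt (K \<theta>) - ?g 0 < real N" using reals_Archimedean2 by blast
    have tau2_inf: "rise_time J ?g n = \<infinity>" if "N \<le> n" for n
    proof -
      have "{ereal t | t. t \<in> J \<and> 0 < t \<and> ?g t = ?g 0 + real n} = {}"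
        using g_bound N that by force
      then show ?thesis unfolding rise_time_def by (simp only:) (simp add: top_ereal_def)
    qed
    have level: "\<exists>t\<in>J. 0 < t \<and> ?f t = ?f 0 + real n \<and> ?\<tau> n \<le> ereal t" if "N \<le> n" "1 \<le> n" for n
    proof -
      have "?\<tau> n = rise_time J ?f n" by (simp add: tau_def tau1 tau2 tau2_inf[OF that(1)])
      moreover have "?\<tau> n < \<infinity>" using le_Te[OF that(2)] fin by (rule le_less_trans)
      ultimately show ?thesis using rf(4)[of n] by simp
    qed
    have J_eq: "J = {0..<\<theta>}"
    proof
      show "J \<subseteq> {0..<\<theta>}" using J S_less by force
      show "{0..<\<theta>} \<subseteq> J"
      proof
        fix s assume s: "s \<in> {0..<\<theta>}"
        have "\<forall>\<^sub>F n in sequentially. ereal s < ?\<tau> n"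
        proof (rule order_tendstoD(1)[OF lim])
          have "ereal s < ereal \<theta>" using s by simp
          then show "ereal s < L" by (simp only: \<theta>(1)[symmetric] Te)
        qed
        then have "\<forall>\<^sub>F n in sequentially. ereal s < ?\<tau> n \<and> N \<le> n \<and> 1 \<le> n"
          using eventually_ge_at_top[of N] eventually_ge_at_top[of "1::nat"] by eventually_elim simp
        then obtain n where n: "ereal s < ?\<tau> n" "N \<le> n" "1 \<le> n"
          by (metis (mono_tags, lifting) eventually_happens' sequentially_bot)
        then obtain t where t: "t \<in> J" "?\<tau> n \<le> ereal t" using level by blast
        have "ereal s < ereal t" using n(1) t(2) by (rule less_le_trans)
        then have "s < t" by simp
        moreover obtain T where "T \<in> S" "t \<in> {0..T}" using t(1) J by blast
        ultimately show "s \<in> J" using s unfolding J by (intro UN_I[of T]) auto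
      qed
    qed
    \<comment> \<open>Uniform continuity lets the second moment matrix be continued to \<open>\<theta>\<close>.\<close>
    have "uniformly_continuous_on {0..<\<theta>} ?C"
    proof (rule C_uniform[of _ "H \<theta>"])
      fix s t assume st: "s \<in> {0..<\<theta>}" "t \<in> {0..<\<theta>}" "s \<le> t"
      then obtain T where "T \<in> S" "t \<in> {0..T}" using J J_eq by blast
      then show "norm (?C t - ?C s) \<le> H \<theta> * sqrt (t - s)"
        using st S_less[of T] by (intro Hoelder[of T]) auto
    qed
    then obtain G where G: "uniformly_continuous_on (closure {0..<\<theta>}) G" "\<And>t. t \<in> {0..<\<theta>} \<Longrightarrow> ?C t = G t"
      by (rule uniformly_continuous_on_extension_on_closure) blast
    have G_cont: "continuous_on {0..\<theta>} G"
      using uniformly_continuous_imp_continuous[OF G(1)] \<theta>(2) by simp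
    have det_C: "det (?C t) \<noteq> 0" if "t \<in> {0..<\<theta>}" for t using that det J J_eq by blast
    \<comment> \<open>An invertible limit would keep the inverse bounded, contradicting the levels reached.\<close>
    have "det (G \<theta>) = 0"
    proof (rule ccontr)
      assume "det (G \<theta>) \<noteq> 0"
      then have "det (G t) \<noteq> 0" if "t \<in> {0..\<theta>}" for t
        using that det_C[of t] G(2)[of t] by (cases "t = \<theta>") auto
      then have "bounded ((\<lambda>t. norm (matrix_inv (G t))) ` {0..\<theta>})"
        by (intro compact_imp_bounded compact_continuous_image continuous_on_norm continuous_on_matrix_inv G_cont) auto
      then obtain R where "\<forall>x \<in> (\<lambda>t. norm (matrix_inv (G t))) ` {0..\<theta>}. norm x \<le> R"
        unfolding bounded_iff ..
      then have R: "?f t \<le> R" if "t \<in> J" for t using that J_eq G(2)[of t] by auto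
      obtain n :: nat where n: "R - ?f 0 < real n" using reals_Archimedean2 by blast
      have "N \<le> N + Suc n" "1 \<le> N + Suc n" by auto
      from level[OF this] obtain t where t: "t \<in> J" "?f t = ?f 0 + real (N + Suc n)" by blast
      have "real n \<le> real (N + Suc n)" by simp
      then show False using R[OF t(1)] t(2) n by linarith
    qed
    have left: "\<forall>\<^sub>F t in at_left \<theta>. t \<in> {0..<\<theta>}"
      using eventually_at_left_real[OF \<theta>(2)] by eventually_elim auto
    have "continuous_on {0..\<theta>} (\<lambda>t. det (G t))"
      by (intro continuous_on_det continuous_intros G_cont)
    then have "((\<lambda>t. det (G t)) \<longlongrightarrow> det (G \<theta>)) (at \<theta> within {0..\<theta>})"
      using \<theta>(2) unfolding continuous_on by simp
    then have "((\<lambda>t. det (G t)) \<longlongrightarrow> 0) (at_left \<theta>)"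
      using \<open>det (G \<theta>) = 0\<close> \<theta>(2) by (simp add: at_within_Icc_at_left)
    then have "((\<lambda>t. det (?C t)) \<longlongrightarrow> 0) (at_left \<theta>)"
      by (rule Lim_transform_eventually) (use left G(2) in \<open>auto elim!: eventually_mono\<close>)
    then have "filterlim ?f at_top (at_left \<theta>)"
      by (rule norm_matrix_inv_blowup) (use left det_C in \<open>auto elim!: eventually_mono\<close>)
    then show ?thesis using J_eq by (auto simp: \<theta>)
  qed
  show ?thesis
    using lim Te Te_pos explosion by (auto simp: less_top[symmetric] top_ereal_def)
qed

end
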